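(* Let $X$ be an infinite-dimensional complex Banach space and let $T\in L(X)$. The following statements are equivalent. (i) $T$ is $g_z$-invertible. (ii) $T$ is $g_z$-Browder. (iii) There exists $(M,N)\in g_zKD(T)$ such that $T_M$ is Drazin invertible. (iv) There exists a Drazin invertible operator $S\in L(X)$ such that $TS=ST$, $STS=S$ and $T^2S-T$ is zeroloid (such an $S$ is called a $g_z$-inverse of $T$). (v) There exists a bounded projection $P$ on $X$ which commutes with $T$ such that $T+P$ is generalized Drazin invertible and $TP$ is zeroloid. (vi) There exists a bounded projection $P$ on $X$ commuting with $T$ such that there exist $U,V\in L(X)$ satisfying $P=TU=VT$, and $T(I-P)$ is zeroloid. (vii) $T$ is $g_z$-Kato and $\tilde p(T)=\tilde q(T)<\infty$.
   Context: $L(X)$ is the algebra of bounded linear operators on $X$. All operator notions below apply to bounded operators on any complex Banach space (including closed invariant subspaces, possibly $\{0\}$). For an operator $T$: $\mathcal{N}(T)$, $\mathcal{R}(T)$ are its kernel and range; the ascent is $p(T)=\inf\{n\in\mathbb{N}:\mathcal{N}(T^n)=\mathcal{N}(T^{n+1})\}$ and the descent is $q(T)=\inf\{n\in\mathbb{N}:\mathcal{R}(T^n)=\mathcal{R}(T^{n+1})\}$, with $\inf\emptyset=\infty$. $T_M$ is the restriction of $T$ to a $T$-invariant subspace $M$. $(M,N)\in\mathrm{Red}(T)$ means that $M,N$ are closed $T$-invariant subspaces with $X=M\oplus N$. $\mathrm{acc}\,A$ is the set of accumulation points of $A\subset\mathbb{C}$. $T$ is semi-regular if $\mathcal{R}(T)$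 is closed and $\mathcal{N}(T)\subset\mathcal{R}(T^n)$ for all $n\in\mathbb{N}$. $T$ is zeroloid if $\mathrm{acc}\,\sigma(T)\subset\{0\}$. $(M,N)\in g_zKD(T)$ means $(M,N)\in\mathrm{Red}(T)$, $T_M$ is semi-regular and $T_N$ is zeroloid; $T$ is $g_z$-Kato if such a pair exists. For $g_z$-Kato $T$, $\tilde p(T)=p(T_M)$ and $\tilde q(T)=q(T_M)$ for any $(M,N)\in g_zKD(T)$ (these do not depend on the choice of $(M,N)$). $T$ is left (resp. right) $g_z$-invertible if there is $(M,N)\in g_zKD(T)$ such that $T_M$ is bounded below (resp. surjective); $T$ is $g_z$-invertible if it is both left and right $g_z$-invertible. $T$ is Browder if it is Fredholm with finite ascent and descent. $T$ is $g_z$-Browder if there is $(M,N)\in\mathrm{Red}(T)$ with $T_M$ Browder and $T_N$ zeroloid. $T$ is Drazin invertible if there is a bounded operator $S$ commuting with $T$ such that $STS=S$ and $T^nST=T^n$ for some $n\in\mathbb{N}$ (equivalently $p(T)=q(T)<\infty$). $T$ is generalized Drazin invertible if there is $(M,N)\in\mathrm{Red}(T)$ with $T_M$ invertible and $T_N$ quasi-nilpotent (equivalently $0\notin\mathrm{acc}\,\sigma(T)$). *)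

theory Defs
  imports "HOL-Analysis.Analysis" "HOL-Library.Extended_Nat"
begin

class complex_banach = banach +
  fixes scaleC :: "complex \<Rightarrow> 'a \<Rightarrow> 'a"  (infixr "*\<^sub>C" 75)
  assumes scaleC_add_right: "c *\<^sub>C (x + y) = c *\<^sub>C x + c *\<^sub>C y"
    and scaleC_add_left: "(c + d) *\<^sub>C x = c *\<^sub>C x + d *\<^sub>C x"
    and scaleC_scaleC: "c *\<^sub>C (d *\<^sub>C x) = (c * d) *\<^sub>C x"
    and scaleC_of_real: "complex_of_real r *\<^sub>C x = r *\<^sub>R x"
    and norm_scaleC: "norm (c *\<^sub>C x) = cmod c * norm x"

global_interpretation complex_vector:
  vector_space "scaleC :: complex \<Rightarrow> 'a \<Rightarrow> 'a::complex_banach"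
proof unfold_locales
  show "1 *\<^sub>C x = x" for x :: 'a
    using scaleC_of_real[of 1 x] by simp
qed (simp_all add: scaleC_add_right scaleC_add_left scaleC_scaleC)

definition closed_subspace :: "'a::complex_banach set \<Rightarrow> bool" where
  "closed_subspace M \<longleftrightarrow> complex_vector.subspace M \<and> closed M"

definition finite_dim :: "'a::complex_banach set \<Rightarrow> bool" where
  "finite_dim V \<longleftrightarrow> (\<exists>B. finite B \<and> complex_vector.span B = V)"

text \<open>
  A Banach space is represented by a closed subspace \<open>M\<close> of the ambient space (the ambient
  space itself is \<open>UNIV\<close>), and a bounded operator on it by a function of which only the values
  on \<open>M\<close> matter. All notions below take \<open>M\<close> as their first argument and refer only to
  those values, so that the restriction \<open>T\<^sub>M\<close> is the function \<open>T\<close> itself, used with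
  the first argument \<open>M\<close>.
\<close>

definition bounded_ops :: "'a::complex_banach set \<Rightarrow> ('a \<Rightarrow> 'a) set" where
  "bounded_ops M = {T. T ` M \<subseteq> M
     \<and> (\<forall>x\<in>M. \<forall>y\<in>M. T (x + y) = T x + T y)
     \<and> (\<forall>c. \<forall>x\<in>M. T (c *\<^sub>C x) = c *\<^sub>C T x)
     \<and> (\<exists>K. \<forall>x\<in>M. norm (T x) \<le> K * norm x)}"

definition kernel :: "'a::complex_banach set \<Rightarrow> ('a \<Rightarrow> 'a) \<Rightarrow> 'a set" where
  "kernel M T = {x \<in> M. T x = 0}"

text \<open>The infimum of the empty set in \<^typ>\<open>enat\<close> is \<open>\<infinity>\<close>.\<close>

definition ascent :: "'a::complex_banach set \<Rightarrow> ('a \<Rightarrow> 'a) \<Rightarrow> enat" where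
  "ascent M T = Inf {enat n |n. kernel M (T ^^ n) = kernel M (T ^^ (n + 1))}"

definition descent :: "'a::complex_banach set \<Rightarrow> ('a \<Rightarrow> 'a) \<Rightarrow> enat" where
  "descent M T = Inf {enat n |n. (T ^^ n) ` M = (T ^^ (n + 1)) ` M}"

definition invertible_op :: "'a::complex_banach set \<Rightarrow> ('a \<Rightarrow> 'a) \<Rightarrow> bool" where
  "invertible_op M T \<longleftrightarrow> (\<exists>S\<in>bounded_ops M. \<forall>x\<in>M. S (T x) = x \<and> T (S x) = x)"

definition spectrum :: "'a::complex_banach set \<Rightarrow> ('a \<Rightarrow> 'a) \<Rightarrow> complex set" where
  "spectrum M T = {z. \<not> invertible_op M (\<lambda>x. z *\<^sub>C x - T x)}"

definition acc_points :: "complex set \<Rightarrow> complex set" where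
  "acc_points A = {z. z islimpt A}"

definition zeroloid :: "'a::complex_banach set \<Rightarrow> ('a \<Rightarrow> 'a) \<Rightarrow> bool" where
  "zeroloid M T \<longleftrightarrow> acc_points (spectrum M T) \<subseteq> {0}"

text \<open>Inclusion rather than equality, because the spectrum is empty on the space \<open>{0}\<close>.\<close>

definition quasi_nilpotent :: "'a::complex_banach set \<Rightarrow> ('a \<Rightarrow> 'a) \<Rightarrow> bool" where
  "quasi_nilpotent M T \<longleftrightarrow> spectrum M T \<subseteq> {0}"

definition semi_regular :: "'a::complex_banach set \<Rightarrow> ('a \<Rightarrow> 'a) \<Rightarrow> bool" where
  "semi_regular M T \<longleftrightarrow> closed (T ` M) \<and> (\<forall>n. kernel M T \<subseteq> (T ^^ n) ` M)"

definition bounded_below :: "'a::complex_banach set \<Rightarrow> ('a \<Rightarrow> 'a) \<Rightarrow> bool" where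
  "bounded_below M T \<longleftrightarrow> (\<exists>c>0. \<forall>x\<in>M. c * norm x \<le> norm (T x))"

definition surjective_op :: "'a::complex_banach set \<Rightarrow> ('a \<Rightarrow> 'a) \<Rightarrow> bool" where
  "surjective_op M T \<longleftrightarrow> T ` M = M"

text \<open>
  The second condition says that finitely many cosets span the quotient of \<open>M\<close> by the range,
  i.e. that the range has finite codimension in \<open>M\<close>.
\<close>

definition fredholm :: "'a::complex_banach set \<Rightarrow> ('a \<Rightarrow> 'a) \<Rightarrow> bool" where
  "fredholm M T \<longleftrightarrow> finite_dim (kernel M T)
     \<and> (\<exists>B. finite B \<and> B \<subseteq> M \<and> complex_vector.span (T ` M \<union> B) = M)"

definition browder :: "'a::complex_banach set \<Rightarrow> ('a \<Rightarrow> 'a) \<Rightarrow> bool" where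
  "browder M T \<longleftrightarrow> fredholm M T \<and> ascent M T < \<infinity> \<and> descent M T < \<infinity>"

definition drazin_invertible :: "'a::complex_banach set \<Rightarrow> ('a \<Rightarrow> 'a) \<Rightarrow> bool" where
  "drazin_invertible M T \<longleftrightarrow> (\<exists>S\<in>bounded_ops M.
     (\<forall>x\<in>M. S (T x) = T (S x)) \<and> (\<forall>x\<in>M. S (T (S x)) = S x)
     \<and> (\<exists>n. \<forall>x\<in>M. (T ^^ n) (S (T x)) = (T ^^ n) x))"

definition Red :: "'a::complex_banach set \<Rightarrow> ('a \<Rightarrow> 'a) \<Rightarrow> ('a set \<times> 'a set) set" where
  "Red Y T = {(M, N). closed_subspace M \<and> closed_subspace N \<and> T ` M \<subseteq> M \<and> T ` N \<subseteq> N
     \<and> {x + y |x y. x \<in> M \<and> y \<in> N} = Y \<and> M \<inter> N = {0}}"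

definition generalized_drazin_invertible :: "'a::complex_banach set \<Rightarrow> ('a \<Rightarrow> 'a) \<Rightarrow> bool" where
  "generalized_drazin_invertible Y T \<longleftrightarrow>
     (\<exists>(M, N)\<in>Red Y T. invertible_op M T \<and> quasi_nilpotent N T)"

definition gzKD :: "'a::complex_banach set \<Rightarrow> ('a \<Rightarrow> 'a) \<Rightarrow> ('a set \<times> 'a set) set" where
  "gzKD Y T = {(M, N). (M, N) \<in> Red Y T \<and> semi_regular M T \<and> zeroloid N T}"

definition gz_kato :: "'a::complex_banach set \<Rightarrow> ('a \<Rightarrow> 'a) \<Rightarrow> bool" where
  "gz_kato Y T \<longleftrightarrow> gzKD Y T \<noteq> {}"

text \<open>
  The next two values do not depend on the chosen decomposition; they are meaningful only for
  \<open>g\<^sub>z\<close>-Kato operators.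
\<close>

definition p_tilde :: "'a::complex_banach set \<Rightarrow> ('a \<Rightarrow> 'a) \<Rightarrow> enat" where
  "p_tilde Y T = ascent (fst (SOME MN. MN \<in> gzKD Y T)) T"

definition q_tilde :: "'a::complex_banach set \<Rightarrow> ('a \<Rightarrow> 'a) \<Rightarrow> enat" where
  "q_tilde Y T = descent (fst (SOME MN. MN \<in> gzKD Y T)) T"

definition left_gz_invertible :: "'a::complex_banach set \<Rightarrow> ('a \<Rightarrow> 'a) \<Rightarrow> bool" where
  "left_gz_invertible Y T \<longleftrightarrow> (\<exists>(M, N)\<in>gzKD Y T. bounded_below M T)"

definition right_gz_invertible :: "'a::complex_banach set \<Rightarrow> ('a \<Rightarrow> 'a) \<Rightarrow> bool" where
  "right_gz_invertible Y T \<longleftrightarrow> (\<exists>(M, N)\<in>gzKD Y T. surjective_op M T)"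

definition gz_invertible :: "'a::complex_banach set \<Rightarrow> ('a \<Rightarrow> 'a) \<Rightarrow> bool" where
  "gz_invertible Y T \<longleftrightarrow> left_gz_invertible Y T \<and> right_gz_invertible Y T"

definition gz_browder :: "'a::complex_banach set \<Rightarrow> ('a \<Rightarrow> 'a) \<Rightarrow> bool" where
  "gz_browder Y T \<longleftrightarrow> (\<exists>(M, N)\<in>Red Y T. browder M T \<and> zeroloid N T)"

definition bounded_projection :: "'a::complex_banach set \<Rightarrow> ('a \<Rightarrow> 'a) \<Rightarrow> bool" where
  "bounded_projection Y P \<longleftrightarrow> P \<in> bounded_ops Y \<and> (\<forall>x\<in>Y. P (P x) = P x)"

end

theory Submission
  imports Defs
begin

text \<open>
  All seven properties say that the space splits, by a bounded projection \<open>E\<close> commuting with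
  \<open>T\<close>, into a range on which \<open>T\<close> is bijective and a kernel on which \<open>T\<close> is zeroloid; such
  an \<open>E\<close> is called a \<open>gz_projection\<close> of \<open>T\<close> below, and each property is proved equivalent to
  its existence. The open mapping theorem makes invertibility on a closed subspace the same as
  bijectivity, and splits a space by a bounded projection whenever a closed subspace is a
  complement of an operator range. Hence spectra of direct sums can be computed by pure algebra,
  and decompositions may be regrouped: if \<open>T\<close> has finite ascent and descent on \<open>M\<close>, then for
  large \<open>n\<close> the subspace \<open>M\<close> splits into the range of \<open>T\<^sup>n\<close>, on which \<open>T\<close> is bijective, and
  the kernel of \<open>T\<^sup>n\<close>, on which \<open>T\<close> is nilpotent and which can be moved to the zeroloid summand
  (lemma \<open>finite_ascent_descent_imp_gz_projection\<close>). This covers Browder operators, Drazin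
  invertibility and finite \<open>p\<close> and \<open>q\<close>. A bijection has ascent and descent zero, which gives the
  converses.

  Left and right \<open>g\<^sub>z\<close>-invertibility may come from two different decompositions, and \<open>p\<close> and \<open>q\<close>
  are read off a decomposition that is merely chosen. So it has to be shown that bijectivity does
  not depend on the decomposition. Points \<open>z\<close> outside the spectra of both zeroloid summands occur
  arbitrarily close to \<open>0\<close>, and for them injectivity and surjectivity of \<open>z - T\<close> on the whole space
  are decided on the complement of either zeroloid summand. Injectivity and surjectivity then have to be carried
  between \<open>z = 0\<close> and small \<open>z\<close>: the backward orbits \<open>T x\<^bsub>n+1\<^esub> = x\<^sub>n\<close> supplied by the open mapping
  theorem give solutions \<open>\<Sum> z\<^sup>n x\<^sub>n\<close> of the perturbed equation. They show that surjectivity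
  persists for small \<open>z\<close>, and that a nonzero kernel of a semi-regular operator persists as well.

  The generalized Drazin invertibility of \<open>T + P\<close> needs the spectral projection at an isolated point
  of the spectrum. Instead of a contour integral of the resolvent it is obtained as the limit of
  averages over \<open>2\<^sup>j\<close>-th roots of unity: the average over \<open>n\<close> equidistant points of the circle of
  radius \<open>r\<close> is \<open>r\<^sup>n (r\<^sup>n - A\<^sup>n)\<^sup>-\<^sup>1\<close>, and this identity, compared for two radii, shows that the limit is
  idempotent; it also shows that \<open>A\<close> is invertible on the kernel of the limit and has no spectrum
  outside the circle on its range (lemma \<open>riesz_projection\<close>). The limit commutes with all bounded operators commuting with \<open>A\<close>,
  in particular with \<open>P\<close> and \<open>T\<close>, so the two splittings can be combined.

  The remaining two properties are algebraic: a \<open>g\<^sub>z\<close>-inverse is the inverse of \<open>T\<close> on the range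
  of \<open>E\<close>, extended by zero, and with \<open>P = T U = V T\<close> the operator \<open>T\<close> is bijective on the range of \<open>P\<close>.
\<close>

section \<open>The open mapping theorem on closed subspaces\<close>

text \<open>
  The usual argument by the Baire category theorem, applied to the closed range instead of to the
  whole target space. The conclusion gives preimages of controlled norm; this is the form in which
  openness is used.
\<close>

lemma open_mapping_bound:
  fixes f :: "'a::banach \<Rightarrow> 'b::banach"
  assumes sM: "subspace M" and cM: "closed M"
    and add: "\<And>x y. x \<in> M \<Longrightarrow> y \<in> M \<Longrightarrow> f (x + y) = f x + f y"
    and scl: "\<And>r x. x \<in> M \<Longrightarrow> f (r *\<^sub>R x) = r *\<^sub>R f x"
    and bd: "\<And>x. x \<in> M \<Longrightarrow> norm (f x) \<le> K * norm x"
    and cl: "closed (f ` M)"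
  shows "\<exists>C>0. \<forall>y\<in>f ` M. \<exists>x\<in>M. f x = y \<and> norm x \<le> C * norm y"
proof -
  let ?Y = "f ` M"
  have diff: "f (x - y) = f x - f y" if "x \<in> M" "y \<in> M" for x y
    using add[of x "(-1) *\<^sub>R y"] scl[of y "-1"] that subspace_scale[OF sM, of y "-1"] by simp
  have f0: "f 0 = 0" using diff[of 0 0] subspace_0[OF sM] by simp
  have sY: "subspace ?Y"
    unfolding subspace_def
  proof (intro conjI ballI allI)
    show "0 \<in> ?Y" using f0 subspace_0[OF sM] by force
    show "u + v \<in> ?Y" if uv: "u \<in> ?Y" "v \<in> ?Y" for u v
    proof -
      from uv obtain x y where "x \<in> M" "y \<in> M" "u = f x" "v = f y" by blast
      then show ?thesis using add subspace_add[OF sM] by (intro image_eqI[of _ _ "x + y"]) auto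
    qed
    show "r *\<^sub>R u \<in> ?Y" if u: "u \<in> ?Y" for r u
    proof -
      from u obtain x where "x \<in> M" "u = f x" by blast
      then show ?thesis using scl subspace_scale[OF sM] by (intro image_eqI[of _ _ "r *\<^sub>R x"]) auto
    qed
  qed
  define F where "F n = closure (f ` (M \<inter> cball 0 (real n)))" for n
  have FY: "F n \<subseteq> ?Y" for n
    unfolding F_def using cl by (intro closure_minimal) auto
  have UF: "\<Union>(range F) = ?Y"
  proof (intro equalityI subsetI)
    fix y assume "y \<in> ?Y"
    then obtain x where x: "x \<in> M" "y = f x" by auto
    obtain n where "norm x \<le> real n" using real_arch_simple by blast
    with x have "y \<in> F n" unfolding F_def using closure_subset by fastforce
    then show "y \<in> \<Union>(range F)" by blast
  qed (use FY in blast)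
  have "\<exists>n. (top_of_set ?Y) interior_of (F n) \<noteq> {}"
  proof (rule ccontr)
    assume "\<not> ?thesis"
    then have e: "\<And>n. (top_of_set ?Y) interior_of (F n) = {}" by blast
    have "(top_of_set ?Y) interior_of (\<Union>(range F)) = {}"
    proof (rule Baire_category_alt)
      show "completely_metrizable_space (top_of_set ?Y) \<or> locally_compact_space (top_of_set ?Y) \<and> regular_space (top_of_set ?Y)"
        by (rule disjI1, rule completely_metrizable_space_closedin[OF completely_metrizable_space_euclidean])
          (rule closed_closedin[THEN iffD1, OF cl])
      show "countable (range F)" by simp
      fix S assume "S \<in> range F"
      then obtain n where n: "S = F n" by blast
      have "closed (F n)" unfolding F_def by simp
      then have "closedin (top_of_set ?Y) (F n)" using FY[of n] by (simp add: closed_subset)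
      with e n show "closedin (top_of_set ?Y) S \<and> top_of_set ?Y interior_of S = {}" by simp
    qed
    moreover have "(top_of_set ?Y) interior_of (\<Union>(range F)) = ?Y"
      unfolding UF using interior_of_topspace[of "top_of_set ?Y"] by simp
    ultimately show False using subspace_0[OF sY] by blast
  qed
  then obtain n y0 where y0: "y0 \<in> (top_of_set ?Y) interior_of (F n)" by blast
  then obtain W where W: "openin (top_of_set ?Y) W" "y0 \<in> W" "W \<subseteq> F n"
    unfolding interior_of_def by auto
  then obtain e where e: "e > 0" "\<And>z. z \<in> ?Y \<Longrightarrow> dist z y0 < e \<Longrightarrow> z \<in> W"
    unfolding openin_euclidean_subtopology_iff by blast
  have y0Y: "y0 \<in> ?Y" and y0F: "y0 \<in> F n" using W FY by blast+
  have app: "\<exists>u\<in>M. norm u \<le> real n \<and> norm (f u - z) < d" if "z \<in> F n" "d > 0" for z d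
  proof -
    have "\<exists>w\<in>f ` (M \<inter> cball 0 (real n)). dist w z < d"
      using that unfolding F_def closure_approachable by blast
    then show ?thesis by (auto simp: dist_norm)
  qed
  \<comment> \<open>A vector of the range with norm \<open>e / 2\<close> is approximated by images of differences \<open>u - v\<close> of norm
    at most \<open>2 n\<close>; rescaling gives the factor \<open>4 n / e\<close>, and the summand \<open>1\<close> makes it positive for \<open>n = 0\<close>.\<close>
  define c where "c = 4 * real n / e + 1"
  have c: "c > 0" using e unfolding c_def by (simp add: add_nonneg_pos)
  have half: "\<exists>x\<in>M. norm x \<le> c * norm y \<and> norm (y - f x) \<le> norm y / 2" if y: "y \<in> ?Y" for y
  proof (cases "y = 0")
    case True
    then show ?thesis using f0 subspace_0[OF sM] by (intro bexI[of _ 0]) auto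
  next
    case False
    define t where "t = e / (2 * norm y)"
    have t: "t > 0" unfolding t_def using e False by simp
    have nt: "norm (t *\<^sub>R y) < e" unfolding t_def using e False by (simp add: field_simps)
    have "y0 + t *\<^sub>R y \<in> ?Y"
      using y0Y y sY by (intro subspace_add subspace_scale)
    then have "y0 + t *\<^sub>R y \<in> W" using e(2)[of "y0 + t *\<^sub>R y"] nt by (simp add: dist_norm)
    then have "y0 + t *\<^sub>R y \<in> F n" using W(3) by blast
    then obtain u where u: "u \<in> M" "norm u \<le> real n" "norm (f u - (y0 + t *\<^sub>R y)) < e / 8"
      using app[of "y0 + t *\<^sub>R y" "e / 8"] e(1) by auto
    obtain v where v: "v \<in> M" "norm v \<le> real n" "norm (f v - y0) < e / 8"
      using app[of y0 "e / 8"] y0F e(1) by auto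
    define x where "x = (1 / t) *\<^sub>R (u - v)"
    have uv: "u - v \<in> M" using u v sM by (intro subspace_diff)
    then have xM: "x \<in> M" unfolding x_def using sM by (intro subspace_scale)
    have "norm (u - v) \<le> 2 * real n" using norm_triangle_ineq4[of u v] u v by linarith
    then have "norm x \<le> (1 / t) * (2 * real n)"
      unfolding x_def using t by (simp add: divide_right_mono)
    also have "\<dots> = 4 * real n / e * norm y" unfolding t_def using e False by simp
    also have "\<dots> \<le> c * norm y" unfolding c_def by (intro mult_right_mono) auto
    finally have 1: "norm x \<le> c * norm y" .
    have "norm (t *\<^sub>R y - f (u - v)) \<le> norm (f u - (y0 + t *\<^sub>R y)) + norm (f v - y0)"
      using norm_triangle_ineq4[of "f v - y0" "f u - (y0 + t *\<^sub>R y)"]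
      unfolding diff[OF u(1) v(1)] by (simp add: algebra_simps)
    also have "\<dots> \<le> e / 4" using u v by linarith
    finally have 2: "norm (t *\<^sub>R y - f (u - v)) \<le> e / 4" .
    have "y - f x = (1 / t) *\<^sub>R (t *\<^sub>R y - f (u - v))"
      unfolding x_def using scl[OF uv] t by (simp add: algebra_simps)
    then have "norm (y - f x) = (1 / t) * norm (t *\<^sub>R y - f (u - v))" using t by simp
    also have "\<dots> \<le> (1 / t) * (e / 4)" using 2 t by (intro mult_left_mono) auto
    also have "\<dots> = norm y / 2" unfolding t_def using e False by simp
    finally show ?thesis using 1 xM by blast
  qed
  then obtain h where hM: "\<And>y. y \<in> ?Y \<Longrightarrow> h y \<in> M"
    and hn: "\<And>y. y \<in> ?Y \<Longrightarrow> norm (h y) \<le> c * norm y"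
    and hr: "\<And>y. y \<in> ?Y \<Longrightarrow> norm (y - f (h y)) \<le> norm y / 2" by metis
  have "\<exists>x\<in>M. f x = y \<and> norm x \<le> (2 * c) * norm y" if y: "y \<in> ?Y" for y
  proof -
    \<comment> \<open>Repeatedly correcting the error halves it at every step, so the corrections are summable.\<close>
    define r where "r k = ((\<lambda>z. z - f (h z)) ^^ k) y" for k
    have r0: "r 0 = y" and rS: "r (Suc k) = r k - f (h (r k))" for k
      unfolding r_def by simp_all
    have rY: "r k \<in> ?Y" for k
    proof (induction k)
      case (Suc k)
      then show ?case unfolding rS using hM sY by (intro subspace_diff) auto
    qed (use y r0 in simp)
    have rn: "norm (r k) \<le> norm y * (1/2) ^ k" for k
    proof (induction k)
      case (Suc k)
      have "norm (r (Suc k)) \<le> norm (r k) / 2" using hr[OF rY[of k]] by (simp add: rS)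
      then show ?case using Suc by simp
    qed (simp add: r0)
    define s where "s k = (\<Sum>i<k. h (r i))" for k
    have hb: "norm (h (r k)) \<le> c * norm y * (1/2) ^ k" for k
      using order_trans[OF hn[OF rY[of k]] mult_left_mono[OF rn[of k]]] c by (simp add: mult.assoc)
    have sg: "summable (\<lambda>k. c * norm y * (1/2::real) ^ k)" by (intro summable_mult summable_geometric) simp
    have sn: "summable (\<lambda>k. norm (h (r k)))"
      by (rule summable_comparison_test'[OF sg, of 0]) (use hb in simp)
    then have sh: "summable (\<lambda>k. h (r k))" by (rule summable_norm_cancel)
    define x where "x = (\<Sum>k. h (r k))"
    have sx: "s \<longlonglongrightarrow> x"
      using sh unfolding s_def x_def by (simp add: summable_LIMSEQ)
    have sM': "s k \<in> M" for k
      unfolding s_def using hM rY sM by (intro subspace_sum) auto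
    have xM: "x \<in> M" using closed_sequentially[OF cM] sM' sx by blast
    have fs: "f (s k) = y - r k" for k
    proof (induction k)
      case (Suc k)
      have "f (s (Suc k)) = f (s k) + f (h (r k))"
        using add[OF sM'[of k] hM[OF rY[of k]]] by (simp add: s_def)
      then show ?case using Suc by (simp add: rS)
    qed (simp add: s_def f0 r0)
    have "r \<longlonglongrightarrow> 0"
    proof (rule Lim_null_comparison)
      show "\<forall>\<^sub>F k in sequentially. norm (r k) \<le> norm y * (1/2) ^ k" using rn by simp
      show "(\<lambda>k. norm y * (1/2::real) ^ k) \<longlonglongrightarrow> 0"
        by (intro tendsto_mult_right_zero LIMSEQ_power_zero) simp
    qed
    then have l1: "(\<lambda>k. f (s k)) \<longlonglongrightarrow> y" unfolding fs by (auto intro: tendsto_eq_intros)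
    have l2: "(\<lambda>k. f (s k)) \<longlonglongrightarrow> f x"
    proof (rule LIM_zero_cancel, rule Lim_null_comparison)
      show "\<forall>\<^sub>F k in sequentially. norm (f (s k) - f x) \<le> K * norm (s k - x)"
        using bd[OF subspace_diff[OF sM sM' xM]] diff[OF sM' xM] by simp
      show "(\<lambda>k. K * norm (s k - x)) \<longlonglongrightarrow> 0"
        using sx by (intro tendsto_mult_right_zero tendsto_norm_zero LIM_zero)
    qed
    have fx: "f x = y" using l1 l2 LIMSEQ_unique by blast
    have "norm x \<le> (\<Sum>k. norm (h (r k)))" unfolding x_def by (rule summable_norm[OF sn])
    also have "\<dots> \<le> (\<Sum>k. c * norm y * (1/2) ^ k)" by (rule suminf_le[OF _ sn sg]) (use hb in simp)
    also have "\<dots> = c * norm y * 2"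
      by (subst suminf_mult) (simp_all add: suminf_geometric summable_geometric)
    finally show ?thesis using fx xM by (intro bexI[of _ x]) (auto simp: mult_ac)
  qed
  then show ?thesis using c by (intro exI[of _ "2 * c"]) auto
qed

section \<open>Bounded operators on a closed subspace\<close>

lemma complex_subspace_imp_subspace: "subspace M" if "complex_vector.subspace M" for M :: "'a::complex_banach set"
proof -
  have "r *\<^sub>R x \<in> M" if "x \<in> M" for r x
    using complex_vector.subspace_scale[OF \<open>complex_vector.subspace M\<close> that, of "complex_of_real r"]
    by (simp add: scaleC_of_real)
  then show ?thesis
    using that complex_vector.subspace_0 complex_vector.subspace_add unfolding subspace_def by blast
qed

lemma closed_subspace_UNIV: "closed_subspace UNIV"
  by (simp add: closed_subspace_def)

context
  fixes M :: "'a::complex_banach set"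
  assumes M: "closed_subspace M"
begin

lemma closed_subspace_real: "subspace M"
  using M complex_subspace_imp_subspace by (auto simp: closed_subspace_def)

lemma closed_subspace_closed: "closed M"
  using M by (simp add: closed_subspace_def)

lemma closed_subspace_0: "0 \<in> M"
  using closed_subspace_real subspace_0 by blast

lemma closed_subspace_add: "x \<in> M \<Longrightarrow> y \<in> M \<Longrightarrow> x + y \<in> M"
  using closed_subspace_real subspace_add by blast

lemma closed_subspace_diff: "x \<in> M \<Longrightarrow> y \<in> M \<Longrightarrow> x - y \<in> M"
  using closed_subspace_real subspace_diff by blast

lemma closed_subspace_minus: "x \<in> M \<Longrightarrow> - x \<in> M"
  using closed_subspace_real subspace_neg by blast

lemma closed_subspace_scaleC: "x \<in> M \<Longrightarrow> c *\<^sub>C x \<in> M"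
  using M complex_vector.subspace_scale by (auto simp: closed_subspace_def)

lemma closed_subspace_scaleR: "x \<in> M \<Longrightarrow> r *\<^sub>R x \<in> M"
  using closed_subspace_real subspace_scale by blast

lemma closed_subspace_sum: "(\<And>i. i \<in> I \<Longrightarrow> f i \<in> M) \<Longrightarrow> sum f I \<in> M"
  using closed_subspace_real subspace_sum by blast

context
  fixes T :: "'a \<Rightarrow> 'a"
  assumes T: "T \<in> bounded_ops M"
begin

lemma op_in: "x \<in> M \<Longrightarrow> T x \<in> M"
  using T by (auto simp: bounded_ops_def)

lemma op_add: "x \<in> M \<Longrightarrow> y \<in> M \<Longrightarrow> T (x + y) = T x + T y"
  using T by (auto simp: bounded_ops_def)

lemma op_scaleC: "x \<in> M \<Longrightarrow> T (c *\<^sub>C x) = c *\<^sub>C T x"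
  using T by (auto simp: bounded_ops_def)

lemma op_scaleR: "x \<in> M \<Longrightarrow> T (r *\<^sub>R x) = r *\<^sub>R T x"
  using op_scaleC[of x "complex_of_real r"] by (simp add: scaleC_of_real)

lemma op_0: "T 0 = 0"
  using op_scaleR[OF closed_subspace_0, of 0] by simp

lemma op_minus: "x \<in> M \<Longrightarrow> T (- x) = - T x"
  using op_scaleR[of x "-1"] by simp

lemma op_diff: "x \<in> M \<Longrightarrow> y \<in> M \<Longrightarrow> T (x - y) = T x - T y"
  using op_add[of x "- y"] op_minus closed_subspace_minus by simp

lemma op_sum: "(\<And>i. i \<in> I \<Longrightarrow> f i \<in> M) \<Longrightarrow> T (sum f I) = (\<Sum>i\<in>I. T (f i))"
proof (induction I rule: infinite_finite_induct)
  case (insert i I)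
  have "T (f i + sum f I) = T (f i) + T (sum f I)"
    using insert.prems by (intro op_add closed_subspace_sum) auto
  then show ?case using insert by simp
qed (simp_all add: op_0)

lemma op_bound: "\<exists>K>0. \<forall>x\<in>M. norm (T x) \<le> K * norm x"
proof -
  obtain K where "\<forall>x\<in>M. norm (T x) \<le> K * norm x"
    using T by (auto simp: bounded_ops_def)
  then have "\<forall>x\<in>M. norm (T x) \<le> max K 1 * norm x"
    by (meson max.cobounded1 mult_right_mono norm_ge_zero order_trans)
  then show ?thesis by (intro exI[of _ "max K 1"]) auto
qed

lemma op_tendsto:
  assumes "\<And>n. u n \<in> M" "u \<longlonglongrightarrow> x" "x \<in> M"
  shows "(\<lambda>n. T (u n)) \<longlonglongrightarrow> T x"
proof -
  obtain K where K: "\<forall>x\<in>M. norm (T x) \<le> K * norm x" using op_bound by blast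
  show ?thesis
  proof (rule LIM_zero_cancel, rule Lim_null_comparison)
    show "\<forall>\<^sub>F n in sequentially. norm (T (u n) - T x) \<le> K * norm (u n - x)"
    proof (rule always_eventually, rule allI)
      fix n show "norm (T (u n) - T x) \<le> K * norm (u n - x)"
        using K closed_subspace_diff[OF assms(1)[of n] assms(3)] op_diff[OF assms(1)[of n] assms(3)]
        by fastforce
    qed
    show "(\<lambda>n. K * norm (u n - x)) \<longlonglongrightarrow> 0"
      using assms(2) by (intro tendsto_mult_right_zero tendsto_norm_zero LIM_zero)
  qed
qed

lemma op_kernel_closed_subspace: "closed_subspace {x \<in> M. T x = 0}"
proof -
  have "closed {x \<in> M. T x = 0}"
  proof (unfold closed_sequential_limits, intro allI impI, elim conjE)
    fix u x assume u: "\<forall>n. u n \<in> {x \<in> M. T x = 0}" "u \<longlonglongrightarrow> x"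
    then have "x \<in> M" using closed_subspace_closed closed_sequentially by blast
    moreover from u this have "(\<lambda>n. T (u n)) \<longlonglongrightarrow> T x" by (intro op_tendsto) auto
    ultimately show "x \<in> {x \<in> M. T x = 0}"
      using u(1) by (simp add: LIMSEQ_const_iff)
  qed
  then show ?thesis
    unfolding closed_subspace_def complex_vector.subspace_def
    using closed_subspace_0 closed_subspace_add closed_subspace_scaleC op_0 op_add op_scaleC by auto
qed

lemma op_image_subspace: "complex_vector.subspace (T ` M)"
  unfolding complex_vector.subspace_def
proof (intro conjI ballI allI)
  show "0 \<in> T ` M" using op_0 closed_subspace_0 by force
next
  fix u v assume "u \<in> T ` M" "v \<in> T ` M"
  then obtain x y where "x \<in> M" "y \<in> M" "u = T x" "v = T y" by blast
  then show "u + v \<in> T ` M"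
    using op_add closed_subspace_add by (intro image_eqI[of _ _ "x + y"]) auto
next
  fix c u assume "u \<in> T ` M"
  then obtain x where "x \<in> M" "u = T x" by blast
  then show "c *\<^sub>C u \<in> T ` M"
    using op_scaleC closed_subspace_scaleC by (intro image_eqI[of _ _ "c *\<^sub>C x"]) auto
qed

lemma op_lift_bound:
  assumes "closed (T ` M)"
  shows "\<exists>C>0. \<forall>y\<in>T ` M. \<exists>x\<in>M. T x = y \<and> norm x \<le> C * norm y"
proof -
  obtain K where "\<forall>x\<in>M. norm (T x) \<le> K * norm x" using op_bound by blast
  then show ?thesis
    by (intro open_mapping_bound[where K = K] closed_subspace_real closed_subspace_closed op_add
        op_scaleR assms) blast+
qed

lemma op_inj_iff: "inj_on T M \<longleftrightarrow> (\<forall>x\<in>M. T x = 0 \<longrightarrow> x = 0)"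
proof
  assume "inj_on T M"
  then show "\<forall>x\<in>M. T x = 0 \<longrightarrow> x = 0"
    using op_0 closed_subspace_0 unfolding inj_on_def by fastforce
next
  assume *: "\<forall>x\<in>M. T x = 0 \<longrightarrow> x = 0"
  show "inj_on T M"
  proof (rule inj_onI)
    fix x y assume "x \<in> M" "y \<in> M" "T x = T y"
    then have "T (x - y) = 0" "x - y \<in> M" using op_diff[of x y] closed_subspace_diff[of x y] by auto
    then have "x - y = 0" using * by blast
    then show "x = y" by simp
  qed
qed

lemma inj_closed_range_imp_bounded_below:
  assumes "inj_on T M" "closed (T ` M)"
  shows "bounded_below M T"
proof -
  obtain C where C: "C > 0" "\<forall>y\<in>T ` M. \<exists>x\<in>M. T x = y \<and> norm x \<le> C * norm y"
    using op_lift_bound assms by blast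
  have "(1 / C) * norm x \<le> norm (T x)" if x: "x \<in> M" for x
  proof -
    obtain x' where "x' \<in> M" "T x' = T x" "norm x' \<le> C * norm (T x)" using C x by blast
    then have "norm x \<le> C * norm (T x)" using assms(1) x by (metis inj_onD)
    then show ?thesis using C by (simp add: field_simps)
  qed
  then show ?thesis unfolding bounded_below_def using C by (intro exI[of _ "1 / C"]) auto
qed

text \<open>
  The inverse mapping theorem. From here on spectra are treated as failures of bijectivity.
\<close>

lemma invertible_op_iff_bij: "invertible_op M T \<longleftrightarrow> bij_betw T M M"
proof
  assume "invertible_op M T"
  then obtain S where "S \<in> bounded_ops M" "\<forall>x\<in>M. S (T x) = x \<and> T (S x) = x"
    unfolding invertible_op_def by blast
  moreover from this have "S ` M \<subseteq> M" by (auto simp: bounded_ops_def)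
  ultimately show "bij_betw T M M"
    using op_in by (intro bij_betw_byWitness[where f' = S]) auto
next
  assume b: "bij_betw T M M"
  define S where "S = inv_into M T"
  have SM: "S y \<in> M" "T (S y) = y" if "y \<in> M" for y
    using that b unfolding S_def bij_betw_def by (auto intro: inv_into_into f_inv_into_f)
  have ST: "S (T x) = x" if "x \<in> M" for x
    using that b unfolding S_def bij_betw_def by auto
  have inj: "x = y" if "x \<in> M" "y \<in> M" "T x = T y" for x y
    using that b by (auto simp: bij_betw_def inj_on_def)
  obtain c where c: "c > 0" "\<forall>x\<in>M. c * norm x \<le> norm (T x)"
    using inj_closed_range_imp_bounded_below b closed_subspace_closed
    unfolding bounded_below_def bij_betw_def by auto
  have "S \<in> bounded_ops M"
    unfolding bounded_ops_def
  proof (intro CollectI conjI ballI allI)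
    show "S ` M \<subseteq> M" using SM by auto
    show "S (x + y) = S x + S y" if "x \<in> M" "y \<in> M" for x y
      by (rule inj) (simp_all add: that SM closed_subspace_add op_add)
    show "S (a *\<^sub>C x) = a *\<^sub>C S x" if "x \<in> M" for a x
      by (rule inj) (simp_all add: that SM closed_subspace_scaleC op_scaleC)
    have "norm (S x) \<le> (1 / c) * norm x" if "x \<in> M" for x
    proof -
      have "c * norm (S x) \<le> norm (T (S x))" using c(2) SM(1)[OF that] by blast
      then show ?thesis using SM(2)[OF that] c(1) by (simp add: field_simps)
    qed
    then show "\<exists>K. \<forall>x\<in>M. norm (S x) \<le> K * norm x" by blast
  qed
  then show "invertible_op M T" unfolding invertible_op_def using SM ST by blast
qed

end
end

lemma bounded_opsI:
  assumes "\<And>x. x \<in> M \<Longrightarrow> T x \<in> M"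
    and "\<And>x y. x \<in> M \<Longrightarrow> y \<in> M \<Longrightarrow> T (x + y) = T x + T y"
    and "\<And>c x. x \<in> M \<Longrightarrow> T (c *\<^sub>C x) = c *\<^sub>C T x"
    and "\<And>x. x \<in> M \<Longrightarrow> norm (T x) \<le> K * norm x"
  shows "T \<in> bounded_ops M"
  unfolding bounded_ops_def
proof (intro CollectI conjI exI[of _ K] ballI allI)
  show "T ` M \<subseteq> M" using assms(1) by (rule image_subsetI)
qed (fact assms)+

lemma bounded_ops_id: "(\<lambda>x. x) \<in> bounded_ops M"
  by (rule bounded_opsI[where K = 1]) auto

lemma bounded_ops_restrict:
  assumes "T \<in> bounded_ops M" "N \<subseteq> M" "\<And>x. x \<in> N \<Longrightarrow> T x \<in> N"
  shows "T \<in> bounded_ops N"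
proof -
  obtain K where "\<forall>x\<in>M. norm (T x) \<le> K * norm x" using assms(1) by (auto simp: bounded_ops_def)
  with assms show ?thesis by (intro bounded_opsI[where K = K]) (auto simp: bounded_ops_def subset_iff)
qed

lemma bounded_ops_compose:
  assumes S: "S \<in> bounded_ops M" and T: "T \<in> bounded_ops M" and M: "closed_subspace M"
  shows "(\<lambda>x. S (T x)) \<in> bounded_ops M"
proof -
  obtain K where K: "K > 0" "\<forall>x\<in>M. norm (S x) \<le> K * norm x" using op_bound[OF M S] by blast
  obtain L where L: "L > 0" "\<forall>x\<in>M. norm (T x) \<le> L * norm x" using op_bound[OF M T] by blast
  show ?thesis
  proof (rule bounded_opsI[where K = "K * L"])
    show "norm (S (T x)) \<le> K * L * norm x" if "x \<in> M" for x
    proof -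
      have "norm (S (T x)) \<le> K * norm (T x)" using K op_in[OF M T that] by blast
      also have "\<dots> \<le> K * (L * norm x)" using K L that by (intro mult_left_mono) auto
      finally show ?thesis by (simp add: mult_ac)
    qed
  qed (simp_all add: op_in[OF M S] op_in[OF M T] op_add[OF M S] op_add[OF M T] op_scaleC[OF M S] op_scaleC[OF M T])
qed

lemma bounded_ops_add:
  assumes S: "S \<in> bounded_ops M" and T: "T \<in> bounded_ops M" and M: "closed_subspace M"
  shows "(\<lambda>x. S x + T x) \<in> bounded_ops M"
proof -
  obtain K where K: "K > 0" "\<forall>x\<in>M. norm (S x) \<le> K * norm x" using op_bound[OF M S] by blast
  obtain L where L: "L > 0" "\<forall>x\<in>M. norm (T x) \<le> L * norm x" using op_bound[OF M T] by blast
  show ?thesis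
  proof (rule bounded_opsI[where K = "K + L"])
    show "norm (S x + T x) \<le> (K + L) * norm x" if "x \<in> M" for x
      using norm_triangle_ineq[of "S x" "T x"] K L that by (fastforce simp: algebra_simps)
    show "S x + T x \<in> M" if "x \<in> M" for x
      using closed_subspace_add[OF M op_in[OF M S that] op_in[OF M T that]] .
  qed (simp_all add: op_add[OF M S] op_add[OF M T] op_scaleC[OF M S] op_scaleC[OF M T] scaleC_add_right)
qed

lemma bounded_ops_scaleC:
  assumes T: "T \<in> bounded_ops M" and M: "closed_subspace M"
  shows "(\<lambda>x. c *\<^sub>C T x) \<in> bounded_ops M"
proof -
  obtain K where K: "K > 0" "\<forall>x\<in>M. norm (T x) \<le> K * norm x" using op_bound[OF M T] by blast
  show ?thesis
  proof (rule bounded_opsI[where K = "cmod c * K"])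
    show "norm (c *\<^sub>C T x) \<le> cmod c * K * norm x" if "x \<in> M" for x
      using K that by (simp add: norm_scaleC mult.assoc mult_left_mono)
    show "c *\<^sub>C T x \<in> M" if "x \<in> M" for x
      using closed_subspace_scaleC[OF M op_in[OF M T that]] .
  qed (simp_all add: op_add[OF M T] op_scaleC[OF M T] scaleC_add_right scaleC_scaleC mult.commute)
qed

lemma scaleC_minus1: "(-1) *\<^sub>C x = - (x::'a::complex_banach)"
  using scaleC_of_real[of "-1" x] by simp

lemma bounded_ops_minus:
  assumes T: "T \<in> bounded_ops M" and M: "closed_subspace M"
  shows "(\<lambda>x. - T x) \<in> bounded_ops M"
  using bounded_ops_scaleC[OF assms, of "-1"] by (simp add: scaleC_minus1)

lemma bounded_ops_diff:
  assumes S: "S \<in> bounded_ops M" and T: "T \<in> bounded_ops M" and M: "closed_subspace M"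
  shows "(\<lambda>x. S x - T x) \<in> bounded_ops M"
  using bounded_ops_add[OF S bounded_ops_minus[OF T M] M] by simp

lemma bounded_ops_shift:
  assumes T: "T \<in> bounded_ops M" and M: "closed_subspace M"
  shows "(\<lambda>x. z *\<^sub>C x - T x) \<in> bounded_ops M"
  using bounded_ops_diff[OF bounded_ops_scaleC[OF bounded_ops_id M] T M] .

lemma bounded_ops_funpow:
  assumes T: "T \<in> bounded_ops M" and M: "closed_subspace M"
  shows "T ^^ n \<in> bounded_ops M"
proof (induction n)
  case 0
  then show ?case using bounded_ops_id by (simp add: id_def)
next
  case (Suc n)
  then show ?case using bounded_ops_compose[OF T Suc M] by (simp add: o_def)
qed

lemma spectrum_iff_not_bij:
  assumes "closed_subspace M" "T \<in> bounded_ops M"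
  shows "z \<in> spectrum M T \<longleftrightarrow> \<not> bij_betw (\<lambda>x. z *\<^sub>C x - T x) M M"
  unfolding spectrum_def mem_Collect_eq
  by (subst invertible_op_iff_bij[OF assms(1) bounded_ops_shift[OF assms(2,1)]]) (rule refl)

section \<open>Projections, direct sums and spectra\<close>

text \<open>
  A range with a closed complement is itself closed, and the projection onto it is bounded. The map \<open>(x, y) \<mapsto> f x + y\<close> from \<open>D \<times> N\<close> is onto, so by the open
  mapping theorem every vector has a decomposition whose parts are bounded by a multiple of its norm;
  the decomposition is unique and therefore linear.
\<close>

lemma projection_onto_operator_range:
  fixes f :: "'a::complex_banach \<Rightarrow> 'a"
  assumes D: "closed_subspace D" and N: "closed_subspace N" and f: "f \<in> bounded_ops D"
    and sum: "\<And>z. \<exists>x\<in>D. \<exists>y\<in>N. z = f x + y" and int: "f ` D \<inter> N \<subseteq> {0}"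
  shows "\<exists>E. bounded_projection UNIV E \<and> range E = f ` D \<and> {x. E x = 0} = N"
proof -
  define g where "g p = f (fst p) + snd p" for p :: "'a \<times> 'a"
  obtain K where K: "K > 0" "\<forall>x\<in>D. norm (f x) \<le> K * norm x" using op_bound[OF D f] by blast
  have g_onto: "g ` (D \<times> N) = UNIV" using sum unfolding g_def by force
  have "\<exists>C>0. \<forall>z\<in>g ` (D \<times> N). \<exists>p\<in>D \<times> N. g p = z \<and> norm p \<le> C * norm z"
  proof (rule open_mapping_bound[where K = "K + 1"])
    show "subspace (D \<times> N)" using D N by (intro subspace_Times closed_subspace_real)
    show "closed (D \<times> N)" using D N by (intro closed_Times closed_subspace_closed)
    show "closed (g ` (D \<times> N))" unfolding g_onto by simp
    show "g (p + q) = g p + g q" if "p \<in> D \<times> N" "q \<in> D \<times> N" for p q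
      using that op_add[OF D f, of "fst p" "fst q"] by (auto simp: g_def)
    show "g (r *\<^sub>R p) = r *\<^sub>R g p" if "p \<in> D \<times> N" for r p
      using that op_scaleR[OF D f, of "fst p" r] by (auto simp: g_def scaleR_right_distrib)
    show "norm (g p) \<le> (K + 1) * norm p" if p: "p \<in> D \<times> N" for p
    proof -
      have "norm (g p) \<le> norm (f (fst p)) + norm (snd p)" unfolding g_def by (rule norm_triangle_ineq)
      also have "\<dots> \<le> K * norm (fst p) + norm (snd p)" using K p by (intro add_right_mono) auto
      also have "\<dots> \<le> K * norm p + norm p"
        using K(1) norm_fst_le[of "fst p" "snd p"] norm_snd_le[of "snd p" "fst p"]
        by (intro add_mono mult_left_mono) auto
      finally show ?thesis by (simp add: algebra_simps)
    qed
  qed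
  then obtain C where C: "C > 0" "\<And>z. \<exists>p\<in>D \<times> N. g p = z \<and> norm p \<le> C * norm z"
    unfolding g_onto by auto
  define R where "R = f ` D"
  have R: "complex_vector.subspace R" unfolding R_def by (rule op_image_subspace[OF D f])
  have R_diff: "u - v \<in> R" if "u \<in> R" "v \<in> R" for u v
    using complex_vector.subspace_diff[OF R] that by blast
  have "\<exists>u\<in>R. z - u \<in> N \<and> norm u \<le> K * C * norm z" for z
  proof -
    obtain p where p: "p \<in> D \<times> N" "g p = z" "norm p \<le> C * norm z" using C by blast
    have "norm (f (fst p)) \<le> K * norm (fst p)" using K p by auto
    also have "\<dots> \<le> K * norm p"
      using K(1) norm_fst_le[of "fst p" "snd p"] by (intro mult_left_mono) auto
    also have "\<dots> \<le> K * (C * norm z)" using K(1) p(3) by (intro mult_left_mono) auto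
    finally show ?thesis
      using p unfolding R_def g_def by (intro bexI[of _ "f (fst p)"]) (auto simp: mult.assoc)
  qed
  then obtain E where E: "\<And>z. E z \<in> R" "\<And>z. z - E z \<in> N" "\<And>z. norm (E z) \<le> K * C * norm z"
    by metis
  have uniq: "E z = u" if "u \<in> R" "z - u \<in> N" for z u
  proof -
    have "E z - u \<in> R" using R_diff E that by blast
    moreover have "E z - u = (z - u) - (z - E z)" by simp
    then have "E z - u \<in> N" using closed_subspace_diff[OF N that(2) E(2)[of z]] by simp
    ultimately show ?thesis using int unfolding R_def by auto
  qed
  have "E \<in> bounded_ops UNIV"
  proof (rule bounded_opsI[where K = "K * C"])
    show "E (x + y) = E x + E y" for x y
    proof (rule uniq)
      show "E x + E y \<in> R" using complex_vector.subspace_add[OF R] E by blast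
      show "x + y - (E x + E y) \<in> N"
        using closed_subspace_add[OF N E(2)[of x] E(2)[of y]] by (simp add: algebra_simps)
    qed
    show "E (c *\<^sub>C x) = c *\<^sub>C E x" for c x
    proof (rule uniq)
      show "c *\<^sub>C E x \<in> R" using complex_vector.subspace_scale[OF R] E by blast
      show "c *\<^sub>C x - c *\<^sub>C E x \<in> N"
        using closed_subspace_scaleC[OF N E(2)[of x], of c]
        by (simp add: complex_vector.scale_right_diff_distrib)
    qed
  qed (use E in auto)
  moreover have fix': "E u = u" if "u \<in> R" for u
    using that closed_subspace_0[OF N] by (intro uniq) auto
  moreover have "range E = R"
  proof (intro equalityI subsetI)
    show "u \<in> range E" if "u \<in> R" for u using fix'[OF that] by (intro image_eqI[of _ E u]) auto
  qed (use E(1) in auto)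
  moreover have "E x = 0 \<longleftrightarrow> x \<in> N" for x
    using E(2)[of x] uniq[of 0 x] complex_vector.subspace_0[OF R] by auto
  ultimately show ?thesis
    using E(1) by (intro exI[of _ E]) (auto simp: bounded_projection_def R_def[symmetric])
qed

text \<open>
  An operator \<open>A\<close> on \<open>Y\<close> together with a commuting projection \<open>E\<close>. The space \<open>Y\<close> is the direct sum of
  the two invariant subspaces \<open>E ` Y\<close> and \<open>K\<close>, and the properties of \<open>A\<close> can be checked on the two
  summands separately.
\<close>

locale reduced_operator =
  fixes Y :: "'a::complex_banach set" and A E :: "'a \<Rightarrow> 'a"
  assumes Y: "closed_subspace Y" and A: "A \<in> bounded_ops Y" and E: "E \<in> bounded_ops Y"
    and idem: "\<And>y. y \<in> Y \<Longrightarrow> E (E y) = E y"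
    and comm: "\<And>y. y \<in> Y \<Longrightarrow> E (A y) = A (E y)"
begin

abbreviation "K \<equiv> {y \<in> Y. E y = 0}"

lemma range_eq: "E ` Y = {y \<in> Y. y - E y = 0}"
proof (intro equalityI subsetI)
  fix y assume "y \<in> {y \<in> Y. y - E y = 0}"
  then show "y \<in> E ` Y" by (intro image_eqI[of _ E y]) auto
qed (use op_in[OF Y E] idem in auto)

lemma closed_subspace_range: "closed_subspace (E ` Y)"
  unfolding range_eq by (rule op_kernel_closed_subspace[OF Y bounded_ops_diff[OF bounded_ops_id E Y]])

lemma closed_subspace_kernel: "closed_subspace K"
  by (rule op_kernel_closed_subspace[OF Y E])

lemma range_subset: "E ` Y \<subseteq> Y"
  using op_in[OF Y E] by blast

lemma fix_range: "y \<in> E ` Y \<Longrightarrow> E y = y"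
  using idem by auto

lemma residual_kernel: "y \<in> Y \<Longrightarrow> y - E y \<in> K"
  using op_diff[OF Y E] op_in[OF Y E] idem closed_subspace_diff[OF Y] by simp

lemma range_invariant: "y \<in> E ` Y \<Longrightarrow> A y \<in> E ` Y"
  using comm[symmetric] op_in[OF Y A] by blast

lemma kernel_invariant: "y \<in> K \<Longrightarrow> A y \<in> K"
  using comm op_in[OF Y A] op_0[OF Y A] by auto

lemma bounded_range: "A \<in> bounded_ops (E ` Y)"
  by (rule bounded_ops_restrict[OF A range_subset range_invariant])

lemma bounded_kernel: "A \<in> bounded_ops K"
  by (rule bounded_ops_restrict[OF A _ kernel_invariant]) auto

lemma inj_split: "inj_on A Y \<longleftrightarrow> inj_on A (E ` Y) \<and> inj_on A K"
proof
  assume "inj_on A Y"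
  then show "inj_on A (E ` Y) \<and> inj_on A K"
    using range_subset by (auto intro: inj_on_subset)
next
  assume "inj_on A (E ` Y) \<and> inj_on A K"
  then have i: "\<forall>y\<in>E ` Y. A y = 0 \<longrightarrow> y = 0" "\<forall>y\<in>K. A y = 0 \<longrightarrow> y = 0"
    using op_inj_iff[OF closed_subspace_range bounded_range]
      op_inj_iff[OF closed_subspace_kernel bounded_kernel] by blast+
  have "y = 0" if y: "y \<in> Y" "A y = 0" for y
  proof -
    have "A (E y) = 0" using comm[OF y(1)] y op_0[OF Y E] by simp
    then have "E y = 0" using i(1) y by blast
    then show ?thesis using i(2) y by blast
  qed
  then show "inj_on A Y" using op_inj_iff[OF Y A] by blast
qed

lemma surj_split: "A ` Y = Y \<longleftrightarrow> A ` (E ` Y) = E ` Y \<and> A ` K = K"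
proof
  assume s: "A ` Y = Y"
  have "E ` Y \<subseteq> A ` (E ` Y)"
  proof
    fix y assume y: "y \<in> E ` Y"
    then have "y \<in> A ` Y" unfolding s using range_subset by blast
    then obtain x where x: "x \<in> Y" "A x = y" by blast
    then have "A (E x) = y" using comm[OF x(1)] fix_range[OF y] by simp
    then show "y \<in> A ` (E ` Y)" using x by blast
  qed
  moreover have "K \<subseteq> A ` K"
  proof
    fix y assume y: "y \<in> K"
    then have "y \<in> A ` Y" unfolding s by blast
    then obtain x where x: "x \<in> Y" "A x = y" by blast
    then have "A (x - E x) = y"
      using comm[OF x(1)] y op_diff[OF Y A x(1)] op_in[OF Y E x(1)] by simp
    then show "y \<in> A ` K" using residual_kernel[OF x(1)] by blast
  qed
  moreover have "A ` (E ` Y) \<subseteq> E ` Y" "A ` K \<subseteq> K"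
    using range_invariant kernel_invariant by (simp_all add: image_subset_iff)
  ultimately show "A ` (E ` Y) = E ` Y \<and> A ` K = K" by (intro conjI equalityI)
next
  assume s: "A ` (E ` Y) = E ` Y \<and> A ` K = K"
  have "y \<in> A ` Y" if y: "y \<in> Y" for y
  proof -
    have "E y \<in> A ` (E ` Y)" unfolding conjunct1[OF s] using y by blast
    then obtain u where "u \<in> E ` Y" "E y = A u" by (rule imageE)
    then have u: "u \<in> Y" "A u = E y" using range_subset by auto
    have "y - E y \<in> A ` K" unfolding conjunct2[OF s] by (rule residual_kernel[OF y])
    then obtain v where "v \<in> K" "y - E y = A v" by (rule imageE)
    then have v: "v \<in> Y" "A v = y - E y" by simp_all
    have "A (u + v) = y" using op_add[OF Y A u(1) v(1)] u v by simp
    then show ?thesis using closed_subspace_add[OF Y u(1) v(1)] by blast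
  qed
  then show "A ` Y = Y" using op_in[OF Y A] by (intro equalityI image_subsetI subsetI)
qed

lemma bij_split: "bij_betw A Y Y \<longleftrightarrow> bij_betw A (E ` Y) (E ` Y) \<and> bij_betw A K K"
  unfolding bij_betw_def inj_split surj_split by (simp add: conj_ac)

lemma shift: "reduced_operator Y (\<lambda>x. z *\<^sub>C x - A x) E"
proof
  show "E (z *\<^sub>C y - A y) = z *\<^sub>C E y - A (E y)" if "y \<in> Y" for y
    using op_diff[OF Y E closed_subspace_scaleC[OF Y that] op_in[OF Y A that]]
      op_scaleC[OF Y E that] comm[OF that] by simp
qed (use Y A E idem bounded_ops_shift in auto)

lemma spectrum_split: "spectrum Y A = spectrum (E ` Y) A \<union> spectrum K A"
proof -
  have "z \<in> spectrum Y A \<longleftrightarrow> z \<in> spectrum (E ` Y) A \<or> z \<in> spectrum K A" for z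
    unfolding spectrum_iff_not_bij[OF Y A] spectrum_iff_not_bij[OF closed_subspace_range bounded_range]
      spectrum_iff_not_bij[OF closed_subspace_kernel bounded_kernel]
    using reduced_operator.bij_split[OF shift[of z]] by blast
  then show ?thesis by blast
qed

lemma zeroloid_split: "zeroloid Y A \<longleftrightarrow> zeroloid (E ` Y) A \<and> zeroloid K A"
  unfolding zeroloid_def acc_points_def spectrum_split islimpt_Un by blast

end

lemma spectrum_cong:
  assumes "\<And>x. x \<in> M \<Longrightarrow> S x = T x"
  shows "spectrum M S = spectrum M T"
proof -
  have "invertible_op M (\<lambda>x. z *\<^sub>C x - S x) \<longleftrightarrow> invertible_op M (\<lambda>x. z *\<^sub>C x - T x)" for z
    unfolding invertible_op_def
  proof (rule bex_cong[OF refl])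
    fix R assume "R \<in> bounded_ops M"
    then have "R x \<in> M" if "x \<in> M" for x using that by (auto simp: bounded_ops_def)
    then show "(\<forall>x\<in>M. R (z *\<^sub>C x - S x) = x \<and> z *\<^sub>C R x - S (R x) = x) \<longleftrightarrow>
        (\<forall>x\<in>M. R (z *\<^sub>C x - T x) = x \<and> z *\<^sub>C R x - T (R x) = x)"
      using assms by simp
  qed
  then show ?thesis unfolding spectrum_def by simp
qed

lemma zeroloid_cong:
  assumes "\<And>x. x \<in> M \<Longrightarrow> S x = T x"
  shows "zeroloid M S \<longleftrightarrow> zeroloid M T"
  unfolding zeroloid_def using spectrum_cong[of M S T] assms by simp

lemma spectrum_subset_0_imp_zeroloid:
  assumes "spectrum M T \<subseteq> {0}"
  shows "zeroloid M T"
  using assms islimpt_subset[OF _ assms] by (auto simp: zeroloid_def acc_points_def islimpt_finite)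

lemma bij_uminus:
  assumes "closed_subspace M" "A \<in> bounded_ops M"
  shows "bij_betw (\<lambda>x. - A x) M M \<longleftrightarrow> bij_betw A M M"
proof -
  have *: "bij_betw (\<lambda>x. - B x) M M" if "bij_betw B M M" for B
  proof -
    have "bij_betw uminus M M"
      using closed_subspace_minus[OF assms(1)] by (intro bij_betw_byWitness[where f' = uminus]) auto
    from bij_betw_trans[OF that this] show ?thesis by (simp add: o_def)
  qed
  show ?thesis using *[of A] *[of "\<lambda>x. - A x"] by auto
qed

lemma zeroloid_uminus:
  assumes M: "closed_subspace M" and T: "T \<in> bounded_ops M" and z: "zeroloid M (\<lambda>x. - T x)"
  shows "zeroloid M T"
proof -
  have "z \<in> spectrum M (\<lambda>x. - T x) \<longleftrightarrow> - z \<in> spectrum M T" for z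
    unfolding spectrum_iff_not_bij[OF M T] spectrum_iff_not_bij[OF M bounded_ops_minus[OF T M]]
    using bij_uminus[OF M bounded_ops_shift[OF T M], of "- z"] by (simp add: add.commute)
  note neg = this
  have eq: "spectrum M (\<lambda>x. - T x) = uminus ` spectrum M T"
  proof (rule set_eqI, rule iffI)
    fix z assume "z \<in> spectrum M (\<lambda>x. - T x)"
    then have "- (- z) \<in> uminus ` spectrum M T" unfolding neg by (rule imageI)
    then show "z \<in> uminus ` spectrum M T" by simp
  next
    fix z assume "z \<in> uminus ` spectrum M T"
    then obtain w where "w \<in> spectrum M T" "z = - w" by (rule imageE) auto
    then show "z \<in> spectrum M (\<lambda>x. - T x)" unfolding neg by simp
  qed
  have "w = 0" if w: "w islimpt spectrum M T" for w
  proof -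
    have "- w islimpt uminus ` spectrum M T"
      unfolding islimpt_approachable
    proof (intro allI impI)
      fix e :: real assume "e > 0"
      then obtain x where "x \<in> spectrum M T" "x \<noteq> w" "dist x w < e"
        using w unfolding islimpt_approachable by blast
      then show "\<exists>x'\<in>uminus ` spectrum M T. x' \<noteq> - w \<and> dist x' (- w) < e"
        by (intro bexI[of _ "- x"]) (auto simp: dist_norm norm_minus_commute)
    qed
    then show ?thesis using z unfolding zeroloid_def acc_points_def eq by auto
  qed
  then show ?thesis unfolding zeroloid_def acc_points_def by blast
qed

text \<open>
  If the two spectra covered a punctured disc, every point of that disc would be an accumulation
  point of one of them.
\<close>

lemma zeroloid_punctured:
  assumes "zeroloid M S" "zeroloid N T" "e > 0"
  shows "\<exists>z. z \<noteq> 0 \<and> cmod z < e \<and> z \<notin> spectrum M S \<and> z \<notin> spectrum N T"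
proof (rule ccontr)
  assume no: "\<not> ?thesis"
  let ?U = "ball 0 e - {0::complex}"
  have "open ?U" by (simp add: open_delete)
  moreover have "complex_of_real (e / 2) \<in> ?U" using assms(3) by simp
  ultimately have "complex_of_real (e / 2) islimpt ?U" by (simp add: interior_open interior_limit_point)
  then have "complex_of_real (e / 2) islimpt spectrum M S \<union> spectrum N T"
    using no by (elim islimpt_subset) (auto simp: dist_norm)
  then have "complex_of_real (e / 2) \<in> {0}"
    using assms(1,2) unfolding islimpt_Un zeroloid_def acc_points_def by blast
  then show False using assms(3) by simp
qed

section \<open>Perturbation by small scalars\<close>

lemma norm_scaleC_power: "norm (z ^ n *\<^sub>C x) = cmod z ^ n * norm x"
  by (simp add: norm_scaleC norm_power)

text \<open>
  The vector is \<open>v = \<Sum> z\<^sup>n x\<^sub>n\<close>: applying \<open>T\<close> shifts the orbit by one step and so reproduces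
  \<open>z v\<close> together with the boundary term \<open>T x\<^sub>0\<close>. The norm bound is the tail of the geometric series; it
  serves to see that \<open>v\<close> is nonzero when \<open>x\<^sub>0\<close> is.
\<close>

lemma backward_orbit_series:
  fixes T :: "'a::complex_banach \<Rightarrow> 'a"
  assumes M: "closed_subspace M" and T: "T \<in> bounded_ops M"
    and x: "\<And>n. x n \<in> M" "\<And>n. T (x (Suc n)) = x n" "\<And>n. norm (x n) \<le> B * C ^ n"
    and C: "C > 0" "cmod z * C < 1"
  shows "\<exists>v\<in>M. T v = T (x 0) + z *\<^sub>C v \<and> norm (v - x 0) \<le> B * (cmod z * C / (1 - cmod z * C))"
proof -
  define q where "q = cmod z * C"
  have q: "0 \<le> q" "q < 1" unfolding q_def using C by simp_all
  define u where "u n = z ^ n *\<^sub>C x n" for n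
  have uM: "u n \<in> M" for n unfolding u_def using x(1) by (intro closed_subspace_scaleC[OF M])
  have ub: "norm (u n) \<le> B * q ^ n" for n
    using mult_left_mono[OF x(3)[of n], of "cmod z ^ n"]
    by (simp add: u_def norm_scaleC_power q_def power_mult_distrib mult_ac)
  have sg: "summable (\<lambda>n. B * q ^ n)" using q by (intro summable_mult summable_geometric) simp
  have sn: "summable (\<lambda>n. norm (u n))"
    by (rule summable_comparison_test'[OF sg, of 0]) (use ub in simp)
  then have su: "summable u" by (rule summable_norm_cancel)
  have sn': "summable (\<lambda>n. norm (u (Suc n)))" using sn by (subst summable_Suc_iff)
  define s where "s N = sum u {..<N}" for N
  define v where "v = suminf u"
  have sv: "s \<longlonglongrightarrow> v" using su unfolding s_def v_def by (simp add: summable_LIMSEQ)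
  have sM: "s N \<in> M" for N unfolding s_def by (rule closed_subspace_sum[OF M uM])
  have vM: "v \<in> M" using closed_sequentially[OF closed_subspace_closed[OF M]] sM sv by blast
  have Tu: "T (u (Suc n)) = z *\<^sub>C u n" for n
    unfolding u_def using op_scaleC[OF M T x(1)] x(2) by (simp add: scaleC_scaleC)
  have Ts: "T (s (Suc N)) = T (x 0) + z *\<^sub>C s N" for N
  proof (induction N)
    case 0
    then show ?case using scaleC_of_real[of 1 "x 0"] by (simp add: s_def u_def)
  next
    case (Suc N)
    have "T (s (Suc (Suc N))) = T (s (Suc N)) + T (u (Suc N))"
      using op_add[OF M T sM[of "Suc N"] uM[of "Suc N"]] by (simp add: s_def)
    then show ?case using Suc Tu by (simp add: s_def scaleC_add_right)
  qed
  have l1: "(\<lambda>N. T (s (Suc N))) \<longlonglongrightarrow> T v"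
    using op_tendsto[OF M T, of "\<lambda>N. s (Suc N)" v] sM vM sv by (simp add: LIMSEQ_Suc)
  have l2: "(\<lambda>N. T (x 0) + z *\<^sub>C s N) \<longlonglongrightarrow> T (x 0) + z *\<^sub>C v"
    using op_tendsto[OF M bounded_ops_scaleC[OF bounded_ops_id M] sM sv vM]
    by (intro tendsto_intros)
  have Tv: "T v = T (x 0) + z *\<^sub>C v"
    using l1 l2 unfolding Ts by (rule LIMSEQ_unique)
  have "v = (\<Sum>n. u (Suc n)) + u 0" unfolding v_def using suminf_split_head[OF su] by simp
  then have "v - x 0 = (\<Sum>n. u (Suc n))" using scaleC_of_real[of 1 "x 0"] by (simp add: u_def)
  also have "norm \<dots> \<le> (\<Sum>n. norm (u (Suc n)))"
    by (rule summable_norm[OF sn'])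
  also have "\<dots> \<le> (\<Sum>n. B * q * q ^ n)"
  proof (rule suminf_le)
    show "summable (\<lambda>n. norm (u (Suc n)))" by (rule sn')
    show "summable (\<lambda>n. B * q * q ^ n)" using q by (intro summable_mult summable_geometric) simp
  qed (use ub[of "Suc _"] in \<open>simp add: mult_ac\<close>)
  also have "\<dots> = B * (q / (1 - q))"
    using q by (subst suminf_mult) (simp_all add: suminf_geometric summable_geometric)
  finally show ?thesis using vM Tv unfolding q_def by blast
qed

text \<open>
  Given \<open>w\<close>, a backward orbit that starts at a preimage of \<open>- w\<close> exists by surjectivity, and its series
  solves \<open>z v - T v = w\<close>.
\<close>

lemma surjective_perturbation:
  fixes T :: "'a::complex_banach \<Rightarrow> 'a"
  assumes M: "closed_subspace M" and T: "T \<in> bounded_ops M" and s: "T ` M = M"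
  shows "\<exists>e>0. \<forall>z. cmod z < e \<longrightarrow> (\<lambda>x. z *\<^sub>C x - T x) ` M = M"
proof -
  obtain C where C: "C > 0" "\<forall>y\<in>M. \<exists>x\<in>M. T x = y \<and> norm x \<le> C * norm y"
    using op_lift_bound[OF M T] closed_subspace_closed[OF M] unfolding s by blast
  then obtain h where h: "\<And>y. y \<in> M \<Longrightarrow> h y \<in> M" "\<And>y. y \<in> M \<Longrightarrow> T (h y) = y"
    "\<And>y. y \<in> M \<Longrightarrow> norm (h y) \<le> C * norm y" by metis
  have "(\<lambda>x. z *\<^sub>C x - T x) ` M = M" if z: "cmod z < 1 / C" for z
  proof (intro equalityI subsetI)
    show "w \<in> M" if "w \<in> (\<lambda>x. z *\<^sub>C x - T x) ` M" for w
      using that op_in[OF M bounded_ops_shift[OF T M]] by blast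
    fix w assume w: "w \<in> M"
    define x where "x n = (h ^^ Suc n) (- w)" for n
    have hM: "(h ^^ n) (- w) \<in> M" for n
      by (induction n) (use h(1) closed_subspace_minus[OF M w] in auto)
    have hb: "norm ((h ^^ n) (- w)) \<le> C ^ n * norm w" for n
    proof (induction n)
      case (Suc n)
      have "norm ((h ^^ Suc n) (- w)) \<le> C * norm ((h ^^ n) (- w))" using h(3)[OF hM[of n]] by simp
      also have "\<dots> \<le> C * (C ^ n * norm w)" using Suc C by (intro mult_left_mono) auto
      finally show ?case by (simp add: mult_ac)
    qed simp
    have "\<exists>v\<in>M. T v = T (x 0) + z *\<^sub>C v \<and>
        norm (v - x 0) \<le> (C * norm w) * (cmod z * C / (1 - cmod z * C))"
    proof (rule backward_orbit_series[OF M T])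
      show "x n \<in> M" for n unfolding x_def by (rule hM)
      show "T (x (Suc n)) = x n" for n unfolding x_def using h(2)[OF hM[of "Suc n"]] by simp
      show "norm (x n) \<le> C * norm w * C ^ n" for n unfolding x_def using hb[of "Suc n"] by (simp add: mult_ac)
      show "cmod z * C < 1" using z C by (simp add: field_simps)
    qed (use C in simp)
    then obtain v where v: "v \<in> M" "T v = T (x 0) + z *\<^sub>C v" by blast
    have "T (x 0) = - w" unfolding x_def using h(2) closed_subspace_minus[OF M w] by simp
    then show "w \<in> (\<lambda>x. z *\<^sub>C x - T x) ` M" using v by (intro image_eqI[of _ _ v]) auto
  qed
  then show ?thesis using C by (intro exI[of _ "1 / C"]) auto
qed

lemma bounded_below_perturbation:
  fixes T :: "'a::complex_banach \<Rightarrow> 'a"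
  assumes M: "closed_subspace M" and T: "T \<in> bounded_ops M"
    and c: "\<forall>x\<in>M. c * norm x \<le> norm (T x)" and z: "cmod z \<le> c / 2" and x: "x \<in> M"
  shows "c / 2 * norm x \<le> norm (z *\<^sub>C x - T x)"
proof -
  have "c * norm x \<le> norm (T x)" using c x by blast
  also have "\<dots> \<le> norm (z *\<^sub>C x) + norm (z *\<^sub>C x - T x)"
    using norm_triangle_ineq4[of "z *\<^sub>C x" "z *\<^sub>C x - T x"] by simp
  also have "norm (z *\<^sub>C x) \<le> c / 2 * norm x" unfolding norm_scaleC using z by (rule mult_right_mono) simp
  finally show ?thesis by (simp add: algebra_simps)
qed

lemma inj_perturbation:
  fixes T :: "'a::complex_banach \<Rightarrow> 'a"
  assumes M: "closed_subspace M" and T: "T \<in> bounded_ops M" and b: "bounded_below M T"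
  shows "\<exists>e>0. \<forall>z. cmod z < e \<longrightarrow> inj_on (\<lambda>x. z *\<^sub>C x - T x) M"
proof -
  obtain c where c: "c > 0" "\<forall>x\<in>M. c * norm x \<le> norm (T x)" using b unfolding bounded_below_def by blast
  have "inj_on (\<lambda>x. z *\<^sub>C x - T x) M" if z: "cmod z < c / 2" for z
    unfolding op_inj_iff[OF M bounded_ops_shift[OF T M]]
  proof (intro ballI impI)
    fix x assume "x \<in> M" "z *\<^sub>C x - T x = 0"
    then have "c / 2 * norm x \<le> 0" using bounded_below_perturbation[OF M T c(2) less_imp_le[OF z], of x] by simp
    then show "x = 0" using c(1) by (simp add: mult_le_0_iff)
  qed
  then show ?thesis using c by (intro exI[of _ "c / 2"]) auto
qed

text \<open>
  A nonzero kernel cannot disappear under small perturbations. By semi-regularity a kernel vector lies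
  in all the ranges of \<open>T\<^sup>n\<close>, and every preimage of a vector in this intersection lies again in it, so
  the kernel vector has an infinite backward orbit. The series of that orbit is an eigenvector of \<open>T\<close>
  for the eigenvalue \<open>z\<close>.
\<close>

lemma semi_regular_inj_limit:
  fixes T :: "'a::complex_banach \<Rightarrow> 'a"
  assumes M: "closed_subspace M" and T: "T \<in> bounded_ops M" and sr: "semi_regular M T"
    and lim: "\<And>e. e > 0 \<Longrightarrow> \<exists>z. cmod z < e \<and> inj_on (\<lambda>x. z *\<^sub>C x - T x) M"
  shows "inj_on T M"
proof (rule ccontr)
  assume "\<not> inj_on T M"
  then obtain x0 where x0: "x0 \<in> M" "T x0 = 0" "x0 \<noteq> 0" unfolding op_inj_iff[OF M T] by blast
  define R where "R = (\<Inter>n. (T ^^ n) ` M)"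
  have RM: "R \<subseteq> M" and RT: "R \<subseteq> T ` M"
    unfolding R_def using INT_lower[of 0 UNIV "\<lambda>n. (T ^^ n) ` M"] INT_lower[of 1 UNIV "\<lambda>n. (T ^^ n) ` M"] by auto
  have ker: "u \<in> (T ^^ n) ` M" if "u \<in> M" "T u = 0" for u n
    using sr that unfolding semi_regular_def kernel_def by blast
  have x0R: "x0 \<in> R" unfolding R_def using ker x0 by blast
  \<comment> \<open>Two preimages of the same vector differ by a kernel vector, which lies in every range.\<close>
  have lift: "u \<in> R" if u: "u \<in> M" "T u \<in> R" for u
    unfolding R_def
  proof (rule INT_I)
    fix n
    have "T u \<in> (T ^^ Suc n) ` M" using u unfolding R_def by blast
    then obtain w where w: "w \<in> M" "T u = T ((T ^^ n) w)" by auto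
    have wn: "(T ^^ n) w \<in> M" using op_in[OF M bounded_ops_funpow[OF T M] w(1)] .
    have "T (u - (T ^^ n) w) = 0" using op_diff[OF M T u(1) wn] w(2) by simp
    then have "u - (T ^^ n) w \<in> (T ^^ n) ` M" using ker closed_subspace_diff[OF M u(1) wn] by blast
    then obtain w' where w': "w' \<in> M" "u - (T ^^ n) w = (T ^^ n) w'" by (rule imageE) auto
    have "u = (T ^^ n) (w + w')"
      using op_add[OF M bounded_ops_funpow[OF T M] w(1) w'(1), of n] w'(2) by (simp add: algebra_simps)
    then show "u \<in> (T ^^ n) ` M" using closed_subspace_add[OF M w(1) w'(1)] by blast
  qed
  obtain C where C: "C > 0" "\<forall>y\<in>T ` M. \<exists>x\<in>M. T x = y \<and> norm x \<le> C * norm y"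
    using op_lift_bound[OF M T] sr unfolding semi_regular_def by blast
  then obtain h where h: "\<And>y. y \<in> T ` M \<Longrightarrow> h y \<in> M" "\<And>y. y \<in> T ` M \<Longrightarrow> T (h y) = y"
    "\<And>y. y \<in> T ` M \<Longrightarrow> norm (h y) \<le> C * norm y" by metis
  \<comment> \<open>With \<open>\<bar>z\<bar> C < 1/2\<close> the tail of the series has norm less than \<open>norm x0\<close>.\<close>
  obtain z where z: "cmod z < 1 / (2 * C)" "inj_on (\<lambda>x. z *\<^sub>C x - T x) M"
    using lim[of "1 / (2 * C)"] C by auto
  define x where "x n = (h ^^ n) x0" for n
  have xR: "x n \<in> R" for n
  proof (induction n)
    case (Suc n)
    then have t: "x n \<in> T ` M" using RT by blast
    show ?case using lift[OF h(1)[OF t]] h(2)[OF t] Suc by (simp add: x_def)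
  qed (simp add: x_def x0R)
  have xT: "x n \<in> T ` M" for n using xR RT by blast
  have q: "cmod z * C < 1 / 2" using z(1) C by (simp add: less_divide_eq mult_ac)
  have "\<exists>v\<in>M. T v = T (x 0) + z *\<^sub>C v \<and>
      norm (v - x 0) \<le> norm x0 * (cmod z * C / (1 - cmod z * C))"
  proof (rule backward_orbit_series[OF M T])
    show "x n \<in> M" for n using xR RM by blast
    show "T (x (Suc n)) = x n" for n using h(2)[OF xT[of n]] by (simp add: x_def)
    show "norm (x n) \<le> norm x0 * C ^ n" for n
    proof (induction n)
      case (Suc n)
      have "norm (x (Suc n)) \<le> C * norm (x n)" using h(3)[OF xT[of n]] by (simp add: x_def)
      also have "\<dots> \<le> C * (norm x0 * C ^ n)" using Suc C by (intro mult_left_mono) auto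
      finally show ?case by (simp add: mult_ac)
    qed (simp add: x_def)
  qed (use C q in auto)
  then obtain v where v: "v \<in> M" "T v = z *\<^sub>C v"
      "norm (v - x0) \<le> norm x0 * (cmod z * C / (1 - cmod z * C))"
    using x0(2) by (auto simp: x_def)
  have "v = 0" using z(2) v unfolding op_inj_iff[OF M bounded_ops_shift[OF T M]] by simp
  moreover have "cmod z * C / (1 - cmod z * C) < 1" using q by (subst divide_less_eq_1_pos) linarith+
  then have "norm x0 * (cmod z * C / (1 - cmod z * C)) < norm x0 * 1"
    using x0(3) by (intro mult_strict_left_mono) auto
  ultimately show False using v(3) by simp
qed

text \<open>
  Since \<open>T\<close> is bounded below, the solutions \<open>x\<close> of \<open>z x - T x = y\<close> stay bounded as \<open>z\<close> tends to \<open>0\<close>,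
  so \<open>T (- x)\<close> tends to \<open>y\<close>, and the range is closed.
\<close>

lemma surj_limit:
  fixes T :: "'a::complex_banach \<Rightarrow> 'a"
  assumes M: "closed_subspace M" and T: "T \<in> bounded_ops M"
    and i: "inj_on T M" and cl: "closed (T ` M)"
    and lim: "\<And>e. e > 0 \<Longrightarrow> \<exists>z. cmod z < e \<and> (\<lambda>x. z *\<^sub>C x - T x) ` M = M"
  shows "T ` M = M"
proof
  show "T ` M \<subseteq> M" using op_in[OF M T] by blast
  obtain c where c: "c > 0" "\<forall>x\<in>M. c * norm x \<le> norm (T x)"
    using inj_closed_range_imp_bounded_below[OF M T i cl] unfolding bounded_below_def by blast
  show "M \<subseteq> T ` M"
  proof
    fix y assume y: "y \<in> M"
    have "y \<in> closure (T ` M)"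
      unfolding closure_approachable
    proof (intro allI impI)
      fix e :: real assume e: "e > 0"
      define d where "d = min (c / 2) (e * c / (2 * (norm y + 1)))"
      have d: "d > 0" unfolding d_def using e c by (simp add: add_nonneg_pos)
      obtain z where z: "cmod z < d" "(\<lambda>x. z *\<^sub>C x - T x) ` M = M" using lim[OF d] by blast
      have "y \<in> (\<lambda>x. z *\<^sub>C x - T x) ` M" unfolding z(2) by (rule y)
      then obtain x where x: "x \<in> M" "y = z *\<^sub>C x - T x" by (rule imageE) auto
      have "c / 2 * norm x \<le> norm y"
        using bounded_below_perturbation[OF M T c(2), of z x] x z(1) d_def by simp
      then have nx: "norm x \<le> 2 * norm y / c" using c(1) by (simp add: field_simps)
      have "dist (T (- x)) y = cmod z * norm x"
        using op_minus[OF M T x(1)] x(2) by (simp add: dist_norm norm_scaleC)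
      also have "\<dots> \<le> cmod z * (2 * norm y / c)" using nx by (intro mult_left_mono) auto
      also have "\<dots> \<le> (e * c / (2 * (norm y + 1))) * (2 * norm y / c)"
        using z(1) c(1) unfolding d_def by (intro mult_right_mono) auto
      also have "\<dots> = e * (norm y / (norm y + 1))"
      proof -
        have "norm y + 1 \<noteq> 0" using norm_ge_zero[of y] by linarith
        moreover have "(e * c / (2 * m)) * (2 * k / c) = e * (k / m)" if "m \<noteq> 0" for m k
          using that c(1) by simp
        ultimately show ?thesis by blast
      qed
      also have "\<dots> < e * 1" using e by (intro mult_strict_left_mono) (auto simp: divide_less_eq add_nonneg_pos)
      finally have "dist (T (- x)) y < e" by simp
      then show "\<exists>w\<in>T ` M. dist w y < e" using closed_subspace_minus[OF M x(1)] by blast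
    qed
    then show "y \<in> T ` M" using cl by simp
  qed
qed

lemma enat_Inf_finite: "Inf {enat n |n. P n} < \<infinity> \<Longrightarrow> \<exists>n. P n"
  by (rule ccontr) (simp add: Inf_enat_def)

lemma bij_ascent_descent:
  assumes M: "closed_subspace M" and T: "T \<in> bounded_ops M" and b: "bij_betw T M M"
  shows "ascent M T = 0" "descent M T = 0" "semi_regular M T"
proof -
  have ker: "kernel M T = {0}"
    using bij_betw_imp_inj_on[OF b] op_0[OF M T] closed_subspace_0[OF M]
    unfolding op_inj_iff[OF M T] kernel_def by blast
  have img: "T ` M = M" using b by (simp add: bij_betw_def)
  have "kernel M (T ^^ 0) = kernel M (T ^^ (0 + 1))"
    using ker closed_subspace_0[OF M] by (auto simp: kernel_def)
  then have "ascent M T \<le> enat 0" unfolding ascent_def by (intro Inf_lower) blast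
  then show "ascent M T = 0" by (simp add: zero_enat_def[symmetric])
  have "(T ^^ 0) ` M = (T ^^ (0 + 1)) ` M" using img by simp
  then have "descent M T \<le> enat 0" unfolding descent_def by (intro Inf_lower) blast
  then show "descent M T = 0" by (simp add: zero_enat_def[symmetric])
  have "(T ^^ n) ` M = M" for n
  proof (induction n)
    case (Suc n)
    have "(T ^^ Suc n) ` M = T ` ((T ^^ n) ` M)" by (simp add: image_comp)
    then show ?case using Suc img by simp
  qed simp
  then show "semi_regular M T"
    unfolding semi_regular_def img ker using closed_subspace_closed[OF M] closed_subspace_0[OF M] by simp
qed

section \<open>Neumann series and geometric convergence\<close>

text \<open>
  The equation \<open>x - B x = y\<close> is the fixed point equation of the contraction \<open>x \<mapsto> y + B x\<close>.
\<close>

lemma neumann_bij: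
  fixes B :: "'a::complex_banach \<Rightarrow> 'a"
  assumes M: "closed_subspace M" and B: "B \<in> bounded_ops M"
    and q: "0 \<le> q" "q < 1" and bd: "\<And>x. x \<in> M \<Longrightarrow> norm (B x) \<le> q * norm x"
  shows "bij_betw (\<lambda>x. x - B x) M M"
proof -
  have ex: "\<exists>!x\<in>M. y + B x = x" if y: "y \<in> M" for y
  proof (rule Banach_fix[OF _ _ q])
    show "complete M" using closed_subspace_closed[OF M] by (simp add: complete_eq_closed)
    show "M \<noteq> {}" using y by blast
    show "(\<lambda>x. y + B x) ` M \<subseteq> M" using closed_subspace_add[OF M y op_in[OF M B]] by blast
    show "dist (y + B u) (y + B v) \<le> q * dist u v" if "u \<in> M" "v \<in> M" for u v
      using bd[OF closed_subspace_diff[OF M that]] op_diff[OF M B that] by (simp add: dist_norm)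
  qed
  have id: "(\<lambda>x. x - B x) \<in> bounded_ops M" by (rule bounded_ops_diff[OF bounded_ops_id B M])
  show ?thesis
    unfolding bij_betw_def
  proof (intro conjI equalityI subsetI)
    show "inj_on (\<lambda>x. x - B x) M"
      unfolding op_inj_iff[OF M id]
    proof (intro ballI impI)
      fix x assume x: "x \<in> M" "x - B x = 0"
      have 1: "0 \<in> M \<and> 0 + B 0 = 0" using op_0[OF M B] closed_subspace_0[OF M] by simp
      have 2: "x \<in> M \<and> 0 + B x = x" using x(1) x(2)[unfolded right_minus_eq] by auto
      show "x = 0" using ex[OF closed_subspace_0[OF M]] 1 2 unfolding Ex1_def by metis
    qed
    show "y \<in> (\<lambda>x. x - B x) ` M" if y: "y \<in> M" for y
    proof -
      obtain x where "x \<in> M" "y + B x = x" using ex1_implies_ex[OF ex[OF y]] by blast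
      then show ?thesis by (intro image_eqI[of _ _ x]) (auto simp: algebra_simps)
    qed
  qed (use op_in[OF M id] in auto)
qed

lemma bij_scaleC:
  assumes M: "closed_subspace M" and c: "c \<noteq> 0"
  shows "bij_betw (\<lambda>x. c *\<^sub>C x) M M"
  using c complex_vector.scale_one
  by (intro bij_betw_byWitness[where f' = "\<lambda>x. (1 / c) *\<^sub>C x"])
    (auto simp: scaleC_scaleC closed_subspace_scaleC[OF M])

text \<open>
  The operator \<open>z\<^sup>n - A\<^sup>n\<close> has the factor \<open>z - A\<close>, which commutes with the cofactor.
\<close>

lemma shift_bij_of_power:
  assumes M: "closed_subspace M" and A: "A \<in> bounded_ops M"
    and b: "bij_betw (\<lambda>x. z ^ n *\<^sub>C x - (A ^^ n) x) M M"
  shows "bij_betw (\<lambda>x. z *\<^sub>C x - A x) M M"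
proof -
  have one: "1 *\<^sub>C x = x" for x :: 'a by (rule complex_vector.scale_one)
  have An: "A ^^ m \<in> bounded_ops M" for m by (rule bounded_ops_funpow[OF A M])
  have s: "(\<lambda>x. z *\<^sub>C x - A x) \<in> bounded_ops M" by (rule bounded_ops_shift[OF A M])
  have sn: "(\<lambda>x. z ^ n *\<^sub>C x - (A ^^ n) x) \<in> bounded_ops M" by (rule bounded_ops_shift[OF An M])
  have "inj_on (\<lambda>x. z *\<^sub>C x - A x) M"
    unfolding op_inj_iff[OF M s]
  proof (intro ballI impI)
    fix x assume x: "x \<in> M" "z *\<^sub>C x - A x = 0"
    have Ax: "A x = z *\<^sub>C x" using x(2) by simp
    have "(A ^^ m) x = z ^ m *\<^sub>C x" for m
    proof (induction m)
      case (Suc m)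
      then show ?case by (simp add: op_scaleC[OF M A x(1)] Ax scaleC_scaleC mult.commute)
    qed (simp add: one)
    then show "x = 0"
      using bij_betw_imp_inj_on[OF b] x(1) unfolding op_inj_iff[OF M sn] by simp
  qed
  moreover have fac: "\<exists>s\<in>M. z ^ m *\<^sub>C x - (A ^^ m) x = z *\<^sub>C s - A s" if x: "x \<in> M" for m x
  proof (induction m)
    case 0
    show ?case using closed_subspace_0[OF M] op_0[OF M A] by (intro bexI[of _ 0]) (auto simp: one)
  next
    case (Suc m)
    then obtain s where s: "s \<in> M" "z ^ m *\<^sub>C x - (A ^^ m) x = z *\<^sub>C s - A s" by blast
    have Ax: "(A ^^ m) x \<in> M" by (rule op_in[OF M An x])
    have zs: "z *\<^sub>C s \<in> M" by (rule closed_subspace_scaleC[OF M s(1)])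
    have "z ^ Suc m *\<^sub>C x - (A ^^ Suc m) x = z *\<^sub>C (z ^ m *\<^sub>C x - (A ^^ m) x)
        + (z *\<^sub>C (A ^^ m) x - A ((A ^^ m) x))"
      by (simp add: complex_vector.scale_right_diff_distrib scaleC_scaleC)
    also have "\<dots> = z *\<^sub>C (z *\<^sub>C s + (A ^^ m) x) - A (z *\<^sub>C s + (A ^^ m) x)"
      unfolding s(2) op_add[OF M A zs Ax] op_scaleC[OF M A s(1)]
      by (simp add: complex_vector.scale_right_diff_distrib scaleC_add_right)
    finally show ?case using closed_subspace_add[OF M zs Ax] by blast
  qed
  have "y \<in> (\<lambda>x. z *\<^sub>C x - A x) ` M" if y: "y \<in> M" for y
  proof -
    have "y \<in> (\<lambda>x. z ^ n *\<^sub>C x - (A ^^ n) x) ` M" unfolding bij_betw_imp_surj_on[OF b] by (rule y)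
    then obtain x where x: "x \<in> M" "y = z ^ n *\<^sub>C x - (A ^^ n) x" by (rule imageE) auto
    then show ?thesis using fac[OF x(1), of n] by auto
  qed
  ultimately show ?thesis
    unfolding bij_betw_def using op_in[OF M s] by (intro conjI equalityI subsetI) auto
qed

lemma geometric_increments_convergent:
  fixes u :: "nat \<Rightarrow> 'a::banach"
  assumes u: "\<And>j. norm (u (Suc j) - u j) \<le> K * (1/2) ^ j"
  shows "convergent u" "u \<longlonglongrightarrow> l \<Longrightarrow> norm (u j - l) \<le> 2 * K * (1/2) ^ j"
proof -
  have step: "norm (u (j + k) - u j) \<le> 2 * K * (1/2) ^ j - 2 * K * (1/2) ^ (j + k)" for j k
  proof (induction k)
    case (Suc k)
    have "norm (u (j + Suc k) - u j) \<le> norm (u (Suc (j + k)) - u (j + k)) + norm (u (j + k) - u j)"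
      using norm_triangle_ineq[of "u (Suc (j + k)) - u (j + k)" "u (j + k) - u j"] by simp
    then show ?case using Suc u[of "j + k"] by simp
  qed simp
  have K: "K \<ge> 0" using order_trans[OF norm_ge_zero u[of 0]] by simp
  then have step': "norm (u (j + k) - u j) \<le> 2 * K * (1/2) ^ j" for j k
  proof -
    have "0 \<le> 2 * K * (1/2) ^ (j + k)" using K by simp
    then show ?thesis using step[of j k] by linarith
  qed
  have "summable (\<lambda>j. u (Suc j) - u j)"
  proof (rule summable_norm_cancel, rule summable_comparison_test'[of "\<lambda>j. K * (1/2) ^ j" 0])
    show "summable (\<lambda>j. K * (1/2::real) ^ j)" by (intro summable_mult summable_geometric) simp
  qed (use u in simp)
  then have "convergent (\<lambda>n. \<Sum>j<n. u (Suc j) - u j)" by (simp add: summable_iff_convergent)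
  then have "convergent (\<lambda>n. u n - u 0)" by (simp add: sum_lessThan_telescope)
  then have "convergent (\<lambda>n. (u n - u 0) + u 0)" by (intro convergent_add convergent_const)
  then show "convergent u" by simp
  assume l: "u \<longlonglongrightarrow> l"
  have "(\<lambda>k. norm (u (k + j) - u j)) \<longlonglongrightarrow> norm (l - u j)"
    by (intro tendsto_norm tendsto_diff LIMSEQ_ignore_initial_segment[OF l] tendsto_const)
  moreover have "norm (u (k + j) - u j) \<le> 2 * K * (1/2) ^ j" for k
    using step'[of j k] by (simp add: add.commute)
  ultimately show "norm (u j - l) \<le> 2 * K * (1/2) ^ j"
    by (subst norm_minus_commute) (rule Lim_bounded[where M = 0], auto)
qed

lemma sum_double: "(\<Sum>k<2 * n. f k) = (\<Sum>k<n. f (2 * k) + f (2 * k + 1))" for f :: "nat \<Rightarrow> 'a::comm_monoid_add"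
  by (induction n) (simp_all add: add.assoc)

definition circle_point :: "real \<Rightarrow> real \<Rightarrow> complex" where
  "circle_point r t = complex_of_real r * cis (2 * pi * t)"

lemma cmod_circle_point: "r \<ge> 0 \<Longrightarrow> cmod (circle_point r t) = r"
  by (simp add: circle_point_def norm_mult)

lemma circle_point_power: "circle_point r t ^ n = circle_point (r ^ n) (real n * t)"
  unfolding circle_point_def power_mult_distrib Complex.DeMoivre of_real_power by (simp only: mult_ac)

lemma circle_point_nat: "circle_point r (real k) = complex_of_real r"
  using cis_multiple_2pi[of "real k"] by (simp add: circle_point_def)

text \<open>
  Orthogonality of characters: the sum is geometric with a ratio that is an \<open>n\<close>-th root of unity other
  than \<open>1\<close>.
\<close>

lemma sum_circle_points_power:
  assumes "0 < m" "m < n"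
  shows "(\<Sum>k<n. circle_point r (real k / real n) ^ m) = 0"
proof -
  define c where "c = cis (2 * pi * (real m / real n))"
  have "c = exp (2 * of_real pi * \<i> * of_nat m / of_nat n)"
    unfolding c_def cis_conv_exp by (rule arg_cong[of _ _ exp]) (simp add: mult_ac)
  then have c1: "c \<noteq> 1" using complex_root_unity_eq_1[of n m] assms by (auto dest: dvd_imp_le)
  have "c ^ n = circle_point 1 (real n * (real m / real n))"
    unfolding c_def circle_point_def Complex.DeMoivre by (simp add: mult_ac)
  also have "\<dots> = 1" using assms circle_point_nat[of 1 m] by simp
  finally have cn: "c ^ n = 1" .
  have "circle_point r (real k / real n) ^ m = complex_of_real (r ^ m) * c ^ k" for k
    unfolding c_def circle_point_def power_mult_distrib Complex.DeMoivre by (simp add: mult_ac)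
  then have "(\<Sum>k<n. circle_point r (real k / real n) ^ m) = complex_of_real (r ^ m) * (\<Sum>k<n. c ^ k)"
    by (simp add: sum_distrib_left)
  also have "(\<Sum>k<n. c ^ k) = 0" using geometric_sum[OF c1, of n] cn by simp
  finally show ?thesis by simp
qed

lemma circle_point_lipschitz_angle:
  assumes "r \<ge> 0"
  shows "cmod (circle_point r s - circle_point r t) \<le> 2 * pi * r * \<bar>s - t\<bar>"
proof -
  have "circle_point r s - circle_point r t =
      complex_of_real r * cis (2 * pi * t) * (exp (\<i> * of_real (2 * pi * (s - t))) - 1)"
    unfolding cis_conv_exp[symmetric]
    by (simp add: circle_point_def algebra_simps cis_mult)
  then have "cmod (circle_point r s - circle_point r t) = r * (2 * \<bar>sin (2 * pi * (s - t) / 2)\<bar>)"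
    using assms by (simp only: norm_mult dist_exp_i_1 norm_cis norm_of_real abs_of_nonneg mult_1_right)
  also have "\<dots> \<le> r * (2 * \<bar>2 * pi * (s - t) / 2\<bar>)"
    using assms by (intro mult_left_mono abs_sin_x_le_abs_x) auto
  also have "\<dots> = 2 * pi * r * \<bar>s - t\<bar>" by (simp add: abs_mult)
  finally show ?thesis .
qed

lemma circle_point_lipschitz_radius: "cmod (circle_point r t - circle_point s t) = \<bar>r - s\<bar>"
proof -
  have "circle_point r t - circle_point s t = complex_of_real (r - s) * cis (2 * pi * t)"
    by (simp add: circle_point_def algebra_simps)
  then show ?thesis by (simp only: norm_mult norm_cis norm_of_real) simp
qed

section \<open>The Riesz projection at an isolated point of the spectrum\<close>

locale punctured_resolvent =
  fixes A :: "'a::complex_banach \<Rightarrow> 'a" and \<delta> :: real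
  assumes A: "A \<in> bounded_ops UNIV" and \<delta>: "\<delta> > 0"
    and bij: "\<And>z. z \<noteq> 0 \<Longrightarrow> cmod z < \<delta> \<Longrightarrow> bij (\<lambda>x. z *\<^sub>C x - A x)"
begin

lemmas U = closed_subspace_UNIV

definition res :: "complex \<Rightarrow> 'a \<Rightarrow> 'a" where
  "res z = inv (\<lambda>x. z *\<^sub>C x - A x)"

lemma res:
  assumes z: "z \<noteq> 0" "cmod z < \<delta>"
  shows "res z \<in> bounded_ops UNIV" "res z (z *\<^sub>C x - A x) = x" "z *\<^sub>C res z x - A (res z x) = x"
proof -
  let ?f = "\<lambda>x. z *\<^sub>C x - A x"
  have b: "bij ?f" by (rule bij[OF z])
  then have "invertible_op UNIV ?f"
    using invertible_op_iff_bij[OF U bounded_ops_shift[OF A U]] by blast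
  then obtain S where S: "S \<in> bounded_ops UNIV" "\<And>x. ?f (S x) = x" unfolding invertible_op_def by blast
  have "S = res z"
  proof
    fix x show "S x = res z x" unfolding res_def using S(2)[of x] by (intro inv_f_eq[symmetric] bij_is_inj[OF b])
  qed
  then show "res z \<in> bounded_ops UNIV" using S by simp
  show "res z (?f x) = x" unfolding res_def by (rule inv_f_f[OF bij_is_inj[OF b]])
  show "?f (res z x) = x" unfolding res_def by (rule surj_f_inv_f[OF bij_is_surj[OF b]])
qed

lemma res_commute:
  assumes z: "z \<noteq> 0" "cmod z < \<delta>" and B: "B \<in> bounded_ops UNIV" and BA: "\<And>x. B (A x) = A (B x)"
  shows "B (res z x) = res z (B x)"
proof -
  have "B x = B (z *\<^sub>C res z x - A (res z x))" using res(3)[OF z] by simp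
  also have "\<dots> = z *\<^sub>C B (res z x) - A (B (res z x))"
    using op_diff[OF U B] op_scaleC[OF U B] BA by simp
  finally show ?thesis using res(2)[OF z, of "B (res z x)"] by simp
qed

text \<open>
  All contours run in the closed annulus with the radii \<open>a\<close> and \<open>b\<close>. It is compact and avoids the
  spectrum, so the resolvent is uniformly bounded on it. The projection is built on the inner circle;
  the other radii serve to prove that it is idempotent.
\<close>

definition a where "a = \<delta> / 3"
definition b where "b = 2 * \<delta> / 3"

lemma ab: "0 < a" "a < b" "b < \<delta>"
  using \<delta> by (simp_all add: a_def b_def)

text \<open>
  A lower bound of \<open>z - A\<close> survives, up to the factor \<open>1/2\<close>, in a disc around \<open>z\<close>; finitely many of these
  discs cover the annulus.
\<close>

lemma res_uniform_bound:
  "\<exists>C>0. \<forall>z x. a \<le> cmod z \<and> cmod z \<le> b \<longrightarrow> norm (res z x) \<le> C * norm x"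
proof -
  define S where "S = {z. a \<le> cmod z \<and> cmod z \<le> b}"
  have nz: "z \<noteq> 0 \<and> cmod z < \<delta>" if "z \<in> S" for z using that ab unfolding S_def by auto
  have "S = cball 0 b - ball 0 a" unfolding S_def by auto
  then have S: "compact S" by (simp add: compact_diff)
  have "\<exists>c>0. \<forall>x. c * norm x \<le> norm (z *\<^sub>C x - A x)" if z: "z \<in> S" for z
  proof -
    obtain K where K: "K > 0" "\<forall>x\<in>UNIV. norm (res z x) \<le> K * norm x"
      using op_bound[OF U res(1)] nz[OF z] by blast
    have "(1 / K) * norm x \<le> norm (z *\<^sub>C x - A x)" for x
      using bspec[OF K(2), of "z *\<^sub>C x - A x"] res(2)[of z x] nz[OF z] K(1) by (simp add: divide_le_eq mult.commute)
    then show ?thesis using K(1) by (intro exI[of _ "1 / K"]) auto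
  qed
  then obtain c where c: "\<And>z. z \<in> S \<Longrightarrow> c z > 0"
      "\<And>z x. z \<in> S \<Longrightarrow> c z * norm x \<le> norm (z *\<^sub>C x - A x)" by metis
  obtain F where F: "F \<subseteq> S" "finite F" "S \<subseteq> (\<Union>w\<in>F. ball w (c w / 2))"
  proof (rule compactE_image[OF S, of S "\<lambda>w. ball w (c w / 2)"])
    show "S \<subseteq> (\<Union>w\<in>S. ball w (c w / 2))" using c(1) by force
  qed auto
  \<comment> \<open>The element \<open>1\<close> keeps the minimum defined and positive when \<open>F\<close> is empty.\<close>
  define m where "m = Min (insert 1 ((\<lambda>w. c w / 2) ` F))"
  have m1: "m > 0" unfolding m_def using F c(1) by (auto simp: subset_iff)
  have m2: "m \<le> c w / 2" if "w \<in> F" for w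
    unfolding m_def using F(2) that by (intro Min_le) auto
  note m = m1 m2
  have low: "m * norm x \<le> norm (z *\<^sub>C x - A x)" if z: "z \<in> S" for z x
  proof -
    obtain w where w: "w \<in> F" "cmod (w - z) < c w / 2" using F(3) z by (auto simp: dist_norm)
    have "c w * norm x \<le> norm (w *\<^sub>C x - A x)" using c(2) w(1) F(1) by blast
    also have "w *\<^sub>C x - A x = (w - z) *\<^sub>C x + (z *\<^sub>C x - A x)"
      by (simp add: complex_vector.scale_left_diff_distrib)
    also have "norm \<dots> \<le> cmod (w - z) * norm x + norm (z *\<^sub>C x - A x)"
      using norm_triangle_ineq[of "(w - z) *\<^sub>C x"] by (simp add: norm_scaleC)
    also have "cmod (w - z) * norm x \<le> c w / 2 * norm x" using w(2) by (intro mult_right_mono) auto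
    finally have "c w / 2 * norm x \<le> norm (z *\<^sub>C x - A x)" by (simp add: algebra_simps)
    then show ?thesis using mult_right_mono[OF m(2)[OF w(1)] norm_ge_zero[of x]] by linarith
  qed
  have "norm (res z x) \<le> (1 / m) * norm x" if z: "a \<le> cmod z \<and> cmod z \<le> b" for z x
    using low[of z "res z x"] res(3)[of z x] nz[of z] z m(1) unfolding S_def
    by (simp add: le_divide_eq mult.commute)
  then show ?thesis using m(1) by (intro exI[of _ "1 / m"]) auto
qed

text \<open>
  The integrand of the Riesz projection with respect to the angle: on a circle around \<open>0\<close> the form
  \<open>dz / (2 \<pi> \<i>)\<close> is \<open>z dt\<close>, where \<open>t\<close> runs from \<open>0\<close> to \<open>1\<close>.
\<close>

definition g where "g z x = z *\<^sub>C res z x"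

lemma g_bounded_op: "z \<noteq> 0 \<Longrightarrow> cmod z < \<delta> \<Longrightarrow> g z \<in> bounded_ops UNIV"
  unfolding g_def[abs_def] by (rule bounded_ops_scaleC[OF res(1) U])

lemma g_estimates:
  "\<exists>G L. G > 0 \<and> L > 0 \<and>
    (\<forall>z x. a \<le> cmod z \<and> cmod z \<le> b \<longrightarrow> norm (g z x) \<le> G * norm x) \<and>
    (\<forall>z w x. a \<le> cmod z \<and> cmod z \<le> b \<and> a \<le> cmod w \<and> cmod w \<le> b
       \<longrightarrow> norm (g z x - g w x) \<le> L * cmod (z - w) * norm x)"
proof -
  obtain C where C: "C > 0" "\<And>z x. a \<le> cmod z \<Longrightarrow> cmod z \<le> b \<Longrightarrow> norm (res z x) \<le> C * norm x"
    using res_uniform_bound by blast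
  have "norm (g z x) \<le> (b * C) * norm x" if z: "a \<le> cmod z" "cmod z \<le> b" for z x
  proof -
    have "norm (g z x) = cmod z * norm (res z x)" by (simp add: g_def norm_scaleC)
    also have "\<dots> \<le> b * (C * norm x)" using z C ab by (intro mult_mono) auto
    finally show ?thesis by simp
  qed
  moreover have "norm (g z x - g w x) \<le> (C + b * C * C) * cmod (z - w) * norm x"
    if z: "a \<le> cmod z" "cmod z \<le> b" and w: "a \<le> cmod w" "cmod w \<le> b" for z w x
  proof -
    have z': "z \<noteq> 0" "cmod z < \<delta>" and w': "w \<noteq> 0" "cmod w < \<delta>" using z w ab by auto
    let ?y = "res w x"
    have "x = (z *\<^sub>C ?y - A ?y) + (w - z) *\<^sub>C ?y"
      using res(3)[OF w', of x] by (simp add: complex_vector.scale_left_diff_distrib)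
    then have "res z x = res z ((z *\<^sub>C ?y - A ?y) + (w - z) *\<^sub>C ?y)" by simp
    also have "\<dots> = ?y + (w - z) *\<^sub>C res z ?y"
      using op_add[OF U res(1)[OF z']] op_scaleC[OF U res(1)[OF z']] res(2)[OF z'] by simp
    \<comment> \<open>the resolvent identity\<close>
    finally have r: "res z x = ?y + (w - z) *\<^sub>C res z ?y" .
    have "g z x - g w x = (z - w) *\<^sub>C res z x + w *\<^sub>C (res z x - ?y)"
      unfolding g_def by (simp add: complex_vector.scale_left_diff_distrib complex_vector.scale_right_diff_distrib)
    also have "res z x - ?y = (w - z) *\<^sub>C res z ?y" using r by simp
    finally have "norm (g z x - g w x) \<le> norm ((z - w) *\<^sub>C res z x) + norm (w *\<^sub>C (w - z) *\<^sub>C res z ?y)"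
      using norm_triangle_ineq by metis
    also have "\<dots> = cmod (z - w) * norm (res z x) + cmod w * (cmod (z - w) * norm (res z ?y))"
      by (simp add: norm_scaleC norm_minus_commute norm_mult)
    also have "\<dots> \<le> cmod (z - w) * (C * norm x) + b * (cmod (z - w) * (C * (C * norm x)))"
    proof -
      have "norm (res z ?y) \<le> C * norm ?y" using C(2) z by blast
      also have "\<dots> \<le> C * (C * norm x)" using C w by (intro mult_left_mono) auto
      finally show ?thesis using z w C ab by (intro add_mono mult_mono mult_left_mono) auto
    qed
    finally show ?thesis by (simp add: algebra_simps)
  qed
  ultimately show ?thesis using C(1) ab
    by (intro exI[of _ "b * C"] exI[of _ "C + b * C * C"]) (auto intro!: add_pos_nonneg)
qed

text \<open>
  The Riemann sum with \<open>n\<close> equidistant nodes for the Riesz projection over the circle of radius \<open>r\<close>.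
\<close>

definition avg where "avg n r x = (1 / real n) *\<^sub>R (\<Sum>k<n. g (circle_point r (real k / real n)) x)"

lemma circle_point_ok: "a \<le> r \<Longrightarrow> r \<le> b \<Longrightarrow> circle_point r t \<noteq> 0 \<and> cmod (circle_point r t) < \<delta>
    \<and> a \<le> cmod (circle_point r t) \<and> cmod (circle_point r t) \<le> b"
  using cmod_circle_point[of r t] ab by auto

lemma norm_average_le:
  assumes "n > 0" "\<And>k. norm (f k) \<le> B"
  shows "norm ((1 / real n) *\<^sub>R (\<Sum>k<n. f k)) \<le> B"
proof -
  have "norm (\<Sum>k<n. f k) \<le> real n * B"
    using sum_norm_le[of "{..<n}" f "\<lambda>_. B"] assms(2) by simp
  then show ?thesis using assms(1) by (simp add: divide_le_eq mult.commute)
qed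

lemma avg_bounded_op:
  assumes r: "a \<le> r" "r \<le> b"
  shows "avg n r \<in> bounded_ops UNIV"
proof -
  have s: "(\<lambda>x. \<Sum>k<m. g (circle_point r (real k / real n)) x) \<in> bounded_ops UNIV" for m
  proof (induction m)
    case 0
    show ?case by (rule bounded_opsI[where K = 0]) auto
  next
    case (Suc m)
    show ?case
      using bounded_ops_add[OF Suc g_bounded_op U] circle_point_ok[OF r] by simp
  qed
  show ?thesis
    using bounded_ops_scaleC[OF s U, of "complex_of_real (1 / real n)" n]
    unfolding avg_def[abs_def] scaleC_of_real .
qed

lemma avg_commute:
  assumes r: "a \<le> r" "r \<le> b" and B: "B \<in> bounded_ops UNIV" and BA: "\<And>x. B (A x) = A (B x)"
  shows "B (avg n r x) = avg n r (B x)"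
proof -
  have "B (g z x) = g z (B x)" if "z \<noteq> 0" "cmod z < \<delta>" for z
    unfolding g_def using op_scaleC[OF U B] res_commute[OF that B BA] by simp
  then show ?thesis
    unfolding avg_def using circle_point_ok[OF r] by (simp add: op_scaleR[OF U B] op_sum[OF U B])
qed

lemma A_funpow: "A ^^ n \<in> bounded_ops UNIV"
  by (rule bounded_ops_funpow[OF A U])

lemma A_funpow_commute: "(A ^^ n) (A x) = A ((A ^^ n) x)"
  by (simp add: funpow_swap1)

text \<open>
  The factorisation \<open>z\<^sup>n - A\<^sup>n = (\<Sum>j<n. z\<^bsup>n-1-j\<^esup> A\<^sup>j) (z - A)\<close>, applied to the vector \<open>z (z - A)\<^sup>-\<^sup>1 x\<close>.
\<close>

lemma g_power_identity:
  assumes z: "z \<noteq> 0" "cmod z < \<delta>"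
  shows "z ^ n *\<^sub>C g z x - (A ^^ n) (g z x) = (\<Sum>j<n. z ^ (n - j) *\<^sub>C (A ^^ j) x)"
proof (induction n)
  case (Suc n)
  let ?y = "g z x"
  have Ay: "A ?y = z *\<^sub>C ?y - z *\<^sub>C x"
  proof -
    have "A (res z x) = z *\<^sub>C res z x - x" using res(3)[OF z, of x] by (simp add: algebra_simps)
    then show ?thesis
      unfolding g_def op_scaleC[OF U A UNIV_I] by (simp add: complex_vector.scale_right_diff_distrib)
  qed
  have "(A ^^ Suc n) ?y = (A ^^ n) (A ?y)" by (simp add: funpow_swap1)
  also have "\<dots> = z *\<^sub>C (A ^^ n) ?y - z *\<^sub>C (A ^^ n) x"
    unfolding Ay using op_diff[OF U A_funpow] op_scaleC[OF U A_funpow] by simp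
  finally have "z ^ Suc n *\<^sub>C ?y - (A ^^ Suc n) ?y = z *\<^sub>C (z ^ n *\<^sub>C ?y - (A ^^ n) ?y) + z *\<^sub>C (A ^^ n) x"
    by (simp add: complex_vector.scale_right_diff_distrib scaleC_scaleC)
  also have "\<dots> = (\<Sum>j<n. z ^ (Suc n - j) *\<^sub>C (A ^^ j) x) + z *\<^sub>C (A ^^ n) x"
    unfolding Suc complex_vector.scale_sum_right
    by (intro arg_cong2[where f = "(+)"] sum.cong) (auto simp: scaleC_scaleC Suc_diff_le)
  finally show ?case by simp
qed simp

text \<open>
  In other words, the average is \<open>r\<^sup>n (r\<^sup>n - A\<^sup>n)\<^sup>-\<^sup>1\<close>. The nodes are the solutions of \<open>z\<^sup>n = r\<^sup>n\<close>, so the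
  previous identity can be averaged with one and the same left factor, and by orthogonality only the
  summand with \<open>j = 0\<close> survives.
\<close>

lemma avg_identity:
  assumes r: "a \<le> r" "r \<le> b" and n: "n > 0"
  shows "r ^ n *\<^sub>R avg n r x - (A ^^ n) (avg n r x) = r ^ n *\<^sub>R x"
proof -
  let ?z = "\<lambda>k. circle_point r (real k / real n)"
  have zn: "?z k ^ n = complex_of_real (r ^ n)" for k
    unfolding circle_point_power using n circle_point_nat[of "r ^ n" k] by simp
  have "r ^ n *\<^sub>R avg n r x - (A ^^ n) (avg n r x)
      = (1 / real n) *\<^sub>R (\<Sum>k<n. ?z k ^ n *\<^sub>C g (?z k) x - (A ^^ n) (g (?z k) x))"
    unfolding avg_def zn scaleC_of_real sum_subtractf
    by (simp add: scaleR_right_diff_distrib scaleR_sum_right[symmetric] mult.commute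
        op_scaleR[OF U A_funpow] op_sum[OF U A_funpow])
  also have "(\<Sum>k<n. ?z k ^ n *\<^sub>C g (?z k) x - (A ^^ n) (g (?z k) x))
      = (\<Sum>k<n. \<Sum>j<n. ?z k ^ (n - j) *\<^sub>C (A ^^ j) x)"
    using g_power_identity circle_point_ok[OF r] by simp
  also have "\<dots> = (\<Sum>j<n. (\<Sum>k<n. ?z k ^ (n - j)) *\<^sub>C (A ^^ j) x)"
    by (subst sum.swap) (simp add: complex_vector.scale_sum_left)
  also have "\<dots> = (\<Sum>j<n. if j = 0 then real n *\<^sub>R r ^ n *\<^sub>R x else 0)"
  proof (rule sum.cong[OF refl])
    fix j assume j: "j \<in> {..<n}"
    show "(\<Sum>k<n. ?z k ^ (n - j)) *\<^sub>C (A ^^ j) x = (if j = 0 then real n *\<^sub>R r ^ n *\<^sub>R x else 0)"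
    proof (cases "j = 0")
      case True
      have "(\<Sum>k<n. ?z k ^ n) = complex_of_real (real n * r ^ n)" unfolding zn by simp
      then show ?thesis using True by (simp add: scaleC_of_real del: of_real_mult of_real_power)
    next
      case False
      then show ?thesis using sum_circle_points_power[of "n - j" n r] j by simp
    qed
  qed
  also have "\<dots> = real n *\<^sub>R r ^ n *\<^sub>R x" using n by (simp add: sum.delta)
  finally show ?thesis using n by simp
qed

text \<open>
  The function \<open>g\<close> is Lipschitz on the annulus. Doubling the number of nodes moves every other node by a
  distance proportional to \<open>1 / n\<close>, which gives the third estimate; it makes the averages over \<open>2\<^sup>j\<close>
  nodes converge in operator norm.
\<close>

lemma avg_estimates:
  obtains G K L where "0 < G" "0 < K" "0 < L"
    and "\<And>n r x. 0 < n \<Longrightarrow> a \<le> r \<Longrightarrow> r \<le> b \<Longrightarrow> norm (avg n r x) \<le> G * norm x"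
    and "\<And>n r s x. 0 < n \<Longrightarrow> a \<le> r \<Longrightarrow> r \<le> b \<Longrightarrow> a \<le> s \<Longrightarrow> s \<le> b
       \<Longrightarrow> norm (avg n r x - avg n s x) \<le> L * \<bar>r - s\<bar> * norm x"
    and "\<And>n r x. 0 < n \<Longrightarrow> a \<le> r \<Longrightarrow> r \<le> b
       \<Longrightarrow> norm (avg (2 * n) r x - avg n r x) \<le> K / real n * norm x"
proof -
  obtain G L where G: "G > 0" "\<And>z x. a \<le> cmod z \<Longrightarrow> cmod z \<le> b \<Longrightarrow> norm (g z x) \<le> G * norm x"
    and L: "L > 0" "\<And>z w x. a \<le> cmod z \<Longrightarrow> cmod z \<le> b \<Longrightarrow> a \<le> cmod w \<Longrightarrow> cmod w \<le> b
       \<Longrightarrow> norm (g z x - g w x) \<le> L * cmod (z - w) * norm x"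
    using g_estimates by blast
  have 1: "norm (avg n r x) \<le> G * norm x" if "0 < n" "a \<le> r" "r \<le> b" for n r x
    unfolding avg_def using that(1) by (rule norm_average_le) (use G circle_point_ok[OF that(2,3)] in blast)
  have 2: "norm (avg n r x - avg n s x) \<le> L * \<bar>r - s\<bar> * norm x"
    if n: "0 < n" and r: "a \<le> r" "r \<le> b" and s: "a \<le> s" "s \<le> b" for n r s x
  proof -
    have "avg n r x - avg n s x = (1 / real n) *\<^sub>R
        (\<Sum>k<n. g (circle_point r (real k / real n)) x - g (circle_point s (real k / real n)) x)"
      by (simp add: avg_def sum_subtractf scaleR_right_diff_distrib)
    also have "norm \<dots> \<le> L * \<bar>r - s\<bar> * norm x"
    proof (rule norm_average_le[OF n])
      fix k
      show "norm (g (circle_point r (real k / real n)) x - g (circle_point s (real k / real n)) x)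
          \<le> L * \<bar>r - s\<bar> * norm x"
        using L(2) circle_point_ok[OF r] circle_point_ok[OF s] circle_point_lipschitz_radius by metis
    qed
    finally show ?thesis .
  qed
  have 3: "norm (avg (2 * n) r x - avg n r x) \<le> (L * pi * b) / real n * norm x"
    if n: "0 < n" and r: "a \<le> r" "r \<le> b" for n r x
  proof -
    define f where "f t = g (circle_point r t) x" for t
    have "avg (2 * n) r x = (1 / real n) *\<^sub>R (\<Sum>k<n. (1/2) *\<^sub>R
        (f (real k / real n) + f (real (2 * k + 1) / real (2 * n))))"
      using n unfolding avg_def f_def[symmetric] sum_double scaleR_sum_right[symmetric]
      by (simp add: field_simps)
    moreover have "avg n r x = (1 / real n) *\<^sub>R (\<Sum>k<n. f (real k / real n))"
      by (simp add: avg_def f_def)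
    ultimately have "avg (2 * n) r x - avg n r x = (1 / real n) *\<^sub>R (\<Sum>k<n. (1/2) *\<^sub>R
        (f (real k / real n) + f (real (2 * k + 1) / real (2 * n))) - f (real k / real n))"
      by (simp only: sum_subtractf scaleR_right_diff_distrib)
    also have "norm \<dots> \<le> (L * pi * b) / real n * norm x"
    proof (rule norm_average_le[OF n])
      fix k
      let ?s = "real (2 * k + 1) / real (2 * n)" and ?t = "real k / real n"
      have "(1/2) *\<^sub>R (f ?t + f ?s) - f ?t = (1/2) *\<^sub>R (f ?s - f ?t)"
        using scaleR_left_distrib[of "1/2" "1/2" "f ?t"]
        by (simp add: scaleR_right_distrib scaleR_right_diff_distrib algebra_simps)
      then have "norm ((1/2) *\<^sub>R (f ?t + f ?s) - f ?t) = 1/2 * norm (f ?s - f ?t)" by simp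
      also have "\<dots> \<le> norm (f ?s - f ?t)" by simp
      also have "\<dots> \<le> L * cmod (circle_point r ?s - circle_point r ?t) * norm x"
        unfolding f_def using L(2) circle_point_ok[OF r] by blast
      also have "\<dots> \<le> L * (2 * pi * r * \<bar>?s - ?t\<bar>) * norm x"
        using L(1) r ab circle_point_lipschitz_angle[of r]
        by (intro mult_right_mono mult_left_mono) auto
      also have "\<bar>?s - ?t\<bar> = 1 / (2 * real n)" using n by (simp add: field_simps)
      also have "L * (2 * pi * r * (1 / (2 * real n))) * norm x = (L * pi * r) / real n * norm x"
        by simp
      also have "\<dots> \<le> (L * pi * b) / real n * norm x"
        using L(1) r by (intro mult_right_mono divide_right_mono mult_left_mono) auto
      finally show "norm ((1/2) *\<^sub>R (f ?t + f ?s) - f ?t) \<le> (L * pi * b) / real n * norm x" .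
    qed
    finally show ?thesis .
  qed
  have "0 < L * pi * b" using L(1) ab by simp
  then show ?thesis by (rule that[OF G(1) _ L(1) 1 2 3])
qed

text \<open>
  For \<open>r < s\<close>, dividing by \<open>s\<^sup>n\<close> leaves the factor \<open>(r / s)\<^sup>n\<close> on the right hand side, which tends to \<open>0\<close>,
  whereas the vectors stay bounded. Hence in the limit the average for \<open>r\<close> annihilates the complement of the average for \<open>s\<close>.
\<close>

lemma avg_idempotency_defect:
  assumes r: "a \<le> r" "r \<le> b" and s: "a \<le> s" "s \<le> b" and n: "0 < n"
  shows "s ^ n *\<^sub>R avg n r (x - avg n s x) = r ^ n *\<^sub>R (avg n s x - avg n r (avg n s x))"
proof -
  note op = avg_bounded_op[OF r, of n]
  have "s ^ n *\<^sub>R (x - avg n s x) = - (A ^^ n) (avg n s x)"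
    using avg_identity[OF s n, of x] by (simp add: scaleR_right_diff_distrib algebra_simps)
  then have "s ^ n *\<^sub>R avg n r (x - avg n s x) = - avg n r ((A ^^ n) (avg n s x))"
    using op_scaleR[OF U op, of "x - avg n s x" "s ^ n"] op_minus[OF U op] by simp
  also have "avg n r ((A ^^ n) (avg n s x)) = (A ^^ n) (avg n r (avg n s x))"
    using avg_commute[OF r A_funpow A_funpow_commute] by simp
  also have "- (A ^^ n) (avg n r (avg n s x)) = r ^ n *\<^sub>R (avg n s x - avg n r (avg n s x))"
    using avg_identity[OF r n, of "avg n s x"] by (simp add: scaleR_right_diff_distrib algebra_simps)
  finally show ?thesis .
qed

text \<open>
  The limit \<open>q\<close> of the averages on the inner circle, together with one average \<open>p\<close> so close to it that
  \<open>p\<close> has norm at most \<open>1/2\<close> on the kernel of \<open>q\<close> and differs from the identity by at most \<open>1/2\<close> on the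
  range of \<open>q\<close>.
\<close>

lemma averages_converge_to_projection:
  obtains q p n where "q \<in> bounded_ops UNIV" "\<And>x. q (q x) = q x"
    and "\<And>B x. B \<in> bounded_ops UNIV \<Longrightarrow> (\<And>x. B (A x) = A (B x)) \<Longrightarrow> B (q x) = q (B x)"
    and "p \<in> bounded_ops UNIV" "0 < n" "\<And>x. norm (p x - q x) \<le> 1/2 * norm x"
    and "\<And>x. a ^ n *\<^sub>R p x - (A ^^ n) (p x) = a ^ n *\<^sub>R x"
    and "\<And>B x. B \<in> bounded_ops UNIV \<Longrightarrow> (\<And>x. B (A x) = A (B x)) \<Longrightarrow> B (p x) = p (B x)"
proof (rule avg_estimates)
  fix G K L assume pos: "0 < G" "0 < K" "0 < L"
    and G: "\<And>n r x. 0 < n \<Longrightarrow> a \<le> r \<Longrightarrow> r \<le> b \<Longrightarrow> norm (avg n r x) \<le> G * norm x"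
    and L: "\<And>n r s x. 0 < n \<Longrightarrow> a \<le> r \<Longrightarrow> r \<le> b \<Longrightarrow> a \<le> s \<Longrightarrow> s \<le> b
       \<Longrightarrow> norm (avg n r x - avg n s x) \<le> L * \<bar>r - s\<bar> * norm x"
    and K: "\<And>n r x. 0 < n \<Longrightarrow> a \<le> r \<Longrightarrow> r \<le> b
       \<Longrightarrow> norm (avg (2 * n) r x - avg n r x) \<le> K / real n * norm x"
  define P where "P j r = avg (2 ^ j) r" for j r
  define Q where "Q r x = lim (\<lambda>j. P j r x)" for r x
  have inc: "norm (P (Suc j) r x - P j r x) \<le> K * norm x * (1/2) ^ j"
    if "a \<le> r" "r \<le> b" for j r x
    using K[of "2 ^ j" r x] that by (simp add: P_def power_divide)
  have PQ: "(\<lambda>j. P j r x) \<longlonglongrightarrow> Q r x" if "a \<le> r" "r \<le> b" for r x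
    unfolding Q_def using geometric_increments_convergent(1)[of "\<lambda>j. P j r x", OF inc[OF that]]
    by (simp only: convergent_LIMSEQ_iff)
  have PQn: "norm (P j r x - Q r x) \<le> 2 * K * (1/2) ^ j * norm x" if "a \<le> r" "r \<le> b" for j r x
    using geometric_increments_convergent(2)[of "\<lambda>j. P j r x", OF inc[OF that] PQ[OF that], of j] by (simp add: mult_ac)
  have Pop: "P j r \<in> bounded_ops UNIV" if "a \<le> r" "r \<le> b" for j r
    unfolding P_def by (rule avg_bounded_op[OF that])
  have PG: "norm (P j r x) \<le> G * norm x" if "a \<le> r" "r \<le> b" for j r x
    unfolding P_def using G that by simp
  have Qop: "Q r \<in> bounded_ops UNIV" if r: "a \<le> r" "r \<le> b" for r
  proof (rule bounded_opsI[where K = G])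
    show "Q r (x + y) = Q r x + Q r y" for x y
      using PQ[OF r, of "x + y"] tendsto_add[OF PQ[OF r, of x] PQ[OF r, of y]]
      unfolding op_add[OF U Pop[OF r] UNIV_I UNIV_I] by (rule LIMSEQ_unique)
    show "Q r (c *\<^sub>C x) = c *\<^sub>C Q r x" for c x
      using PQ[OF r, of "c *\<^sub>C x"]
        op_tendsto[OF U bounded_ops_scaleC[OF bounded_ops_id U] UNIV_I PQ[OF r, of x] UNIV_I, of c]
      unfolding op_scaleC[OF U Pop[OF r] UNIV_I] by (rule LIMSEQ_unique)
    show "norm (Q r x) \<le> G * norm x" for x
      using PG[OF r] by (intro Lim_bounded[OF tendsto_norm[OF PQ[OF r, of x]], of 0]) auto
  qed simp
  have QL: "norm (Q r x - Q s x) \<le> L * \<bar>r - s\<bar> * norm x"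
    if r: "a \<le> r" "r \<le> b" and s: "a \<le> s" "s \<le> b" for r s x
    using L[OF _ r s] unfolding P_def[symmetric]
    by (intro Lim_bounded[OF tendsto_norm[OF tendsto_diff[OF PQ[OF r] PQ[OF s]]], of 0]) (auto simp: P_def)
  \<comment> \<open>Idempotency comes from two radii: \<open>Q a\<close> annihilates \<open>1 - Q s\<close> for \<open>s > a\<close>, and \<open>Q s\<close> tends to \<open>Q a\<close>.\<close>
  have QQ: "Q a (x - Q s x) = 0" if s: "a < s" "s \<le> b" for s x
  proof -
    have a: "a \<le> a" "a \<le> b" and s': "a \<le> s" "s \<le> b" using ab s by auto
    define y where "y j = P j s x - P j a (P j s x)" for j
    have yb: "norm (y j) \<le> (G + G * G) * norm x" for j
    proof -
      have "norm (P j a (P j s x)) \<le> G * norm (P j s x)" by (rule PG[OF a])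
      also have "\<dots> \<le> G * (G * norm x)" using pos(1) PG[OF s'] by (intro mult_left_mono) auto
      finally show ?thesis
        using norm_triangle_ineq4[of "P j s x" "P j a (P j s x)"] PG[OF s', of j x]
        unfolding y_def by (simp add: algebra_simps)
    qed
    have "P j a (x - P j s x) = (a / s) ^ 2 ^ j *\<^sub>R y j" for j
    proof -
      have "s ^ 2 ^ j *\<^sub>R P j a (x - P j s x) = a ^ 2 ^ j *\<^sub>R y j"
        unfolding y_def P_def by (rule avg_idempotency_defect[OF a s']) simp
      then have "(1 / s ^ 2 ^ j) *\<^sub>R s ^ 2 ^ j *\<^sub>R P j a (x - P j s x)
          = (1 / s ^ 2 ^ j) *\<^sub>R a ^ 2 ^ j *\<^sub>R y j" by simp
      then show ?thesis using ab s by (simp add: power_divide)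
    qed
    then have nb: "norm (P j a (x - P j s x)) \<le> (a / s) ^ j * ((G + G * G) * norm x)" for j
    proof -
      assume eq: "\<And>j. P j a (x - P j s x) = (a / s) ^ 2 ^ j *\<^sub>R y j"
      have q: "0 \<le> a / s" "a / s \<le> 1" using ab s by simp_all
      have "norm (P j a (x - P j s x)) = (a / s) ^ 2 ^ j * norm (y j)" unfolding eq using q by simp
      also have "\<dots> \<le> (a / s) ^ j * ((G + G * G) * norm x)"
        using q yb[of j] less_exp[of j] by (intro mult_mono power_decreasing) auto
      finally show ?thesis .
    qed
    have "(\<lambda>j. P j a (x - P j s x)) \<longlonglongrightarrow> 0"
    proof (rule Lim_null_comparison)
      show "\<forall>\<^sub>F j in sequentially. norm (P j a (x - P j s x)) \<le> (a / s) ^ j * ((G + G * G) * norm x)"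
        using nb by simp
      show "(\<lambda>j. (a / s) ^ j * ((G + G * G) * norm x)) \<longlonglongrightarrow> 0"
        using ab s by (intro tendsto_mult_left_zero LIMSEQ_power_zero) simp
    qed
    moreover have "(\<lambda>j. P j a (x - P j s x)) \<longlonglongrightarrow> Q a (x - Q s x)"
    proof -
      have "(\<lambda>j. P j a (Q s x - P j s x)) \<longlonglongrightarrow> 0"
      proof (rule Lim_null_comparison)
        show "\<forall>\<^sub>F j in sequentially. norm (P j a (Q s x - P j s x)) \<le> G * norm (Q s x - P j s x)"
          using PG[OF a] by simp
        show "(\<lambda>j. G * norm (Q s x - P j s x)) \<longlonglongrightarrow> 0"
          using tendsto_diff[OF tendsto_const[of "Q s x"] PQ[OF s', of x]]
          by (intro tendsto_mult_right_zero tendsto_norm_zero) simp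
      qed
      from tendsto_add[OF this PQ[OF a, of "x - Q s x"]]
      show ?thesis by (simp add: op_add[OF U Pop[OF a] UNIV_I UNIV_I, symmetric])
    qed
    ultimately show ?thesis using LIMSEQ_unique by blast
  qed
  have a: "a \<le> a" "a \<le> b" using ab by auto
  define q where "q = Q a"
  have q: "q \<in> bounded_ops UNIV" unfolding q_def by (rule Qop[OF a])
  have qG: "norm (q x) \<le> G * norm x" for x
    unfolding q_def using PG[OF a] by (intro Lim_bounded[OF tendsto_norm[OF PQ[OF a, of x]], of 0]) auto
  have "q (x - q x) = 0" for x
  proof -
    have le: "norm (q (x - q x)) \<le> (G * L * norm x) * e" if e: "e > 0" "e \<le> b - a" for e
    proof -
      have s: "a < a + e" "a + e \<le> b" using e by auto
      have "q (x - q x) = q (x - Q (a + e) x) + q (Q (a + e) x - q x)"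
        using op_add[OF U q, of "x - Q (a + e) x" "Q (a + e) x - q x"] by simp
      also have "q (x - Q (a + e) x) = 0" unfolding q_def by (rule QQ[OF s])
      finally have "norm (q (x - q x)) \<le> G * norm (Q (a + e) x - Q a x)" using qG by (simp add: q_def)
      also have "\<dots> \<le> G * (L * \<bar>a + e - a\<bar> * norm x)"
        using pos s a by (intro mult_left_mono QL) auto
      finally show ?thesis using e by (simp add: mult_ac)
    qed
    show ?thesis
    proof (rule ccontr)
      assume nz: "q (x - q x) \<noteq> 0"
      define W where "W = G * L * norm x"
      have W: "W \<ge> 0" unfolding W_def using pos by simp
      define N where "N = norm (q (x - q x))"
      have N: "N > 0" unfolding N_def using nz by simp
      define e where "e = min (b - a) (N / (2 * (W + 1)))"
      have e: "e > 0" "e \<le> b - a" unfolding e_def using ab N W by auto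
      have "N \<le> W * e" using le[OF e] unfolding N_def W_def .
      also have "\<dots> \<le> W * (N / (2 * (W + 1)))" using W unfolding e_def by (intro mult_left_mono) auto
      also have "\<dots> \<le> (W + 1) * (N / (2 * (W + 1)))" using W N by (intro mult_right_mono) auto
      also have "\<dots> = N / 2"
      proof -
        have cancel: "m * (N / (2 * m)) = N / 2" if "m \<noteq> 0" for m :: real using that by simp
        show ?thesis by (rule cancel) (use W in linarith)
      qed
      finally show False using N by simp
    qed
  qed
  then have idem: "q (q x) = q x" for x using op_diff[OF U q, of x "q x"] by simp
  have comm: "B (q x) = q (B x)" if B: "B \<in> bounded_ops UNIV" and BA: "\<And>x. B (A x) = A (B x)" for B x
  proof -
    have "(\<lambda>j. B (P j a x)) \<longlonglongrightarrow> B (q x)"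
      unfolding q_def by (rule op_tendsto[OF U B UNIV_I PQ[OF a] UNIV_I])
    moreover have "B (P j a x) = P j a (B x)" for j
      unfolding P_def by (rule avg_commute[OF a B BA])
    ultimately have "(\<lambda>j. P j a (B x)) \<longlonglongrightarrow> B (q x)" by simp
    then show ?thesis unfolding q_def using PQ[OF a, of "B x"] LIMSEQ_unique by blast
  qed
  obtain j where j: "2 * K * (1/2) ^ j \<le> (1/2 :: real)"
  proof -
    have "(\<lambda>j. 2 * K * (1/2::real) ^ j) \<longlonglongrightarrow> 0"
      by (intro tendsto_mult_right_zero LIMSEQ_power_zero) simp
    then have "\<forall>\<^sub>F j in sequentially. 2 * K * (1/2::real) ^ j < 1/2"
      by (rule order_tendstoD(2)) simp
    then show ?thesis using that eventually_happens[of _ sequentially] by (metis less_imp_le sequentially_bot)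
  qed
  define n where "n = (2::nat) ^ j"
  have n: "n > 0" unfolding n_def by simp
  define p where "p = P j a"
  have p: "p \<in> bounded_ops UNIV" unfolding p_def by (rule Pop[OF a])
  have pq: "norm (p x - q x) \<le> 1/2 * norm x" for x
    using PQn[OF a, of j x] mult_right_mono[OF j, of "norm x"] unfolding p_def q_def by simp
  have pid: "a ^ n *\<^sub>R p x - (A ^^ n) (p x) = a ^ n *\<^sub>R x" for x
    unfolding p_def P_def n_def by (rule avg_identity[OF a]) simp
  have pcomm: "B (p x) = p (B x)" if B: "B \<in> bounded_ops UNIV" and BA: "\<And>x. B (A x) = A (B x)" for B x
    unfolding p_def P_def by (rule avg_commute[OF a B BA])
  show thesis by (rule that[OF q idem comm p n pq pid pcomm])
qed

text \<open>
  Everything follows from \<open>r\<^sup>n (p - 1) = A\<^sup>n p\<close>, where \<open>r\<close> is the radius of the inner circle. On the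
  kernel of \<open>q\<close> the operator \<open>1 - p\<close> is invertible by the Neumann series, hence so is its factor \<open>A\<close>. On
  the range of \<open>q\<close> the operator \<open>p\<close> is invertible and the identity bounds the norm of \<open>A\<^sup>n\<close> by \<open>r\<^sup>n\<close>, so
  that \<open>A\<close> has no spectrum outside the circle; inside the punctured disc there is none by assumption.
\<close>

lemma riesz_projection:
  "\<exists>Q\<in>bounded_ops UNIV. (\<forall>x. Q (Q x) = Q x) \<and>
    (\<forall>B\<in>bounded_ops UNIV. (\<forall>x. B (A x) = A (B x)) \<longrightarrow> (\<forall>x. B (Q x) = Q (B x))) \<and>
    bij_betw A {x. Q x = 0} {x. Q x = 0} \<and> spectrum (range Q) A \<subseteq> {0}"
proof (rule averages_converge_to_projection)
  fix q p n
  assume q: "q \<in> bounded_ops UNIV" and idem: "\<And>x. q (q x) = q x"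
    and comm: "\<And>B x. B \<in> bounded_ops UNIV \<Longrightarrow> (\<And>x. B (A x) = A (B x)) \<Longrightarrow> B (q x) = q (B x)"
    and p: "p \<in> bounded_ops UNIV" and n: "0 < n" and pq: "\<And>x. norm (p x - q x) \<le> 1/2 * norm x"
    and pid: "\<And>x. a ^ n *\<^sub>R p x - (A ^^ n) (p x) = a ^ n *\<^sub>R x"
    and pcomm: "\<And>B x. B \<in> bounded_ops UNIV \<Longrightarrow> (\<And>x. B (A x) = A (B x)) \<Longrightarrow> B (p x) = p (B x)"
  have Aq: "A (q x) = q (A x)" for x by (rule comm[OF A refl])
  interpret red: reduced_operator UNIV A q
    by (standard) (use U A q idem Aq in auto)
  have pqc: "q (p x) = p (q x)" for x using pcomm[OF q Aq[symmetric]] .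
  have an: "a ^ n > 0" using ab by simp

  have bij0: "bij_betw A {x. q x = 0} {x. q x = 0}"
  proof -
    let ?N = "{x. q x = 0}"
    have N: "closed_subspace ?N" using red.closed_subspace_kernel by simp
    have AN: "A \<in> bounded_ops ?N" using red.bounded_kernel by simp
    have pN: "p \<in> bounded_ops ?N"
      by (rule bounded_ops_restrict[OF p]) (auto simp: pqc op_0[OF U p])
    have half: "norm (p x) \<le> 1/2 * norm x" if "x \<in> ?N" for x using pq[of x] that by simp
    have "inj_on A ?N"
      unfolding op_inj_iff[OF N AN]
    proof (intro ballI impI)
      fix x assume x: "x \<in> ?N" "A x = 0"
      have "(A ^^ n) x = 0"
      proof -
        have "(A ^^ n) x = (A ^^ (n - 1)) (A x)" using n by (cases n) (simp_all add: funpow_swap1)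
        then show ?thesis using x op_0[OF U A_funpow] by simp
      qed
      then have "(A ^^ n) (p x) = 0" using pcomm[OF A_funpow A_funpow_commute, of n x] op_0[OF U p] by simp
      then have "a ^ n *\<^sub>R p x = a ^ n *\<^sub>R x" using pid[of x] by simp
      then have "p x = x" using ab by simp
      then have "norm x \<le> 1/2 * norm x" using half[OF x(1)] by simp
      then show "x = 0" by simp
    qed
    moreover have "y \<in> A ` ?N" if y: "y \<in> ?N" for y
    proof -
      have "bij_betw (\<lambda>x. x - p x) ?N ?N" by (rule neumann_bij[OF N pN _ _ half]) auto
      then have "y \<in> (\<lambda>x. x - p x) ` ?N" using y by (simp add: bij_betw_def)
      then obtain x where x: "x \<in> ?N" "y = x - p x" by (rule imageE) auto
      have px: "p x \<in> ?N" by (rule op_in[OF N pN x(1)])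
      define w where "w = (- (1 / a ^ n)) *\<^sub>R (A ^^ (n - 1)) (p x)"
      have wN: "w \<in> ?N"
        unfolding w_def by (rule closed_subspace_scaleR[OF N op_in[OF N bounded_ops_funpow[OF AN N] px]])
      have "A w = (- (1 / a ^ n)) *\<^sub>R A ((A ^^ (n - 1)) (p x))"
        unfolding w_def by (rule op_scaleR[OF U A UNIV_I])
      also have "A ((A ^^ (n - 1)) (p x)) = (A ^^ n) (p x)" using n by (cases n) simp_all
      also have "(A ^^ n) (p x) = - (a ^ n *\<^sub>R y)"
        unfolding x(2) using pid[of x] by (simp add: scaleR_right_diff_distrib algebra_simps)
      also have "(- (1 / a ^ n)) *\<^sub>R - (a ^ n *\<^sub>R y) = y" using ab by simp
      finally have "A w = y" .
      then show ?thesis using wN by (intro image_eqI[of _ _ w]) auto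
    qed
    ultimately show ?thesis
      unfolding bij_betw_def using op_in[OF N AN] by (intro conjI equalityI subsetI) auto
  qed

  have spec: "z \<notin> spectrum (range q) A" if z: "z \<noteq> 0" for z
  proof -
    let ?M = "range q"
    have M: "closed_subspace ?M" by (rule red.closed_subspace_range)
    have AM: "A \<in> bounded_ops ?M" by (rule red.bounded_range)
    show ?thesis
    proof (cases "cmod z < \<delta>")
      case True
      have "bij_betw (\<lambda>x. z *\<^sub>C x - A x) ?M ?M"
        using reduced_operator.bij_split[OF red.shift[of z]] bij[OF z True] by blast
      then show ?thesis using spectrum_iff_not_bij[OF M AM] by blast
    next
      case False
      have qM: "q x = x" if "x \<in> ?M" for x using that idem by auto
      have pM: "p x \<in> ?M" if "x \<in> ?M" for x
        using pqc[of x] qM[OF that] by (intro image_eqI[of _ q "p x"]) auto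
      have dM: "(\<lambda>x. x - p x) \<in> bounded_ops ?M"
        by (rule bounded_ops_restrict[OF bounded_ops_diff[OF bounded_ops_id p U]])
          (auto intro: closed_subspace_diff[OF M] pM)
      have half: "norm (x - p x) \<le> 1/2 * norm x" if "x \<in> ?M" for x
        using pq[of x] qM[OF that] by (simp add: norm_minus_commute)
      have "bij_betw (\<lambda>x. x - (x - p x)) ?M ?M" by (rule neumann_bij[OF M dM _ _ half]) auto
      then have psurj: "p ` ?M = ?M" by (simp add: bij_betw_def)
      have AMn: "A ^^ n \<in> bounded_ops ?M" by (rule bounded_ops_funpow[OF AM M])
      have An: "norm ((A ^^ n) u) \<le> a ^ n * norm u" if u: "u \<in> ?M" for u
      proof -
        have "u \<in> p ` ?M" unfolding psurj by (rule u)
        then obtain x where x: "x \<in> ?M" "u = p x" by (rule imageE) auto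
        have "norm x \<le> norm u + norm (x - p x)" using norm_triangle_ineq[of "p x" "x - p x"] x(2) by simp
        then have "1/2 * norm x \<le> norm u" using half[OF x(1)] by simp
        then have "norm (x - p x) \<le> norm u" using half[OF x(1)] by linarith
        moreover have "(A ^^ n) u = - (a ^ n *\<^sub>R (x - p x))"
          unfolding x(2) using pid[of x] by (simp add: scaleR_right_diff_distrib algebra_simps)
        ultimately show ?thesis using an by simp
      qed
      have az: "a < cmod z" using False ab by simp
      define B where "B x = (1 / z ^ n) *\<^sub>C (A ^^ n) x" for x
      have Bop: "B \<in> bounded_ops ?M" unfolding B_def[abs_def] by (rule bounded_ops_scaleC[OF AMn M])
      have Bq: "norm (B x) \<le> (a / cmod z) ^ n * norm x" if "x \<in> ?M" for x
      proof -
        have "norm (B x) = norm ((A ^^ n) x) / cmod z ^ n"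
          by (simp add: B_def norm_scaleC norm_divide norm_power)
        also have "\<dots> \<le> a ^ n * norm x / cmod z ^ n" using An[OF that] by (intro divide_right_mono) auto
        finally show ?thesis by (simp add: power_divide)
      qed
      have "0 < a / cmod z" "a / cmod z < 1" using z az ab by (simp_all add: divide_less_eq)
      then have "(a / cmod z) ^ n < 1" using power_strict_decreasing[of 0 n "a / cmod z"] n by simp
      then have bijB: "bij_betw (\<lambda>x. x - B x) ?M ?M"
        using ab by (intro neumann_bij[OF M Bop _ _ Bq]) auto
      have zB: "z ^ n *\<^sub>C (x - B x) = z ^ n *\<^sub>C x - (A ^^ n) x" for x
        using z complex_vector.scale_one[of "(A ^^ n) x"]
        by (simp add: B_def complex_vector.scale_right_diff_distrib scaleC_scaleC)
      have "bij_betw (\<lambda>x. z ^ n *\<^sub>C x - (A ^^ n) x) ?M ?M"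
        using bij_betw_trans[OF bijB bij_scaleC[OF M, of "z ^ n"]] z unfolding o_def zB by simp
      then have "bij_betw (\<lambda>x. z *\<^sub>C x - A x) ?M ?M" by (rule shift_bij_of_power[OF M AM])
      then show ?thesis using spectrum_iff_not_bij[OF M AM] by blast
    qed
  qed
  show ?thesis
    using q idem comm bij0 spec by (intro bexI[of _ q]) auto
qed

end

section \<open>Independence of the decomposition\<close>

text \<open>
  The common form of all the properties that are compared: a projection whose range and kernel are the
  invertible and the zeroloid part of \<open>T\<close>.
\<close>

definition gz_projection :: "('a::complex_banach \<Rightarrow> 'a) \<Rightarrow> ('a \<Rightarrow> 'a) \<Rightarrow> bool" where
  "gz_projection T E \<longleftrightarrow>
    reduced_operator UNIV T E \<and> bij_betw T (range E) (range E) \<and> zeroloid {x. E x = 0} T"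

lemma reduced_operatorI:
  assumes T: "T \<in> bounded_ops UNIV" and E: "E \<in> bounded_ops UNIV" and idem: "\<And>x. E (E x) = E x"
    and M: "\<And>x. x \<in> range E \<Longrightarrow> T x \<in> range E" and N: "\<And>x. E x = 0 \<Longrightarrow> E (T x) = 0"
  shows "reduced_operator UNIV T E"
proof
  note U = closed_subspace_UNIV
  fix x
  have "E (x - E x) = 0" using op_diff[OF U E, of x "E x"] idem by simp
  then have "E (T (x - E x)) = 0" by (rule N)
  then have "E (T x) = E (T (E x))" using op_diff[OF U T, of x "E x"] op_diff[OF U E, of "T x" "T (E x)"] by simp
  moreover have "T (E x) \<in> range E" by (rule M) simp
  then have "E (T (E x)) = T (E x)" using idem by auto
  ultimately show "E (T x) = T (E x)" by simp
qed (use T E idem closed_subspace_UNIV in auto)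

lemma Red_imp_projection:
  assumes T: "T \<in> bounded_ops UNIV" and R: "(M, N) \<in> Red UNIV T"
  shows "\<exists>E. reduced_operator UNIV T E \<and> range E = M \<and> {x. E x = 0} = N"
proof -
  have M: "closed_subspace M" and N: "closed_subspace N" and inv: "T ` M \<subseteq> M" "T ` N \<subseteq> N"
    and sum: "{x + y |x y. x \<in> M \<and> y \<in> N} = UNIV" and int: "M \<inter> N = {0}"
    using R unfolding Red_def by auto
  have "\<exists>E. bounded_projection UNIV E \<and> range E = (\<lambda>x. x) ` M \<and> {x. E x = 0} = N"
  proof (rule projection_onto_operator_range[OF M N bounded_ops_id])
    fix z have "z \<in> {x + y |x y. x \<in> M \<and> y \<in> N}" unfolding sum by simp
    then show "\<exists>x\<in>M. \<exists>y\<in>N. z = x + y" by blast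
  qed (use int in simp)
  then obtain E where E: "bounded_projection UNIV E" "range E = M" "{x. E x = 0} = N" by auto
  have "reduced_operator UNIV T E"
  proof (rule reduced_operatorI[OF T])
    show "E \<in> bounded_ops UNIV" "\<And>x. E (E x) = E x" using E(1) unfolding bounded_projection_def by auto
    show "T x \<in> range E" if "x \<in> range E" for x using that inv(1) unfolding E(2) by auto
    show "E (T x) = 0" if "E x = 0" for x
    proof -
      have "x \<in> N" using that E(3) by blast
      then have "T x \<in> N" using inv(2) by blast
      then show ?thesis using E(3) by blast
    qed
  qed
  then show ?thesis using E by blast
qed

lemma reduced_operator_imp_Red:
  assumes "reduced_operator UNIV T E"
  shows "(range E, {x. E x = 0}) \<in> Red UNIV T" "({x. E x = 0}, range E) \<in> Red UNIV T"
proof -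
  interpret reduced_operator UNIV T E by fact
  have "x \<in> {u + v |u v. u \<in> range E \<and> v \<in> {x. E x = 0}}" for x
    using residual_kernel[of x] by (intro CollectI exI[of _ "E x"] exI[of _ "x - E x"]) simp
  then have 1: "{u + v |u v. u \<in> range E \<and> v \<in> {x. E x = 0}} = UNIV" by blast
  have "x \<in> {u + v |u v. u \<in> {x. E x = 0} \<and> v \<in> range E}" for x
    using residual_kernel[of x] by (intro CollectI exI[of _ "x - E x"] exI[of _ "E x"]) simp
  then have 2: "{u + v |u v. u \<in> {x. E x = 0} \<and> v \<in> range E} = UNIV" by blast
  have 3: "range E \<inter> {x. E x = 0} = {0}" "{x. E x = 0} \<inter> range E = {0}"
    using idem op_0[OF Y E] by auto
  have 4: "T ` range E \<subseteq> range E" "T ` {x. E x = 0} \<subseteq> {x. E x = 0}"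
    using range_invariant kernel_invariant by auto
  have 5: "closed_subspace {x. E x = 0}" using closed_subspace_kernel by simp
  show "(range E, {x. E x = 0}) \<in> Red UNIV T" "({x. E x = 0}, range E) \<in> Red UNIV T"
    unfolding Red_def
    by (rule CollectI, unfold case_prod_conv, intro conjI 1 2 3 4 5 closed_subspace_range)+
qed

lemma gz_projection_pair:
  assumes "gz_projection T E"
  shows "(range E, {x. E x = 0}) \<in> gzKD UNIV T" "closed_subspace (range E)"
    "T \<in> bounded_ops (range E)" "bij_betw T (range E) (range E)"
proof -
  have r: "reduced_operator UNIV T E" and b: "bij_betw T (range E) (range E)"
    and z: "zeroloid {x. E x = 0} T" using assms unfolding gz_projection_def by auto
  interpret reduced_operator UNIV T E by (fact r)
  show 1: "closed_subspace (range E)" "T \<in> bounded_ops (range E)" "bij_betw T (range E) (range E)"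
    using closed_subspace_range bounded_range b by auto
  show "(range E, {x. E x = 0}) \<in> gzKD UNIV T"
    unfolding gzKD_def using reduced_operator_imp_Red(1)[OF r] bij_ascent_descent(3)[OF 1] z by simp
qed

lemma gzKD_bij_imp_gz_projection:
  assumes T: "T \<in> bounded_ops UNIV" and MN: "(M, N) \<in> Red UNIV T" and z: "zeroloid N T"
    and b: "bij_betw T M M"
  shows "\<exists>E. gz_projection T E"
  using Red_imp_projection[OF T MN] z b unfolding gz_projection_def by blast

lemma Red_closed:
  assumes "T \<in> bounded_ops UNIV" "(M, N) \<in> Red Y T"
  shows "closed_subspace M" "closed_subspace N" "T \<in> bounded_ops M" "T \<in> bounded_ops N"
proof -
  show "closed_subspace M" "closed_subspace N" using assms(2) unfolding Red_def by auto
  have inv: "T ` M \<subseteq> M" "T ` N \<subseteq> N" using assms(2) unfolding Red_def by auto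
  show "T \<in> bounded_ops M" by (rule bounded_ops_restrict[OF assms(1) subset_UNIV]) (use inv in blast)
  show "T \<in> bounded_ops N" by (rule bounded_ops_restrict[OF assms(1) subset_UNIV]) (use inv in blast)
qed

text \<open>
  Away from the spectrum on \<open>N\<close>, the operator \<open>z - T\<close> on the whole space behaves as it does on \<open>M\<close>. This
  is what transports injectivity and surjectivity from one decomposition to another.
\<close>

lemma Red_shift:
  assumes T: "T \<in> bounded_ops UNIV" and R: "(M, N) \<in> Red UNIV T" and z: "z \<notin> spectrum N T"
  shows "inj (\<lambda>x. z *\<^sub>C x - T x) \<longleftrightarrow> inj_on (\<lambda>x. z *\<^sub>C x - T x) M"
    and "surj (\<lambda>x. z *\<^sub>C x - T x) \<longleftrightarrow> (\<lambda>x. z *\<^sub>C x - T x) ` M = M"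
proof -
  obtain E where E: "reduced_operator UNIV T E" "range E = M" "{x. E x = 0} = N"
    using Red_imp_projection[OF T R] by blast
  interpret s: reduced_operator UNIV "\<lambda>x. z *\<^sub>C x - T x" E by (rule reduced_operator.shift[OF E(1)])
  have b: "bij_betw (\<lambda>x. z *\<^sub>C x - T x) N N"
    using z spectrum_iff_not_bij[OF Red_closed(2,4)[OF T R]] by blast
  show "inj (\<lambda>x. z *\<^sub>C x - T x) \<longleftrightarrow> inj_on (\<lambda>x. z *\<^sub>C x - T x) M"
    using s.inj_split bij_betw_imp_inj_on[OF b] E(2,3) by simp
  show "surj (\<lambda>x. z *\<^sub>C x - T x) \<longleftrightarrow> (\<lambda>x. z *\<^sub>C x - T x) ` M = M"
    using s.surj_split bij_betw_imp_surj_on[OF b] E(2,3) by simp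
qed

lemma gzKD_D:
  assumes "(M, N) \<in> gzKD UNIV T"
  shows "(M, N) \<in> Red UNIV T" "semi_regular M T" "zeroloid N T"
  using assms by (auto simp: gzKD_def)

text \<open>
  Surjectivity on \<open>M'\<close> persists for small \<open>z\<close>, passes to the whole space and to \<open>M\<close> for suitable \<open>z\<close>, and
  returns to \<open>z = 0\<close> because \<open>T\<close> is bounded below on \<open>M\<close>.
\<close>

lemma left_right_gz_invertible_bij:
  assumes T: "T \<in> bounded_ops UNIV"
    and l: "(M, N) \<in> gzKD UNIV T" "bounded_below M T"
    and r: "(M', N') \<in> gzKD UNIV T" "T ` M' = M'"
  shows "bij_betw T M M"
proof -
  note L = gzKD_D[OF l(1)] and R = gzKD_D[OF r(1)]
  note M = Red_closed(1,3)[OF T L(1)] and M' = Red_closed(1,3)[OF T R(1)]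
  obtain c where c: "c > 0" "\<forall>x\<in>M. c * norm x \<le> norm (T x)" using l(2) unfolding bounded_below_def by blast
  have inj: "inj_on T M"
    unfolding op_inj_iff[OF M]
  proof (intro ballI impI)
    fix x assume "x \<in> M" "T x = 0"
    then have "c * norm x \<le> 0" using c(2) by fastforce
    then show "x = 0" using c(1) by (simp add: mult_le_0_iff)
  qed
  obtain e' where e': "e' > 0" "\<forall>z. cmod z < e' \<longrightarrow> (\<lambda>x. z *\<^sub>C x - T x) ` M' = M'"
    using surjective_perturbation[OF M' r(2)] by blast
  have "T ` M = M"
  proof (rule surj_limit[OF M inj])
    show "closed (T ` M)" using L(2) unfolding semi_regular_def by blast
    fix e :: real assume "e > 0"
    then have "min e e' > 0" using e' by simp
    then obtain z where z: "cmod z < min e e'" "z \<notin> spectrum N T" "z \<notin> spectrum N' T"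
      using zeroloid_punctured[OF L(3) R(3)] by blast
    have "(\<lambda>x. z *\<^sub>C x - T x) ` M' = M'" using e'(2) z(1) by simp
    then have "(\<lambda>x. z *\<^sub>C x - T x) ` M = M"
      using Red_shift(2)[OF T L(1) z(2)] Red_shift(2)[OF T R(1) z(3)] by simp
    then show "\<exists>z. cmod z < e \<and> (\<lambda>x. z *\<^sub>C x - T x) ` M = M" using z(1) by auto
  qed
  then show ?thesis using inj by (simp add: bij_betw_def)
qed

lemma bij_imp_bounded_below:
  assumes "closed_subspace M" "T \<in> bounded_ops M" "bij_betw T M M"
  shows "bounded_below M T"
  using inj_closed_range_imp_bounded_below[OF assms(1,2)] assms(3) closed_subspace_closed[OF assms(1)]
  by (simp add: bij_betw_def)

lemma bij_perturbation:
  assumes M: "closed_subspace M" "T \<in> bounded_ops M" and b: "bij_betw T M M"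
  shows "\<exists>e>0. \<forall>z. cmod z < e \<longrightarrow> bij_betw (\<lambda>x. z *\<^sub>C x - T x) M M"
proof -
  obtain e1 where e1: "e1 > 0" "\<forall>z. cmod z < e1 \<longrightarrow> inj_on (\<lambda>x. z *\<^sub>C x - T x) M"
    using inj_perturbation[OF M bij_imp_bounded_below[OF M b]] by blast
  obtain e2 where e2: "e2 > 0" "\<forall>z. cmod z < e2 \<longrightarrow> (\<lambda>x. z *\<^sub>C x - T x) ` M = M"
    using surjective_perturbation[OF M bij_betw_imp_surj_on[OF b]] by blast
  show ?thesis using e1 e2 by (intro exI[of _ "min e1 e2"]) (simp add: bij_betw_def)
qed

text \<open>
  The same transport as before, but on \<open>M'\<close> only semi-regularity is known, so injectivity has to be
  carried back to \<open>z = 0\<close> first.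
\<close>

lemma gzKD_bij_independent:
  assumes T: "T \<in> bounded_ops UNIV" and E: "gz_projection T E" and r: "(M', N') \<in> gzKD UNIV T"
  shows "bij_betw T M' M'"
proof -
  note L = gzKD_D[OF gz_projection_pair(1)[OF E]] and R = gzKD_D[OF r]
  note M = gz_projection_pair(2,3)[OF E] and M' = Red_closed(1,3)[OF T R(1)]
  obtain e' where e': "e' > 0" "\<forall>z. cmod z < e' \<longrightarrow> bij_betw (\<lambda>x. z *\<^sub>C x - T x) (range E) (range E)"
    using bij_perturbation[OF M gz_projection_pair(4)[OF E]] by blast
  have near: "\<exists>z. cmod z < e \<and> inj_on (\<lambda>x. z *\<^sub>C x - T x) M' \<and> (\<lambda>x. z *\<^sub>C x - T x) ` M' = M'"
    if "e > 0" for e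
  proof -
    have "min e e' > 0" using e' that by simp
    then obtain z where z: "cmod z < min e e'" "z \<notin> spectrum {x. E x = 0} T" "z \<notin> spectrum N' T"
      using zeroloid_punctured[OF L(3) R(3)] by blast
    have "bij_betw (\<lambda>x. z *\<^sub>C x - T x) (range E) (range E)" using e'(2) z(1) by simp
    then have "inj_on (\<lambda>x. z *\<^sub>C x - T x) M'" "(\<lambda>x. z *\<^sub>C x - T x) ` M' = M'"
      using Red_shift[OF T L(1) z(2)] Red_shift[OF T R(1) z(3)] by (simp_all add: bij_betw_def)
    then show ?thesis using z(1) by auto
  qed
  have inj: "inj_on T M'" by (rule semi_regular_inj_limit[OF M' R(2)]) (use near in blast)
  have "T ` M' = M'"
  proof (rule surj_limit[OF M' inj])
    show "closed (T ` M')" using R(2) unfolding semi_regular_def by blast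
  qed (use near in blast)
  then show ?thesis using inj by (simp add: bij_betw_def)
qed

lemma gz_invertible_iff:
  assumes T: "T \<in> bounded_ops UNIV"
  shows "gz_invertible UNIV T \<longleftrightarrow> (\<exists>E. gz_projection T E)"
proof
  assume "gz_invertible UNIV T"
  then obtain M N M' N' where l: "(M, N) \<in> gzKD UNIV T" "bounded_below M T"
    and r: "(M', N') \<in> gzKD UNIV T" "T ` M' = M'"
    unfolding gz_invertible_def left_gz_invertible_def right_gz_invertible_def surjective_op_def by auto
  show "\<exists>E. gz_projection T E"
    by (rule gzKD_bij_imp_gz_projection[OF T gzKD_D(1,3)[OF l(1)] left_right_gz_invertible_bij[OF T l r]])
next
  assume "\<exists>E. gz_projection T E"
  then obtain E where E: "gz_projection T E" by blast
  note p = gz_projection_pair[OF E]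
  show "gz_invertible UNIV T"
    unfolding gz_invertible_def left_gz_invertible_def right_gz_invertible_def surjective_op_def
    using p(1) bij_imp_bounded_below[OF p(2,3,4)] bij_betw_imp_surj_on[OF p(4)] by blast
qed

section \<open>Finite ascent and descent\<close>

lemma kernel_funpow_stable:
  assumes eq: "kernel M (T ^^ m) = kernel M (T ^^ (m + 1))" and inv: "\<And>x. x \<in> M \<Longrightarrow> T x \<in> M"
    and x: "x \<in> M" "(T ^^ (m + k)) x = 0"
  shows "(T ^^ m) x = 0"
  using x
proof (induction k arbitrary: x)
  case (Suc k)
  have "(T ^^ k) x \<in> M" using Suc.prems(1) inv by (induction k) auto
  moreover have "T ^^ (m + Suc k) = T ^^ (m + 1) \<circ> T ^^ k"
    unfolding funpow_add[symmetric] by simp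
  then have "(T ^^ (m + 1)) ((T ^^ k) x) = 0" using Suc.prems(2) by simp
  ultimately have "(T ^^ k) x \<in> kernel M (T ^^ m)" unfolding eq by (simp add: kernel_def)
  then have "(T ^^ (m + k)) x = 0" by (simp add: kernel_def funpow_add)
  then show ?case using Suc.IH Suc.prems(1) by blast
qed simp

lemma range_funpow_stable:
  fixes T :: "'a \<Rightarrow> 'a"
  assumes eq: "(T ^^ m) ` M = (T ^^ (m + 1)) ` M"
  shows "(T ^^ (m + k)) ` M = (T ^^ m) ` M"
proof (induction k)
  case (Suc k)
  have "(T ^^ (m + Suc k)) ` M = (T ^^ k) ` ((T ^^ (m + 1)) ` M)"
  proof -
    have "T ^^ (m + Suc k) = T ^^ k \<circ> T ^^ (m + 1)"
      unfolding funpow_add[symmetric] by (simp add: add.commute)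
    then show ?thesis by (simp only: image_comp)
  qed
  also have "\<dots> = (T ^^ (m + k)) ` M"
  proof -
    have "T ^^ (m + k) = T ^^ k \<circ> T ^^ m"
      unfolding funpow_add[symmetric] by (simp add: add.commute)
    then show ?thesis by (simp only: image_comp eq[symmetric])
  qed
  finally show ?case using Suc by simp
qed simp

lemma zeroloid_nilpotent:
  assumes M: "closed_subspace M" and T: "T \<in> bounded_ops M" and nil: "\<And>x. x \<in> M \<Longrightarrow> (T ^^ n) x = 0"
  shows "zeroloid M T"
proof (rule spectrum_subset_0_imp_zeroloid, rule subsetI, rule ccontr)
  fix z assume z: "z \<in> spectrum M T" "z \<notin> {0}"
  have "bij_betw (\<lambda>x. z ^ n *\<^sub>C x - (T ^^ n) x) M M \<longleftrightarrow> bij_betw (\<lambda>x. z ^ n *\<^sub>C x) M M"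
    by (rule bij_betw_cong) (simp add: nil)
  then have "bij_betw (\<lambda>x. z *\<^sub>C x - T x) M M"
    using bij_scaleC[OF M, of "z ^ n"] z(2) by (intro shift_bij_of_power[OF M T, of z n]) simp
  then show False using z(1) spectrum_iff_not_bij[OF M T] by blast
qed

text \<open>
  With \<open>n\<close> beyond ascent and descent, \<open>M\<close> is the direct sum of \<open>T\<^sup>n ` M\<close> and the kernel of \<open>T\<^sup>n\<close> on \<open>M\<close>. The
  projection is onto \<open>T\<^sup>n ` M\<close> along the kernel \<open>W\<close> of \<open>T\<^sup>n E\<close>, where \<open>E\<close> is the projection onto \<open>M\<close> along \<open>N\<close>;
  that \<open>W\<close> is closed is evident, and it is the sum of \<open>N\<close> and the nilpotent part of \<open>M\<close>.
\<close>

lemma finite_ascent_descent_imp_gz_projection: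
  assumes T: "T \<in> bounded_ops UNIV" and MN: "(M, N) \<in> Red UNIV T" and z: "zeroloid N T"
    and asc: "ascent M T < \<infinity>" and desc: "descent M T < \<infinity>"
  shows "\<exists>F. gz_projection T F"
proof -
  note U = closed_subspace_UNIV
  note M = Red_closed(1,3)[OF T MN]
  obtain E where E: "reduced_operator UNIV T E" "range E = M" "{x. E x = 0} = N"
    using Red_imp_projection[OF T MN] by blast
  interpret E: reduced_operator UNIV T E by (fact E(1))
  note Eop = E.E
  obtain m1 where m1: "kernel M (T ^^ m1) = kernel M (T ^^ (m1 + 1))"
    using enat_Inf_finite[OF asc[unfolded ascent_def]] by (rule exE)
  obtain m2 where m2: "(T ^^ m2) ` M = (T ^^ (m2 + 1)) ` M"
    using enat_Inf_finite[OF desc[unfolded descent_def]] by (rule exE)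
  define n where "n = m1 + m2"
  have ker: "(T ^^ n) x = 0" if "x \<in> M" "(T ^^ (n + k)) x = 0" for x k
  proof -
    have "(T ^^ m1) x = 0"
      using kernel_funpow_stable[OF m1 op_in[OF M] that(1), of "m2 + k"] that(2) by (simp add: n_def add_ac)
    then show ?thesis
      using op_0[OF M(1) bounded_ops_funpow[OF M(2,1)], of m2] funpow_add[of m2 m1 T] by (simp add: n_def add_ac)
  qed
  have ran: "(T ^^ (n + k)) ` M = (T ^^ n) ` M" for k
    using range_funpow_stable[OF m2, of "m1 + k"] range_funpow_stable[OF m2, of m1] by (simp add: n_def add_ac)
  have Tn: "T ^^ n \<in> bounded_ops UNIV" by (rule bounded_ops_funpow[OF T U])
  have TnM: "T ^^ n \<in> bounded_ops M" by (rule bounded_ops_funpow[OF M(2,1)])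
  have EM: "E x \<in> M" for x using E(2) by blast
  have fixM: "E x = x" if "x \<in> M" for x using that E.fix_range E(2) by simp
  define W where "W = {x. (T ^^ n) (E x) = 0}"
  have W: "closed_subspace W"
    unfolding W_def using op_kernel_closed_subspace[OF U bounded_ops_compose[OF Tn Eop U]] by simp
  have "\<exists>F. bounded_projection UNIV F \<and> range F = (T ^^ n) ` M \<and> {x. F x = 0} = W"
  proof (rule projection_onto_operator_range[OF M(1) W TnM])
    fix y
    have "(T ^^ n) (E y) \<in> (T ^^ (n + n)) ` M" unfolding ran using EM by blast
    then obtain v where v: "v \<in> M" "(T ^^ n) (E y) = (T ^^ (n + n)) v" by (rule imageE) auto
    have "E ((T ^^ n) v) = (T ^^ n) v" using fixM op_in[OF M(1) TnM v(1)] by blast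
    then have "(T ^^ n) (E (y - (T ^^ n) v)) = 0"
      using v(2) op_diff[OF U Eop, of y "(T ^^ n) v"] op_diff[OF U Tn, of "E y" "(T ^^ n) v"]
      by (simp add: funpow_add)
    then have "y - (T ^^ n) v \<in> W" unfolding W_def by simp
    then show "\<exists>x\<in>M. \<exists>w\<in>W. y = (T ^^ n) x + w"
      using v(1) by (intro bexI[of _ v] bexI[of _ "y - (T ^^ n) v"]) auto
  next
    show "(T ^^ n) ` M \<inter> W \<subseteq> {0}"
    proof
      fix w assume w: "w \<in> (T ^^ n) ` M \<inter> W"
      then obtain v where v: "v \<in> M" "w = (T ^^ n) v" by blast
      have "E w = w" using fixM op_in[OF M(1) TnM v(1)] v(2) by blast
      then have "(T ^^ n) w = 0" using w unfolding W_def by simp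
      then have "(T ^^ (n + n)) v = 0" unfolding v(2) by (simp add: funpow_add)
      then show "w \<in> {0}" using ker[OF v(1)] v(2) by simp
    qed
  qed
  then obtain F where F: "bounded_projection UNIV F" "range F = (T ^^ n) ` M" "{x. F x = 0} = W" by blast
  have TR: "T ` ((T ^^ n) ` M) = (T ^^ n) ` M"
    using ran[of 1] by (simp add: image_comp o_def)
  have comm: "(T ^^ n) (T x) = T ((T ^^ n) x)" for x by (simp add: funpow_swap1)
  have Fr: "reduced_operator UNIV T F"
  proof (rule reduced_operatorI[OF T])
    show "F \<in> bounded_ops UNIV" "\<And>x. F (F x) = F x" using F(1) unfolding bounded_projection_def by auto
    show "T x \<in> range F" if "x \<in> range F" for x using that TR unfolding F(2) by blast
    show "F (T x) = 0" if "F x = 0" for x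
    proof -
      have "x \<in> W" using that F(3) by blast
      then have "(T ^^ n) (E (T x)) = 0" unfolding W_def using E.comm[of x] comm op_0[OF U T] by simp
      then have "T x \<in> W" unfolding W_def by simp
      then show ?thesis using F(3) by blast
    qed
  qed
  interpret F: reduced_operator UNIV T F by (fact Fr)
  have "bij_betw T (range F) (range F)"
    unfolding bij_betw_def
  proof
    show "inj_on T (range F)"
      unfolding op_inj_iff[OF F.closed_subspace_range F.bounded_range]
    proof (intro ballI impI)
      fix x assume x: "x \<in> range F" "T x = 0"
      then have "x \<in> (T ^^ n) ` M" unfolding F(2) by blast
      then obtain v where v: "v \<in> M" "x = (T ^^ n) v" by (rule imageE) auto
      then have "(T ^^ (n + 1)) v = 0" using x(2) by simp
      then show "x = 0" using ker[OF v(1)] v(2) by blast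
    qed
    show "T ` range F = range F" unfolding F(2) by (rule TR)
  qed
  moreover have "zeroloid {x. F x = 0} T"
  proof -
    have EW: "E x \<in> W" if "x \<in> W" for x using that E.idem unfolding W_def by simp
    have TW: "T \<in> bounded_ops W" using F.bounded_kernel F(3) by simp
    interpret W: reduced_operator W T E
      by standard (use W TW bounded_ops_restrict[OF Eop _ EW] E.idem E.comm in auto)
    have "zeroloid (E ` W) T"
    proof (rule zeroloid_nilpotent[OF W.closed_subspace_range W.bounded_range])
      fix x assume "x \<in> E ` W"
      then show "(T ^^ n) x = 0" unfolding W_def by auto
    qed
    moreover have "{x \<in> W. E x = 0} = N"
      using E(3) op_0[OF U Tn] unfolding W_def by auto
    ultimately show ?thesis unfolding F(3) using W.zeroloid_split z by simp
  qed
  ultimately show ?thesis unfolding gz_projection_def using Fr by blast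
qed

lemma gz_browder_iff:
  assumes T: "T \<in> bounded_ops UNIV"
  shows "gz_browder UNIV T \<longleftrightarrow> (\<exists>E. gz_projection T E)"
proof
  assume "gz_browder UNIV T"
  then show "\<exists>E. gz_projection T E"
    unfolding gz_browder_def browder_def using finite_ascent_descent_imp_gz_projection[OF T] by blast
next
  assume "\<exists>E. gz_projection T E"
  then obtain E where E: "gz_projection T E" by blast
  note p = gz_projection_pair[OF E]
  have "kernel (range E) T = {0}"
    using bij_betw_imp_inj_on[OF p(4)] op_0[OF p(2,3)] closed_subspace_0[OF p(2)]
    unfolding op_inj_iff[OF p(2,3)] kernel_def by blast
  then have 1: "finite_dim (kernel (range E) T)"
    unfolding finite_dim_def by (intro exI[of _ "{}"]) simp
  have "complex_vector.span (T ` range E \<union> {}) = range E"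
    unfolding bij_betw_imp_surj_on[OF p(4)] using p(2) by (simp add: closed_subspace_def)
  then have "fredholm (range E) T" unfolding fredholm_def using 1 by blast
  then have "browder (range E) T"
    unfolding browder_def using bij_ascent_descent(1,2)[OF p(2,3,4)] by simp
  then show "gz_browder UNIV T" unfolding gz_browder_def using gzKD_D[OF p(1)] by blast
qed

lemma drazin_invertible_imp_finite:
  assumes M: "closed_subspace M" and T: "T \<in> bounded_ops M" and d: "drazin_invertible M T"
  shows "ascent M T < \<infinity>" "descent M T < \<infinity>"
proof -
  obtain S n where S: "S \<in> bounded_ops M" "\<forall>x\<in>M. S (T x) = T (S x)" "\<forall>x\<in>M. (T ^^ n) (S (T x)) = (T ^^ n) x"
    using d unfolding drazin_invertible_def by blast
  have TM: "(T ^^ k) x \<in> M" if "x \<in> M" for k x using op_in[OF M bounded_ops_funpow[OF T M] that] .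
  have ST: "S ((T ^^ k) x) = (T ^^ k) (S x)" if "x \<in> M" for k x
  proof (induction k)
    case (Suc k)
    then show ?case using S(2) TM[OF that, of k] by simp
  qed simp
  have key: "(T ^^ n) x = S ((T ^^ (n + 1)) x)" if "x \<in> M" for x
    using S(3) ST[OF op_in[OF M T that], of n] that by (simp add: funpow_swap1)
  have "kernel M (T ^^ n) = kernel M (T ^^ (n + 1))"
  proof (intro equalityI subsetI)
    show "x \<in> kernel M (T ^^ (n + 1))" if "x \<in> kernel M (T ^^ n)" for x
      using that op_0[OF M T] by (simp add: kernel_def)
    show "x \<in> kernel M (T ^^ n)" if "x \<in> kernel M (T ^^ (n + 1))" for x
      using that key[of x] op_0[OF M S(1)] unfolding kernel_def by simp
  qed
  then have "ascent M T \<le> enat n" unfolding ascent_def by (intro Inf_lower) blast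
  then show "ascent M T < \<infinity>" using enat_ord_simps(4) le_less_trans by blast
  have "(T ^^ n) ` M = (T ^^ (n + 1)) ` M"
  proof (intro equalityI subsetI)
    fix y assume "y \<in> (T ^^ n) ` M"
    then obtain x where x: "x \<in> M" "y = (T ^^ n) x" by (rule imageE) auto
    have "y = (T ^^ (n + 1)) (S x)" unfolding x(2) key[OF x(1)] by (rule ST[OF x(1)])
    then show "y \<in> (T ^^ (n + 1)) ` M" using op_in[OF M S(1) x(1)] by blast
  next
    fix y assume "y \<in> (T ^^ (n + 1)) ` M"
    then obtain x where x: "x \<in> M" "y = (T ^^ (n + 1)) x" by (rule imageE) auto
    then have "y = (T ^^ n) (T x)" by (simp add: funpow_swap1)
    then show "y \<in> (T ^^ n) ` M" using op_in[OF M T x(1)] by blast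
  qed
  then have "descent M T \<le> enat n" unfolding descent_def by (intro Inf_lower) blast
  then show "descent M T < \<infinity>" using enat_ord_simps(4) le_less_trans by blast
qed

lemma gzKD_drazin_iff:
  assumes T: "T \<in> bounded_ops UNIV"
  shows "(\<exists>(M, N)\<in>gzKD UNIV T. drazin_invertible M T) \<longleftrightarrow> (\<exists>E. gz_projection T E)"
proof
  assume "\<exists>(M, N)\<in>gzKD UNIV T. drazin_invertible M T"
  then obtain M N where MN: "(M, N) \<in> gzKD UNIV T" "drazin_invertible M T" by blast
  note D = gzKD_D[OF MN(1)]
  note M = Red_closed(1,3)[OF T D(1)]
  show "\<exists>E. gz_projection T E"
    by (rule finite_ascent_descent_imp_gz_projection[OF T D(1,3) drazin_invertible_imp_finite[OF M MN(2)]])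
next
  assume "\<exists>E. gz_projection T E"
  then obtain E where E: "gz_projection T E" by blast
  note p = gz_projection_pair[OF E]
  obtain S where S: "S \<in> bounded_ops (range E)" "\<forall>x\<in>range E. S (T x) = x \<and> T (S x) = x"
    using invertible_op_iff_bij[OF p(2,3)] p(4) unfolding invertible_op_def by blast
  have "drazin_invertible (range E) T"
    unfolding drazin_invertible_def
  proof (intro bexI[OF _ S(1)] conjI exI[of _ 0] ballI)
    fix x assume "x \<in> range E"
    then have inv: "S (T x) = x" "T (S x) = x" using S(2) by blast+
    show "S (T x) = T (S x)" by (simp only: inv)
    show "S (T (S x)) = S x" by (simp only: inv)
    show "(T ^^ 0) (S (T x)) = (T ^^ 0) x" by (simp only: inv)
  qed
  then show "\<exists>(M, N)\<in>gzKD UNIV T. drazin_invertible M T" using p(1) by blast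
qed

lemma gz_kato_iff:
  assumes T: "T \<in> bounded_ops UNIV"
  shows "gz_kato UNIV T \<and> p_tilde UNIV T = q_tilde UNIV T \<and> q_tilde UNIV T < \<infinity>
    \<longleftrightarrow> (\<exists>E. gz_projection T E)"
proof -
  define MN where "MN = (SOME MN. MN \<in> gzKD UNIV T)"
  obtain M N where pair: "MN = (M, N)" by (cases MN)
  have pq: "p_tilde UNIV T = ascent M T" "q_tilde UNIV T = descent M T"
    using pair by (simp_all add: p_tilde_def q_tilde_def MN_def[symmetric])
  have chosen: "(M, N) \<in> gzKD UNIV T" if "X \<in> gzKD UNIV T" for X
    using someI[of "\<lambda>MN. MN \<in> gzKD UNIV T", OF that] pair by (simp add: MN_def[symmetric])
  show ?thesis
  proof
    assume a: "gz_kato UNIV T \<and> p_tilde UNIV T = q_tilde UNIV T \<and> q_tilde UNIV T < \<infinity>"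
    then have in_gz: "(M, N) \<in> gzKD UNIV T" using chosen unfolding gz_kato_def by blast
    note D = gzKD_D[OF in_gz]
    show "\<exists>E. gz_projection T E"
      using a unfolding pq by (intro finite_ascent_descent_imp_gz_projection[OF T D(1,3)]) auto
  next
    assume "\<exists>E. gz_projection T E"
    then obtain E where E: "gz_projection T E" by blast
    note MN' = chosen[OF gz_projection_pair(1)[OF E]]
    have "bij_betw T M M" by (rule gzKD_bij_independent[OF T E MN'])
    then have "ascent M T = 0" "descent M T = 0"
      using bij_ascent_descent(1,2)[OF Red_closed(1,3)[OF T gzKD_D(1)[OF MN']]] by blast+
    then show "gz_kato UNIV T \<and> p_tilde UNIV T = q_tilde UNIV T \<and> q_tilde UNIV T < \<infinity>"
      unfolding pq gz_kato_def using MN' by auto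
  qed
qed

section \<open>Commuting inverses and projections\<close>

text \<open>
  The inverse of \<open>T\<close> on the range of \<open>E\<close>, extended by zero on the kernel.
\<close>

lemma gz_projection_partial_inverse:
  assumes "gz_projection T E"
  shows "\<exists>S\<in>bounded_ops UNIV. \<forall>x. S (T x) = E x \<and> T (S x) = E x \<and> S (E x) = S x \<and> E (S x) = S x"
proof -
  note U = closed_subspace_UNIV
  note p = gz_projection_pair[OF assms]
  interpret reduced_operator UNIV T E using assms by (simp add: gz_projection_def)
  obtain S where S: "S \<in> bounded_ops (range E)" "\<forall>x\<in>range E. S (T x) = x \<and> T (S x) = x"
    using invertible_op_iff_bij[OF p(2,3)] p(4) unfolding invertible_op_def by blast
  have ST: "S (T (E x)) = E x" "T (S (E x)) = E x" for x using S(2) by blast+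
  have "S (E x) \<in> range E" for x by (rule op_in[OF p(2) S(1)]) simp
  then have ES: "E (S (E x)) = S (E x)" for x by (rule fix_range)
  have EE: "E (E x) = E x" for x using idem by simp
  have "(\<lambda>x. S (E x)) \<in> bounded_ops UNIV"
  proof -
    obtain K where K: "K > 0" "\<forall>x\<in>range E. norm (S x) \<le> K * norm x" using op_bound[OF p(2) S(1)] by blast
    obtain L where L: "L > 0" "\<forall>x\<in>UNIV. norm (E x) \<le> L * norm x" using op_bound[OF U E] by blast
    show ?thesis
    proof (rule bounded_opsI[where K = "K * L"])
      show "S (E (x + y)) = S (E x) + S (E y)" for x y
        unfolding op_add[OF U E UNIV_I UNIV_I] by (rule op_add[OF p(2) S(1)]) simp_all
      show "S (E (c *\<^sub>C x)) = c *\<^sub>C S (E x)" for c x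
        unfolding op_scaleC[OF U E UNIV_I] by (rule op_scaleC[OF p(2) S(1)]) simp
      show "norm (S (E x)) \<le> K * L * norm x" for x
      proof -
        have "norm (S (E x)) \<le> K * norm (E x)" using K(2) by blast
        also have "\<dots> \<le> K * (L * norm x)" using K(1) L(2) by (intro mult_left_mono) auto
        finally show ?thesis by (simp add: mult.assoc)
      qed
    qed simp
  qed
  moreover have "S (E (T x)) = E x" for x using comm[of x] ST(1)[of x] by simp
  ultimately show ?thesis using ST(2) ES EE by (intro bexI[of _ "\<lambda>x. S (E x)"]) auto
qed

lemma zeroloid_zero: "closed_subspace M \<Longrightarrow> zeroloid M (\<lambda>x. 0)"
proof (rule zeroloid_nilpotent[where n = 1])
  show "(\<lambda>x. 0) \<in> bounded_ops M" if "closed_subspace M"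
    by (rule bounded_opsI[where K = 0]) (auto simp: closed_subspace_0[OF that])
qed auto

lemma zeroloid_by_projection:
  assumes E: "reduced_operator UNIV W E"
    and M: "\<And>x. E x = x \<Longrightarrow> W x = V x" and N: "\<And>x. E x = 0 \<Longrightarrow> W x = V' x"
  shows "zeroloid UNIV W \<longleftrightarrow> zeroloid (range E) V \<and> zeroloid {x. E x = 0} V'"
proof -
  interpret reduced_operator UNIV W E by (fact E)
  have "zeroloid (range E) W \<longleftrightarrow> zeroloid (range E) V"
    by (rule zeroloid_cong) (use M fix_range in blast)
  moreover have "zeroloid {x. E x = 0} W \<longleftrightarrow> zeroloid {x. E x = 0} V'"
    by (rule zeroloid_cong) (use N in blast)
  ultimately show ?thesis using zeroloid_split by simp
qed

text \<open>
  The projection is \<open>T S\<close>. On its kernel \<open>T\<^sup>2 S - T\<close> is \<open>- T\<close>, and on its range it vanishes.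
\<close>

lemma gz_inverse_iff:
  assumes T: "T \<in> bounded_ops UNIV"
  shows "(\<exists>S\<in>bounded_ops UNIV. drazin_invertible UNIV S \<and> T \<circ> S = S \<circ> T \<and> S \<circ> T \<circ> S = S
          \<and> zeroloid UNIV (\<lambda>x. T (T (S x)) - T x)) \<longleftrightarrow> (\<exists>E. gz_projection T E)"
proof
  note U = closed_subspace_UNIV
  assume "\<exists>S\<in>bounded_ops UNIV. drazin_invertible UNIV S \<and> T \<circ> S = S \<circ> T \<and> S \<circ> T \<circ> S = S
          \<and> zeroloid UNIV (\<lambda>x. T (T (S x)) - T x)"
  then obtain S where S: "S \<in> bounded_ops UNIV" "T \<circ> S = S \<circ> T" "S \<circ> T \<circ> S = S"
    and z: "zeroloid UNIV (\<lambda>x. T (T (S x)) - T x)" by blast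
  have TS: "T (S x) = S (T x)" for x using fun_cong[OF S(2), of x] by simp
  have STS: "S (T (S x)) = S x" for x using fun_cong[OF S(3), of x] by simp
  define E where "E x = T (S x)" for x
  have Eop: "E \<in> bounded_ops UNIV" unfolding E_def[abs_def] by (rule bounded_ops_compose[OF T S(1) U])
  have idem: "E (E x) = E x" for x unfolding E_def STS by (rule refl)
  have comm: "E (T x) = T (E x)" for x unfolding E_def TS by (rule refl)
  have Zop: "(\<lambda>x. T (T (S x)) - T x) \<in> bounded_ops UNIV"
    by (rule bounded_ops_diff[OF bounded_ops_compose[OF T bounded_ops_compose[OF T S(1) U] U] T U])
  have T0: "T 0 = 0" by (rule op_0[OF U T])
  interpret red: reduced_operator UNIV T E by standard (use U T Eop idem comm in auto)
  have red': "reduced_operator UNIV (\<lambda>x. T (T (S x)) - T x) E"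
  proof
    fix x
    have "E (T (T (S x)) - T x) = E (T (T (S x))) - E (T x)" by (rule op_diff[OF U Eop UNIV_I UNIV_I])
    also have "\<dots> = T (T (E (S x))) - T (E x)" unfolding comm by (rule refl)
    also have "E (S x) = S (E x)" unfolding E_def TS by (rule refl)
    finally show "E (T (T (S x)) - T x) = T (T (S (E x))) - T (E x)" .
  qed (use U Zop Eop idem in auto)
  have "zeroloid {x. E x = 0} (\<lambda>x. - T x)"
  proof -
    have "T (T (S x)) - T x = - T x" if "E x = 0" for x
    proof -
      have "T (S x) = 0" using that unfolding E_def .
      then show ?thesis using T0 by simp
    qed
    then show ?thesis
      using z zeroloid_by_projection[OF red', of "\<lambda>x. T (T (S x)) - T x" "\<lambda>x. - T x"] by simp
  qed
  then have "zeroloid {x. E x = 0} T"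
    using zeroloid_uminus[of "{x. E x = 0}" T] red.closed_subspace_kernel red.bounded_kernel by simp
  moreover have "bij_betw T (range E) (range E)"
  proof (rule bij_betw_byWitness[where f' = S])
    have fixE: "T (S x) = x" if "x \<in> range E" for x using red.fix_range[OF that] unfolding E_def .
    show "\<forall>x\<in>range E. S (T x) = x" using fixE TS by simp
    show "\<forall>x\<in>range E. T (S x) = x" using fixE by simp
    show "T ` range E \<subseteq> range E" using red.range_invariant by blast
    show "S ` range E \<subseteq> range E"
    proof
      fix y assume "y \<in> S ` range E"
      then obtain x where "y = S x" by blast
      then have "y = E y" unfolding E_def by (simp add: TS STS[unfolded TS])
      then show "y \<in> range E" by (rule range_eqI)
    qed
  qed
  ultimately show "\<exists>E. gz_projection T E" unfolding gz_projection_def using red.reduced_operator_axioms by blast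
next
  note U = closed_subspace_UNIV
  assume "\<exists>E. gz_projection T E"
  then obtain E where E: "gz_projection T E" by blast
  interpret red: reduced_operator UNIV T E using E by (simp add: gz_projection_def)
  obtain S where S: "S \<in> bounded_ops UNIV"
    and inv: "\<And>x. S (T x) = E x" "\<And>x. T (S x) = E x" "\<And>x. S (E x) = S x" "\<And>x. E (S x) = S x"
    using gz_projection_partial_inverse[OF E] by blast
  have idem: "E (E x) = E x" and comm: "E (T x) = T (E x)" for x using red.idem red.comm by auto
  have "drazin_invertible UNIV S"
    unfolding drazin_invertible_def
  proof (intro bexI[of _ "\<lambda>x. T (E x)"] conjI ballI exI[of _ 1])
    fix x
    show "T (E (S x)) = S (T (E x))" by (simp add: inv idem)
    show "T (E (S (T (E x)))) = T (E x)" by (simp add: inv idem)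
    show "(S ^^ 1) (T (E (S x))) = (S ^^ 1) x" by (simp add: inv idem)
  qed (rule bounded_ops_compose[OF T red.E U])
  moreover have "T \<circ> S = S \<circ> T" "S \<circ> T \<circ> S = S" by (simp_all add: fun_eq_iff inv)
  moreover have "zeroloid UNIV (\<lambda>x. T (T (S x)) - T x)"
  proof -
    have op: "(\<lambda>x. T (E x) - T x) \<in> bounded_ops UNIV"
      by (rule bounded_ops_diff[OF bounded_ops_compose[OF T red.E U] T U])
    have red': "reduced_operator UNIV (\<lambda>x. T (E x) - T x) E"
    proof
      fix x show "E (T (E x) - T x) = T (E (E x)) - T (E x)"
        using op_diff[OF U red.E, of "T (E x)" "T x"] by (simp add: comm)
    qed (use U op red.E idem in auto)
    have 0: "zeroloid (range E) (\<lambda>x. 0)" by (rule zeroloid_zero[OF red.closed_subspace_range])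
    have zN: "zeroloid {x. E x = 0} (\<lambda>x. - T x)"
    proof (rule zeroloid_uminus)
      show N: "closed_subspace {x. E x = 0}" using red.closed_subspace_kernel by simp
      show "(\<lambda>x. - T x) \<in> bounded_ops {x. E x = 0}"
        using bounded_ops_minus[OF red.bounded_kernel red.closed_subspace_kernel] by simp
      show "zeroloid {x. E x = 0} (\<lambda>x. - (- T x))" using E by (simp add: gz_projection_def)
    qed
    have "zeroloid UNIV (\<lambda>x. T (E x) - T x)"
      using zeroloid_by_projection[OF red', of "\<lambda>x. 0" "\<lambda>x. - T x"] 0 zN op_0[OF U T] by simp
    then show ?thesis by (simp add: inv)
  qed
  ultimately show "\<exists>S\<in>bounded_ops UNIV. drazin_invertible UNIV S \<and> T \<circ> S = S \<circ> T \<and> S \<circ> T \<circ> S = S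
          \<and> zeroloid UNIV (\<lambda>x. T (T (S x)) - T x)" using S by blast
qed

text \<open>
  The projection is \<open>P\<close> itself: on its range \<open>V T\<close> and \<open>T U\<close> are the identity, which makes \<open>T\<close> injective
  and surjective there.
\<close>

lemma one_sided_factor_iff:
  assumes T: "T \<in> bounded_ops UNIV"
  shows "(\<exists>P. bounded_projection UNIV P \<and> P \<circ> T = T \<circ> P
          \<and> (\<exists>U\<in>bounded_ops UNIV. \<exists>V\<in>bounded_ops UNIV. P = T \<circ> U \<and> P = V \<circ> T)
          \<and> zeroloid UNIV (\<lambda>x. T (x - P x))) \<longleftrightarrow> (\<exists>E. gz_projection T E)" (is "?L \<longleftrightarrow> ?R")
proof -
  note U = closed_subspace_UNIV
  have key: "zeroloid UNIV (\<lambda>x. T (x - P x)) \<longleftrightarrow> zeroloid {x. P x = 0} T"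
    if P: "reduced_operator UNIV T P" for P
  proof -
    interpret P: reduced_operator UNIV T P by (fact P)
    have op: "(\<lambda>x. T (x - P x)) \<in> bounded_ops UNIV"
      by (rule bounded_ops_compose[OF T bounded_ops_diff[OF bounded_ops_id P.E U] U])
    have "reduced_operator UNIV (\<lambda>x. T (x - P x)) P"
    proof
      fix x show "P (T (x - P x)) = T (P x - P (P x))"
        using P.comm[of "x - P x"] op_diff[OF U P.E, of x "P x"] by simp
    qed (use U op P.E P.idem in auto)
    from zeroloid_by_projection[OF this, of "\<lambda>x. 0" T] show ?thesis
      using zeroloid_zero[OF P.closed_subspace_range] op_0[OF U T] by simp
  qed
  show ?thesis
  proof
    assume ?L
    then obtain P A V where P: "bounded_projection UNIV P" "P \<circ> T = T \<circ> P"
      and A: "A \<in> bounded_ops UNIV" "P = T \<circ> A" and V: "V \<in> bounded_ops UNIV" "P = V \<circ> T"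
      and z: "zeroloid UNIV (\<lambda>x. T (x - P x))" by blast
    have PT: "P (T x) = T (P x)" for x using fun_cong[OF P(2), of x] by simp
    interpret P: reduced_operator UNIV T P
      by standard (use U T P(1) PT in \<open>auto simp: bounded_projection_def\<close>)
    have TA: "T (A x) = P x" and VT: "V (T x) = P x" for x
      using fun_cong[OF A(2), of x] fun_cong[OF V(2), of x] by simp_all
    have "bij_betw T (range P) (range P)"
      unfolding bij_betw_def
    proof
      show "inj_on T (range P)"
        unfolding op_inj_iff[OF P.closed_subspace_range P.bounded_range]
      proof (intro ballI impI)
        fix x assume x: "x \<in> range P" "T x = 0"
        then show "x = 0" using VT[of x] op_0[OF U V(1)] P.fix_range[OF x(1)] by simp
      qed
      have "x \<in> T ` range P" if x: "x \<in> range P" for x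
      proof -
        have "T (P (A x)) = x" using PT[of "A x"] TA[of x] P.fix_range[OF x] by simp
        then show ?thesis by (intro image_eqI[of _ T "P (A x)"]) auto
      qed
      then show "T ` range P = range P" using P.range_invariant by blast
    qed
    then show ?R unfolding gz_projection_def using P.reduced_operator_axioms key z by blast
  next
    assume ?R
    then obtain E where E: "gz_projection T E" by blast
    have red: "reduced_operator UNIV T E" using E by (simp add: gz_projection_def)
    interpret red: reduced_operator UNIV T E by (fact red)
    obtain S where S: "S \<in> bounded_ops UNIV"
      and inv: "\<And>x. S (T x) = E x" "\<And>x. T (S x) = E x" using gz_projection_partial_inverse[OF E] by blast
    have "bounded_projection UNIV E" using red.E red.idem by (simp add: bounded_projection_def)
    moreover have "E \<circ> T = T \<circ> E" "E = T \<circ> S" "E = S \<circ> T" using red.comm by (simp_all add: fun_eq_iff inv)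
    moreover have "zeroloid UNIV (\<lambda>x. T (x - E x))" using key[OF red] E by (simp add: gz_projection_def)
    ultimately show ?L using S by (intro exI[of _ E]) blast
  qed
qed

lemma isolated_zero_imp_punctured_resolvent:
  assumes E: "reduced_operator UNIV W E"
    and e: "e > 0" "\<And>z. z \<noteq> 0 \<Longrightarrow> cmod z < e \<Longrightarrow> bij_betw (\<lambda>x. z *\<^sub>C x - W x) (range E) (range E)"
    and d: "d > 0" "\<And>z. z \<noteq> 0 \<Longrightarrow> cmod z < d \<Longrightarrow> bij_betw (\<lambda>x. z *\<^sub>C x - W x) {x. E x = 0} {x. E x = 0}"
  shows "punctured_resolvent W (min e d)"
proof
  interpret reduced_operator UNIV W E by (fact E)
  show "W \<in> bounded_ops UNIV" by (fact A)
  show "bij (\<lambda>x. z *\<^sub>C x - W x)" if "z \<noteq> 0" "cmod z < min e d" for z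
    using reduced_operator.bij_split[OF shift[of z]] e(2) d(2) that by simp
qed (use e d in simp)

lemma generalized_drazin_imp_punctured_resolvent:
  assumes W: "W \<in> bounded_ops UNIV" and g: "generalized_drazin_invertible UNIV W"
  shows "\<exists>\<delta>. punctured_resolvent W \<delta>"
proof -
  obtain M N where R: "(M, N) \<in> Red UNIV W" and i: "invertible_op M W" and q: "spectrum N W \<subseteq> {0}"
    using g unfolding generalized_drazin_invertible_def quasi_nilpotent_def by blast
  obtain F where F: "reduced_operator UNIV W F" "range F = M" "{x. F x = 0} = N"
    using Red_imp_projection[OF W R] by blast
  note M = Red_closed(1,3)[OF W R] and N = Red_closed(2,4)[OF W R]
  obtain e where e: "e > 0" "\<forall>z. cmod z < e \<longrightarrow> bij_betw (\<lambda>x. z *\<^sub>C x - W x) M M"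
    using bij_perturbation[OF M] i invertible_op_iff_bij[OF M] by blast
  have n: "bij_betw (\<lambda>x. z *\<^sub>C x - W x) N N" if "z \<noteq> 0" for z
    using q that spectrum_iff_not_bij[OF N, of z] by blast
  have "punctured_resolvent W (min e 1)"
    by (rule isolated_zero_imp_punctured_resolvent[OF F(1)]) (use e n F(2,3) in auto)
  then show ?thesis by blast
qed

lemma punctured_resolvent_imp_generalized_drazin:
  assumes "punctured_resolvent W \<delta>"
  shows "generalized_drazin_invertible UNIV W"
proof -
  interpret punctured_resolvent W \<delta> by (fact assms)
  obtain Q where Q: "Q \<in> bounded_ops UNIV" "\<And>x. Q (Q x) = Q x"
    and comm: "\<And>B x. B \<in> bounded_ops UNIV \<Longrightarrow> (\<And>x. B (W x) = W (B x)) \<Longrightarrow> B (Q x) = Q (B x)"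
    and b: "bij_betw W {x. Q x = 0} {x. Q x = 0}" and s: "spectrum (range Q) W \<subseteq> {0}"
    using riesz_projection by blast
  have red: "reduced_operator UNIV W Q"
    by standard (use closed_subspace_UNIV A Q comm[OF A] in auto)
  interpret red: reduced_operator UNIV W Q by (fact red)
  have "invertible_op {x. Q x = 0} W"
    using invertible_op_iff_bij[OF red.closed_subspace_kernel red.bounded_kernel] b by simp
  then show ?thesis
    unfolding generalized_drazin_invertible_def quasi_nilpotent_def
    using reduced_operator_imp_Red(2)[OF red] s by blast
qed

text \<open>
  Away from \<open>0\<close> the spectrum of a zeroloid operator is discrete, so \<open>w\<close> is at worst an isolated point of it.
\<close>

lemma zeroloid_isolated:
  assumes "zeroloid N T" "w \<noteq> 0"
  shows "\<exists>d>0. \<forall>z. z \<noteq> 0 \<longrightarrow> cmod z < d \<longrightarrow> z + w \<notin> spectrum N T"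
proof -
  have "\<not> w islimpt spectrum N T" using assms unfolding zeroloid_def acc_points_def by blast
  then obtain d where d: "d > 0" "\<And>x. x \<in> spectrum N T \<Longrightarrow> x \<noteq> w \<Longrightarrow> \<not> dist x w < d"
    unfolding islimpt_approachable by blast
  have "z + w \<notin> spectrum N T" if "z \<noteq> 0" "cmod z < d" for z
    using d(2)[of "z + w"] that by (auto simp: dist_norm)
  then show ?thesis using d(1) by blast
qed

text \<open>
  Given a \<open>gz_projection\<close> \<open>E\<close>, take \<open>P = 1 - E\<close>. Then \<open>T + P\<close> is the invertible \<open>T\<close> on the range of \<open>E\<close> and
  \<open>T + 1\<close> on its kernel, where \<open>0\<close> is at worst an isolated point of the spectrum because \<open>-1\<close> is at worst
  an isolated point of the spectrum of \<open>T\<close>.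

  Conversely, let \<open>Q\<close> be the Riesz projection of \<open>T + P\<close> at \<open>0\<close>. It commutes with \<open>P\<close> and \<open>T\<close>, and
  \<open>E = (1 - P) (1 - Q)\<close> works: \<open>T\<close> and \<open>T + P\<close> agree on the kernel of \<open>P\<close>, so \<open>T\<close> is bijective on the range
  of \<open>E\<close>. The kernel of \<open>E\<close> is the sum of the range of \<open>P\<close>, where \<open>T\<close> is zeroloid by hypothesis, and of a part
  of the range of \<open>Q\<close> in the kernel of \<open>P\<close>, where the spectrum of \<open>T\<close> is contained in \<open>{0}\<close>.
\<close>

lemma perturbed_drazin_iff:
  assumes T: "T \<in> bounded_ops UNIV"
  shows "(\<exists>P. bounded_projection UNIV P \<and> P \<circ> T = T \<circ> P
          \<and> generalized_drazin_invertible UNIV (\<lambda>x. T x + P x)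
          \<and> zeroloid UNIV (T \<circ> P)) \<longleftrightarrow> (\<exists>E. gz_projection T E)" (is "?L \<longleftrightarrow> ?R")
proof
  note U = closed_subspace_UNIV
  assume ?R
  then obtain E where E: "gz_projection T E" by blast
  note pr = gz_projection_pair[OF E]
  interpret red: reduced_operator UNIV T E using E by (simp add: gz_projection_def)
  have zN: "zeroloid {x. E x = 0} T" using E by (simp add: gz_projection_def)
  have idem: "E (E x) = E x" and comm: "E (T x) = T (E x)" for x using red.idem red.comm by auto
  define P where "P x = x - E x" for x
  have Pop: "P \<in> bounded_ops UNIV" unfolding P_def[abs_def] by (rule bounded_ops_diff[OF bounded_ops_id red.E U])
  have EP: "E (P x) = 0" for x unfolding P_def using op_diff[OF U red.E, of x "E x"] idem by simp
  have PP: "P (P x) = P x" for x unfolding P_def[of "P x"] EP by simp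
  have PT: "P (T x) = T (P x)" for x unfolding P_def using op_diff[OF U T, of x "E x"] comm by simp
  have PE: "P (E x) = 0" for x by (simp add: P_def idem)
  have "zeroloid UNIV (T \<circ> P)"
  proof -
    have "reduced_operator UNIV (T \<circ> P) E"
    proof
      show "T \<circ> P \<in> bounded_ops UNIV" unfolding o_def by (rule bounded_ops_compose[OF T Pop U])
      fix x show "E ((T \<circ> P) x) = (T \<circ> P) (E x)" using comm[of "P x"] by (simp add: EP PE)
    qed (use U red.E idem in auto)
    from zeroloid_by_projection[OF this, of "\<lambda>x. 0" T] show ?thesis
      using zeroloid_zero[OF red.closed_subspace_range] zN op_0[OF U T] by (simp add: P_def)
  qed
  moreover have "generalized_drazin_invertible UNIV (\<lambda>x. T x + P x)"
  proof -
    have Wop: "(\<lambda>x. T x + P x) \<in> bounded_ops UNIV" by (rule bounded_ops_add[OF T Pop U])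
    have redW: "reduced_operator UNIV (\<lambda>x. T x + P x) E"
    proof
      fix x show "E (T x + P x) = T (E x) + P (E x)"
        using op_add[OF U red.E, of "T x" "P x"] comm[of x] by (simp add: EP PE)
    qed (use U Wop red.E idem in auto)
    obtain e where e: "e > 0" "\<forall>z. cmod z < e \<longrightarrow> bij_betw (\<lambda>x. z *\<^sub>C x - T x) (range E) (range E)"
      using bij_perturbation[OF pr(2,3,4)] by blast
    \<comment> \<open>On the kernel of \<open>E\<close> the operator is \<open>T + 1\<close>, so \<open>z\<close> corresponds to the spectral point \<open>z - 1\<close> of \<open>T\<close>.\<close>
    obtain d where d: "d > 0" "\<forall>z. z \<noteq> 0 \<longrightarrow> cmod z < d \<longrightarrow> z + -1 \<notin> spectrum {x. E x = 0} T"
      using zeroloid_isolated[OF zN, of "-1"] by auto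
    have N: "closed_subspace {x. E x = 0}" "T \<in> bounded_ops {x. E x = 0}"
      using red.closed_subspace_kernel red.bounded_kernel by auto
    have "punctured_resolvent (\<lambda>x. T x + P x) (min e d)"
    proof (rule isolated_zero_imp_punctured_resolvent[OF redW])
      show "bij_betw (\<lambda>x. z *\<^sub>C x - (T x + P x)) (range E) (range E)" if "cmod z < e" for z
      proof -
        have "bij_betw (\<lambda>x. z *\<^sub>C x - (T x + P x)) (range E) (range E)
            \<longleftrightarrow> bij_betw (\<lambda>x. z *\<^sub>C x - T x) (range E) (range E)"
          by (rule bij_betw_cong) (auto simp: PE)
        then show ?thesis using e(2) that by blast
      qed
      show "bij_betw (\<lambda>x. z *\<^sub>C x - (T x + P x)) {x. E x = 0} {x. E x = 0}" if "z \<noteq> 0" "cmod z < d" for z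
      proof -
        have "bij_betw (\<lambda>x. z *\<^sub>C x - (T x + P x)) {x. E x = 0} {x. E x = 0}
            \<longleftrightarrow> bij_betw (\<lambda>x. (z + -1) *\<^sub>C x - T x) {x. E x = 0} {x. E x = 0}"
        proof (rule bij_betw_cong)
          fix x assume "x \<in> {x. E x = 0}"
          then have "P x = x" by (simp add: P_def)
          then show "z *\<^sub>C x - (T x + P x) = (z + -1) *\<^sub>C x - T x"
            unfolding scaleC_add_left scaleC_minus1 by simp
        qed
        then show ?thesis using d(2) that spectrum_iff_not_bij[OF N] by blast
      qed
    qed (use e d in auto)
    then show ?thesis by (rule punctured_resolvent_imp_generalized_drazin)
  qed
  moreover have "bounded_projection UNIV P" "P \<circ> T = T \<circ> P"
    using Pop PP PT by (auto simp: bounded_projection_def)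
  ultimately show ?L by blast
next
  note U = closed_subspace_UNIV
  assume ?L
  then obtain P where P: "bounded_projection UNIV P" "P \<circ> T = T \<circ> P"
    and gd: "generalized_drazin_invertible UNIV (\<lambda>x. T x + P x)" and z: "zeroloid UNIV (T \<circ> P)" by blast
  have Pop: "P \<in> bounded_ops UNIV" and PP: "P (P x) = P x" for x
    using P(1) unfolding bounded_projection_def by auto
  have PT: "P (T x) = T (P x)" for x using fun_cong[OF P(2), of x] by simp
  define W where "W x = T x + P x" for x
  have Wop: "W \<in> bounded_ops UNIV" unfolding W_def[abs_def] by (rule bounded_ops_add[OF T Pop U])
  have TW: "T (W x) = W (T x)" for x unfolding W_def using op_add[OF U T, of "T x" "P x"] PT by simp
  have PW: "P (W x) = W (P x)" for x unfolding W_def using op_add[OF U Pop, of "T x" "P x"] PT by simp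
  have W_ker: "W x = T x" if "P x = 0" for x using that by (simp add: W_def)
  obtain \<delta> where "punctured_resolvent W \<delta>"
    using generalized_drazin_imp_punctured_resolvent[OF Wop] gd unfolding W_def[abs_def] by blast
  then interpret R: punctured_resolvent W \<delta> .
  obtain Q where Q: "Q \<in> bounded_ops UNIV" "\<And>x. Q (Q x) = Q x"
    and comm: "\<And>B x. B \<in> bounded_ops UNIV \<Longrightarrow> (\<And>x. B (W x) = W (B x)) \<Longrightarrow> B (Q x) = Q (B x)"
    and b: "bij_betw W {x. Q x = 0} {x. Q x = 0}" and s: "spectrum (range Q) W \<subseteq> {0}"
    using R.riesz_projection by blast
  have QT: "Q (T x) = T (Q x)" for x using comm[OF T TW] by simp
  have QP: "Q (P x) = P (Q x)" for x using comm[OF Pop PW] by simp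
  have QW: "Q (W x) = W (Q x)" for x using comm[OF Wop refl] by simp
  interpret Q: reduced_operator UNIV W Q by standard (use U Wop Q QW in auto)
  interpret P: reduced_operator UNIV T P by standard (use U T Pop PP PT in auto)
  have P0: "P 0 = 0" and Q0: "Q 0 = 0" using op_0[OF U Pop] op_0[OF U Q(1)] by auto
  have Tdiff: "T (x - y) = T x - T y" and Pdiff: "P (x - y) = P x - P y" and Qdiff: "Q (x - y) = Q x - Q y" for x y
    using op_diff[OF U T] op_diff[OF U Pop] op_diff[OF U Q(1)] by auto
  define E where "E x = (x - Q x) - P (x - Q x)" for x
  have E_eq: "E x = x - Q x - (P x - P (Q x))" for x unfolding E_def Pdiff by (rule refl)
  have IQ: "(\<lambda>x. x - Q x) \<in> bounded_ops UNIV" by (rule bounded_ops_diff[OF bounded_ops_id Q(1) U])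
  have Eop: "E \<in> bounded_ops UNIV"
    unfolding E_def[abs_def] by (rule bounded_ops_diff[OF IQ bounded_ops_compose[OF Pop IQ U] U])
  have PE: "P (E x) = 0" for x unfolding E_def using Pdiff[of "x - Q x" "P (x - Q x)"] PP by simp
  have QE: "Q (E x) = 0" for x unfolding E_eq by (simp add: Qdiff QP Q(2))
  have Efix: "E x = x" if "P x = 0" "Q x = 0" for x using that by (simp add: E_def)
  have EE: "E (E x) = E x" for x by (rule Efix[OF PE QE])
  have rangeE: "range E = {x. P x = 0 \<and> Q x = 0}"
  proof (intro equalityI subsetI)
    show "x \<in> range E" if "x \<in> {x. P x = 0 \<and> Q x = 0}" for x
      using Efix[of x] that by (intro image_eqI[of _ E x]) auto
  qed (use PE QE in auto)
  have ET: "E (T x) = T (E x)" for x unfolding E_eq by (simp add: QT PT Tdiff)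
  have EP: "E (P x) = 0" for x unfolding E_eq by (simp add: QP PP)
  interpret E: reduced_operator UNIV T E by standard (use U T Eop EE ET in auto)

  have kerQ: "reduced_operator {x. Q x = 0} W P"
  proof
    show "closed_subspace {x. Q x = 0}" "W \<in> bounded_ops {x. Q x = 0}"
      using Q.closed_subspace_kernel Q.bounded_kernel by auto
    show "P \<in> bounded_ops {x. Q x = 0}"
      by (rule bounded_ops_restrict[OF Pop subset_UNIV]) (simp add: QP P0)
  qed (use PP PW in auto)
  have rangeQ: "reduced_operator (range Q) W P"
  proof
    show "closed_subspace (range Q)" "W \<in> bounded_ops (range Q)"
      using Q.closed_subspace_range Q.bounded_range by auto
    show "P \<in> bounded_ops (range Q)"
      by (rule bounded_ops_restrict[OF Pop subset_UNIV]) (auto simp flip: QP)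
  qed (use PP PW in auto)

  have "bij_betw T (range E) (range E)"
  proof -
    have "{y \<in> {x. Q x = 0}. P y = 0} = range E" unfolding rangeE by blast
    then have "bij_betw W (range E) (range E)" using reduced_operator.bij_split[OF kerQ] b by simp
    moreover have "bij_betw W (range E) (range E) \<longleftrightarrow> bij_betw T (range E) (range E)"
      by (rule bij_betw_cong) (auto simp: W_ker PE)
    ultimately show ?thesis by blast
  qed
  moreover have "zeroloid {x. E x = 0} T"
  proof -
    let ?Z = "{x. E x = 0}"
    have Z: "reduced_operator ?Z T P"
    proof
      show "closed_subspace ?Z" "T \<in> bounded_ops ?Z" using E.closed_subspace_kernel E.bounded_kernel by auto
      show "P \<in> bounded_ops ?Z" by (rule bounded_ops_restrict[OF Pop subset_UNIV]) (simp add: EP)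
    qed (use PP PT in auto)
    have PZ: "P ` ?Z = range P"
    proof (intro equalityI subsetI)
      fix x assume "x \<in> range P"
      then have x: "P x = x" by (rule P.fix_range)
      have "E x = 0" using EP[of x] unfolding x .
      then show "x \<in> P ` ?Z" using imageI[of x ?Z P] x by simp
    qed blast
    have KZ: "{y \<in> ?Z. P y = 0} = {y \<in> range Q. P y = 0}"
    proof (intro equalityI subsetI)
      fix y assume "y \<in> {y \<in> ?Z. P y = 0}"
      then have y: "E y = 0" "P y = 0" by auto
      have "P (Q y) = 0" unfolding QP[symmetric] y(2) by (rule Q0)
      then have "y = Q y" using y unfolding E_eq by simp
      then have "y \<in> range Q" by (rule range_eqI)
      then show "y \<in> {y \<in> range Q. P y = 0}" using y(2) by simp
    next
      fix y assume "y \<in> {y \<in> range Q. P y = 0}"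
      then have "y \<in> range Q" and Py: "P y = 0" by simp_all
      from this(1) have Qy: "Q y = y" by (rule Q.fix_range)
      have "E y = 0" unfolding E_eq Qy Py by simp
      then show "y \<in> {y \<in> ?Z. P y = 0}" using Py by simp
    qed
    have "zeroloid (range P) T"
    proof -
      have "reduced_operator UNIV (T \<circ> P) P"
      proof
        show "T \<circ> P \<in> bounded_ops UNIV" unfolding o_def by (rule bounded_ops_compose[OF T Pop U])
      qed (use U Pop PP PT in auto)
      from zeroloid_by_projection[OF this, of T "T \<circ> P"] show ?thesis using z by simp
    qed
    moreover have "zeroloid {y \<in> range Q. P y = 0} T"
    proof -
      have "spectrum {y \<in> range Q. P y = 0} W \<subseteq> {0}"
        using reduced_operator.spectrum_split[OF rangeQ] s by blast
      then have "zeroloid {y \<in> range Q. P y = 0} W" by (rule spectrum_subset_0_imp_zeroloid)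
      moreover have "zeroloid {y \<in> range Q. P y = 0} W \<longleftrightarrow> zeroloid {y \<in> range Q. P y = 0} T"
        by (rule zeroloid_cong) (simp add: W_ker)
      ultimately show ?thesis by blast
    qed
    ultimately show ?thesis using reduced_operator.zeroloid_split[OF Z] unfolding PZ KZ by blast
  qed
  ultimately show ?R unfolding gz_projection_def using E.reduced_operator_axioms by blast
qed

theorem theorem4p7:
  fixes T :: "'a::complex_banach \<Rightarrow> 'a"
  assumes "\<not> finite_dim (UNIV :: 'a set)"
    and "T \<in> bounded_ops UNIV"
  shows
    "(gz_invertible UNIV T \<longleftrightarrow> gz_browder UNIV T)
   \<and> (gz_invertible UNIV T \<longleftrightarrow> (\<exists>(M, N)\<in>gzKD UNIV T. drazin_invertible M T))
   \<and> (gz_invertible UNIV T \<longleftrightarrow>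
       (\<exists>S\<in>bounded_ops UNIV. drazin_invertible UNIV S \<and> T \<circ> S = S \<circ> T \<and> S \<circ> T \<circ> S = S
          \<and> zeroloid UNIV (\<lambda>x. T (T (S x)) - T x)))
   \<and> (gz_invertible UNIV T \<longleftrightarrow>
       (\<exists>P. bounded_projection UNIV P \<and> P \<circ> T = T \<circ> P
          \<and> generalized_drazin_invertible UNIV (\<lambda>x. T x + P x)
          \<and> zeroloid UNIV (T \<circ> P)))
   \<and> (gz_invertible UNIV T \<longleftrightarrow>
       (\<exists>P. bounded_projection UNIV P \<and> P \<circ> T = T \<circ> P
          \<and> (\<exists>U\<in>bounded_ops UNIV. \<exists>V\<in>bounded_ops UNIV. P = T \<circ> U \<and> P = V \<circ> T)
          \<and> zeroloid UNIV (\<lambda>x. T (x - P x))))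
   \<and> (gz_invertible UNIV T \<longleftrightarrow>
       gz_kato UNIV T \<and> p_tilde UNIV T = q_tilde UNIV T \<and> q_tilde UNIV T < \<infinity>)"
  unfolding gz_invertible_iff[OF assms(2)] gz_browder_iff[OF assms(2)] gzKD_drazin_iff[OF assms(2)]
    gz_inverse_iff[OF assms(2)] perturbed_drazin_iff[OF assms(2)] one_sided_factor_iff[OF assms(2)]
    gz_kato_iff[OF assms(2)]
  by simp

end
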